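(* Let $0<\alpha<1$, $T>0$, $0<\nu<\mu$, $Y=(0,\ell_1)$ with $\ell_1>0$, and let $\Omega\subset\mathbb{R}$ be a bounded open interval. Let $x_0\in\Omega$ and $t_1\in(0,T)$ be arbitrarily chosen. Let $a_1,a_2\in L^\infty(Y)$ be $Y$-periodic with $\nu\le a_k\le\mu$ on $\overline Y$ ($k=1,2$) and $a_1(y)\ge a_2(y)$ for $y\in\overline Y$, let $a_k^0=1/\mathcal{M}_Y(1/a_k)$, let $u_{0,1},u_{0,2}\in H^2(\Omega)\cap H_0^1(\Omega)$, and let $u_k^0$ be the weak solution of the homogenized problem $$\partial_t^\alpha u_k^0-\partial_x(a_k^0\partial_xu_k^0)=0\ \text{in }\Omega\times(0,T),\quad u_k^0=0\ \text{on }\partial\Omega\times(0,T),\quad u_k^0(\cdot,0)=u_{0,k}\ \text{in }\Omega.$$ Assume that $P_1u_{0,1}(x_0)\ne0$ and $P_1u_{0,2}(x_0)\ne0$. If $u_1^0(x_0,t)=u_2^0(x_0,t)$ for $0<t<t_1$, then $a_1=a_2$ a.e. on $Y$.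
   Context: $\mathcal{M}_Y(g)=\frac1{|Y|}\int_Yg\,dy$; $Y$-periodic means $\ell_1$-periodic on $\mathbb{R}$. The problem for $u_k^0$ is the homogenization limit, as $\varepsilon\to0$, of the problems with coefficient $a_k(x/\varepsilon)$ and initial values converging weakly in $L^2(\Omega)$ to $u_{0,k}$. Eigenprojection: $\lambda_1>0$ is the smallest eigenvalue of $-\Delta=-\frac{d^2}{dx^2}$ in $L^2(\Omega)$ with domain $H^2(\Omega)\cap H_0^1(\Omega)$; $P_1$ is the $L^2(\Omega)$-orthogonal projection onto $\ker(-\Delta-\lambda_1)$. Fractional derivative: for a Hilbert space $X$ and $\beta>0$, $J^\beta v(t)=\frac1{\Gamma(\beta)}\int_0^t(t-s)^{\beta-1}v(s)\,ds$. $H^\alpha(0,T;X)$ is the Sobolev–Slobodeckij space; $H_\alpha(0,T;X)$ is $H^\alpha(0,T;X)$ if $\alpha<\frac12$; $\{u\in H^{1/2}(0,T;X):\int_0^T\|u(t)\|_X^2t^{-1}dt<\infty\}$ if $\alpha=\frac12$; $\{u\in H^\alpha(0,T;X):u(0)=0\}$ if $\alpha>\frac12$. The map $J^\alpha:L^2(0,T;X)\to H_\alpha(0,T;X)$ is an isomorphism and $\partial_t^\alpha:=(J^\alpha)^{-1}$ (generalized Caputo derivative). Weak solution: $u_k^0$ is the unique function in $L^2(0,T;H_0^1(\Omega))$ with $u_k^0-u_{0,k}\in H_\alpha(0,T;H^{-1}(\Omega))$ such that for a.e. $t$ and all $\Phi\in H_0^1(\Omega)$, $\langle\partial_t^\alpha(u_k^0-u_{0,k}),\Phi\rangle_{H^{-1},H_0^1}+a_k^0(\partial_xu_k^0,\partial_x\Phi)_{L^2(\Omega)}=0$.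 For $t>0$, $u_k^0(\cdot,t)\in H^2(\Omega)\subset C(\overline\Omega)$, so point values are those of the continuous representative. *)

theory Defs
  imports "HOL-Analysis.Analysis"
begin

text \<open>Throughout, elements of Lebesgue and Sobolev spaces are represented by functions, to be read
  modulo equality almost everywhere; \<open>\<Omega>\<close> is an open subset of the real line.\<close>

section \<open>Lebesgue and Sobolev spaces on an open set\<close>

definition L2 :: "real set \<Rightarrow> (real \<Rightarrow> real) set" where
  "L2 \<Omega> = {f. f \<in> borel_measurable (lebesgue_on \<Omega>) \<and>
              integrable (lebesgue_on \<Omega>) (\<lambda>x. (f x)\<^sup>2)}"

definition Linfty :: "real set \<Rightarrow> (real \<Rightarrow> real) set" where
  "Linfty \<Omega> = {f. f \<in> borel_measurable (lebesgue_on \<Omega>) \<and>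
                  (\<exists>C. AE x in lebesgue_on \<Omega>. \<bar>f x\<bar> \<le> C)}"

definition test_functions :: "real set \<Rightarrow> (real \<Rightarrow> real) set" where
  "test_functions \<Omega> =
     {\<phi>. (\<forall>n x. (deriv ^^ n) \<phi> field_differentiable (at x)) \<and>
         (\<exists>K. compact K \<and> K \<subseteq> \<Omega> \<and> (\<forall>x. x \<notin> K \<longrightarrow> \<phi> x = 0))}"

definition locally_integrable :: "real set \<Rightarrow> (real \<Rightarrow> real) \<Rightarrow> bool" where
  "locally_integrable \<Omega> f \<longleftrightarrow>
     (\<forall>K. compact K \<and> K \<subseteq> \<Omega> \<longrightarrow> integrable (lebesgue_on K) f)"

definition is_weak_deriv :: "real set \<Rightarrow> (real \<Rightarrow> real) \<Rightarrow> (real \<Rightarrow> real) \<Rightarrow> bool" where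
  "is_weak_deriv \<Omega> f g \<longleftrightarrow> locally_integrable \<Omega> f \<and> locally_integrable \<Omega> g \<and>
     (\<forall>\<phi>\<in>test_functions \<Omega>.
        (LINT x|lebesgue_on \<Omega>. f x * deriv \<phi> x) = - (LINT x|lebesgue_on \<Omega>. g x * \<phi> x))"

text \<open>Unspecified when \<open>f\<close> is not weakly differentiable; otherwise unique up to null sets.\<close>

definition weak_deriv :: "real set \<Rightarrow> (real \<Rightarrow> real) \<Rightarrow> real \<Rightarrow> real" where
  "weak_deriv \<Omega> f = (SOME g. is_weak_deriv \<Omega> f g)"

definition H1 :: "real set \<Rightarrow> (real \<Rightarrow> real) set" where
  "H1 \<Omega> = {f \<in> L2 \<Omega>. \<exists>g\<in>L2 \<Omega>. is_weak_deriv \<Omega> f g}"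

definition H2 :: "real set \<Rightarrow> (real \<Rightarrow> real) set" where
  "H2 \<Omega> = {f \<in> H1 \<Omega>. weak_deriv \<Omega> f \<in> H1 \<Omega>}"

definition H1_norm :: "real set \<Rightarrow> (real \<Rightarrow> real) \<Rightarrow> real" where
  "H1_norm \<Omega> f =
     sqrt ((LINT x|lebesgue_on \<Omega>. (f x)\<^sup>2) + (LINT x|lebesgue_on \<Omega>. (weak_deriv \<Omega> f x)\<^sup>2))"

definition H10 :: "real set \<Rightarrow> (real \<Rightarrow> real) set" where
  "H10 \<Omega> = {f \<in> H1 \<Omega>. \<exists>\<phi>. (\<forall>n::nat. \<phi> n \<in> test_functions \<Omega>) \<and>
                          (\<lambda>n. H1_norm \<Omega> (f - \<phi> n)) \<longlonglongrightarrow> 0}"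

text \<open>The dual space of \<open>H10 \<Omega>\<close>. Only the values of a functional on \<open>H10 \<Omega>\<close> matter.\<close>

definition Hm1 :: "real set \<Rightarrow> ((real \<Rightarrow> real) \<Rightarrow> real) set" where
  "Hm1 \<Omega> =
     {F. (\<forall>f\<in>H10 \<Omega>. \<forall>g\<in>H10 \<Omega>. \<forall>c d. F (\<lambda>x. c * f x + d * g x) = c * F f + d * F g) \<and>
         (\<exists>C. \<forall>f\<in>H10 \<Omega>. \<bar>F f\<bar> \<le> C * H1_norm \<Omega> f)}"

definition Hm1_norm :: "real set \<Rightarrow> ((real \<Rightarrow> real) \<Rightarrow> real) \<Rightarrow> real" where
  "Hm1_norm \<Omega> F = (SUP f\<in>{f \<in> H10 \<Omega>. H1_norm \<Omega> f \<le> 1}. \<bar>F f\<bar>)"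

definition L2_into_Hm1 :: "real set \<Rightarrow> (real \<Rightarrow> real) \<Rightarrow> (real \<Rightarrow> real) \<Rightarrow> real" where
  "L2_into_Hm1 \<Omega> f = (\<lambda>\<Phi>. LINT x|lebesgue_on \<Omega>. f x * \<Phi> x)"

text \<open>Value at \<open>x\<close> of the representative of \<open>f\<close> that is continuous on the closure of \<open>\<Omega>\<close>.\<close>

definition point_value :: "real set \<Rightarrow> (real \<Rightarrow> real) \<Rightarrow> real \<Rightarrow> real" where
  "point_value \<Omega> f x =
     (SOME g. continuous_on (closure \<Omega>) g \<and> (AE y in lebesgue_on \<Omega>. g y = f y)) x"

section \<open>The Dirichlet Laplacian\<close>

definition neg_laplace :: "real set \<Rightarrow> (real \<Rightarrow> real) \<Rightarrow> real \<Rightarrow> real" where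
  "neg_laplace \<Omega> f = (\<lambda>x. - weak_deriv \<Omega> (weak_deriv \<Omega> f) x)"

definition eigenspace :: "real set \<Rightarrow> real \<Rightarrow> (real \<Rightarrow> real) set" where
  "eigenspace \<Omega> \<kappa> =
     {f \<in> H2 \<Omega> \<inter> H10 \<Omega>. AE x in lebesgue_on \<Omega>. neg_laplace \<Omega> f x - \<kappa> * f x = 0}"

definition is_eigenvalue :: "real set \<Rightarrow> real \<Rightarrow> bool" where
  "is_eigenvalue \<Omega> \<kappa> \<longleftrightarrow> (\<exists>f\<in>eigenspace \<Omega> \<kappa>. \<not> (AE x in lebesgue_on \<Omega>. f x = 0))"

definition lambda1 :: "real set \<Rightarrow> real" where
  "lambda1 \<Omega> = (LEAST \<kappa>. is_eigenvalue \<Omega> \<kappa>)"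

definition P1 :: "real set \<Rightarrow> (real \<Rightarrow> real) \<Rightarrow> real \<Rightarrow> real" where
  "P1 \<Omega> f = (SOME p. p \<in> eigenspace \<Omega> (lambda1 \<Omega>) \<and>
     (\<forall>q\<in>eigenspace \<Omega> (lambda1 \<Omega>). (LINT x|lebesgue_on \<Omega>. (f x - p x) * q x) = 0))"

section \<open>Function spaces in time\<close>

text \<open>Both \<open>H10 \<Omega>\<close> and \<open>Hm1 \<Omega>\<close> are sets \<open>X\<close> of functions, with a seminorm \<open>N\<close> whose
  null elements represent 0. The spaces below are those over the interval from 0 to \<open>T\<close> with
  values in the normed space given by \<open>X\<close> and \<open>N\<close>.\<close>

definition strongly_measurable ::
    "real \<Rightarrow> ('z \<Rightarrow> real) set \<Rightarrow> (('z \<Rightarrow> real) \<Rightarrow> real) \<Rightarrow> (real \<Rightarrow> 'z \<Rightarrow> real) \<Rightarrow> bool" where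
  "strongly_measurable T X N v \<longleftrightarrow>
     (\<exists>s. (\<forall>n::nat. simple_function (lebesgue_on {0<..<T}) (s n) \<and> (\<forall>t. s n t \<in> X)) \<and>
          (AE t in lebesgue_on {0<..<T}. (\<lambda>n. N (s n t - v t)) \<longlonglongrightarrow> 0))"

definition L2_time ::
    "real \<Rightarrow> ('z \<Rightarrow> real) set \<Rightarrow> (('z \<Rightarrow> real) \<Rightarrow> real) \<Rightarrow> (real \<Rightarrow> 'z \<Rightarrow> real) set" where
  "L2_time T X N =
     {v. (AE t in lebesgue_on {0<..<T}. v t \<in> X) \<and> strongly_measurable T X N v \<and>
         (\<integral>\<^sup>+t. ennreal ((N (v t))\<^sup>2) \<partial>lebesgue_on {0<..<T}) < \<infinity>}"

definition H_slobodeckij ::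
    "real \<Rightarrow> real \<Rightarrow> ('z \<Rightarrow> real) set \<Rightarrow> (('z \<Rightarrow> real) \<Rightarrow> real) \<Rightarrow> (real \<Rightarrow> 'z \<Rightarrow> real) set" where
  "H_slobodeckij \<alpha> T X N =
     {v \<in> L2_time T X N.
        (\<integral>\<^sup>+t. (\<integral>\<^sup>+s. ennreal ((N (v t - v s))\<^sup>2 / \<bar>t - s\<bar> powr (1 + 2 * \<alpha>))
           \<partial>lebesgue_on {0<..<T}) \<partial>lebesgue_on {0<..<T}) < \<infinity>}"

text \<open>\<open>u(0) = 0\<close> for the representative of \<open>u\<close> that is continuous in time.\<close>

definition vanishes_at_0 ::
    "real \<Rightarrow> ('z \<Rightarrow> real) set \<Rightarrow> (('z \<Rightarrow> real) \<Rightarrow> real) \<Rightarrow> (real \<Rightarrow> 'z \<Rightarrow> real) \<Rightarrow> bool" where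
  "vanishes_at_0 T X N v \<longleftrightarrow>
     (\<exists>w. (\<forall>t\<in>{0..T}. w t \<in> X) \<and> (AE t in lebesgue_on {0<..<T}. N (v t - w t) = 0) \<and>
          (\<forall>t\<in>{0..T}. ((\<lambda>s. N (w s - w t)) \<longlongrightarrow> 0) (at t within {0..T})) \<and> N (w 0) = 0)"

definition H_sub ::
    "real \<Rightarrow> real \<Rightarrow> ('z \<Rightarrow> real) set \<Rightarrow> (('z \<Rightarrow> real) \<Rightarrow> real) \<Rightarrow> (real \<Rightarrow> 'z \<Rightarrow> real) set" where
  "H_sub \<alpha> T X N =
     {v \<in> H_slobodeckij \<alpha> T X N.
        (\<alpha> = 1/2 \<longrightarrow>
           (\<integral>\<^sup>+t. ennreal ((N (v t))\<^sup>2 / t) \<partial>lebesgue_on {0<..<T}) < \<infinity>) \<and>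
        (\<alpha> > 1/2 \<longrightarrow> vanishes_at_0 T X N v)}"

section \<open>Fractional derivative and weak solutions\<close>

text \<open>For a Bochner integrable function with values in a dual space, the value of the integral at
  \<open>\<Phi>\<close> is the integral of the values at \<open>\<Phi>\<close>; the integral is therefore taken pointwise.\<close>

definition J_frac :: "real \<Rightarrow> (real \<Rightarrow> 'z \<Rightarrow> real) \<Rightarrow> real \<Rightarrow> 'z \<Rightarrow> real" where
  "J_frac \<beta> v t =
     (\<lambda>\<Phi>. 1 / Gamma \<beta> * (LINT s|lebesgue_on {0<..<t}. (t - s) powr (\<beta> - 1) * v s \<Phi>))"

text \<open>The generalized Caputo derivative with values in the dual space, given by its graph: \<open>w\<close> is
  the (a.e. unique) preimage of \<open>v\<close> under \<open>J_frac \<alpha>\<close>, as a map from \<open>L2_time\<close> onto \<open>H_sub \<alpha>\<close>.\<close>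

definition has_caputo_deriv ::
    "real set \<Rightarrow> real \<Rightarrow> real \<Rightarrow> (real \<Rightarrow> (real \<Rightarrow> real) \<Rightarrow> real) \<Rightarrow>
     (real \<Rightarrow> (real \<Rightarrow> real) \<Rightarrow> real) \<Rightarrow> bool" where
  "has_caputo_deriv \<Omega> T \<alpha> v w \<longleftrightarrow>
     v \<in> H_sub \<alpha> T (Hm1 \<Omega>) (Hm1_norm \<Omega>) \<and> w \<in> L2_time T (Hm1 \<Omega>) (Hm1_norm \<Omega>) \<and>
     (AE t in lebesgue_on {0<..<T}. \<forall>\<Phi>\<in>H10 \<Omega>. v t \<Phi> = J_frac \<alpha> w t \<Phi>)"

text \<open>Here \<open>u t\<close> is the function of the space variable at time \<open>t\<close>.\<close>

definition weak_solution ::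
    "real set \<Rightarrow> real \<Rightarrow> real \<Rightarrow> real \<Rightarrow> (real \<Rightarrow> real) \<Rightarrow> (real \<Rightarrow> real \<Rightarrow> real) \<Rightarrow> bool" where
  "weak_solution \<Omega> T \<alpha> A u0 u \<longleftrightarrow>
     u \<in> L2_time T (H10 \<Omega>) (H1_norm \<Omega>) \<and>
     (\<exists>w. has_caputo_deriv \<Omega> T \<alpha> (\<lambda>t. L2_into_Hm1 \<Omega> (u t - u0)) w \<and>
        (AE t in lebesgue_on {0<..<T}. \<forall>\<Phi>\<in>H10 \<Omega>.
           w t \<Phi> + A * (LINT x|lebesgue_on \<Omega>. weak_deriv \<Omega> (u t) x * weak_deriv \<Omega> \<Phi> x) = 0))"

section \<open>Periodic coefficients\<close>

definition mean :: "real set \<Rightarrow> (real \<Rightarrow> real) \<Rightarrow> real" where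
  "mean Y g = 1 / measure lebesgue Y * (LINT y|lebesgue_on Y. g y)"

definition homogenized :: "real set \<Rightarrow> (real \<Rightarrow> real) \<Rightarrow> real" where
  "homogenized Y a = 1 / mean Y (\<lambda>y. 1 / a y)"

end

theory Submission
  imports Defs "HOL-Real_Asymp.Real_Asymp"
begin

text \<open>Write \<open>c i t\<close> for the sine coefficients of the solution \<open>u t\<close>. Testing the equation with the sines
  turns it into the Volterra equations \<open>c i + A \<lambda>\<^sub>i J\<^sup>\<alpha> (c i) = c i 0\<close>. Taking the Laplace transform in time over
  the observation interval \<open>(0, t1)\<close> only, instead of over the half line, changes the resolvent formula by
  a term of order \<open>exp (- s t1)\<close>, uniformly in \<open>i\<close>. No Mittag-Leffler functions and no analytic
  continuation in time are needed: with \<open>z = s\<^sup>\<alpha>\<close>, the difference of the two functions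
  \<open>\<Sum>\<^sub>i b\<^sub>i / (z + A \<lambda>\<^sub>i)\<close>, where \<open>b\<^sub>i\<close> is the \<open>i\<close>th sine term of the initial value at \<open>x0\<close>, is
  \<open>O (exp (- C z))\<close> for every \<open>C\<close>, because \<open>1 / \<alpha> > 1\<close>. This difference is the Laplace transform of the
  difference of the exponential sums \<open>\<Sum>\<^sub>i b\<^sub>i exp (- A \<lambda>\<^sub>i \<tau>)\<close>, which therefore vanishes. If \<open>A2 < A1\<close>, its
  slowest exponential is the first mode of the second solution, whose coefficient is nonzero since
  \<open>P1 u02 (x0)\<close> is. So \<open>A1 = A2\<close>, and \<open>a2 \<le> a1\<close> with equal harmonic means forces equality.\<close>

section \<open>Smooth functions\<close>

text \<open>Why a short observation suffices: an error \<open>exp (- C * z)\<close> in the transform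
  settles the exponential sums only up to time \<open>C\<close>. For \<open>\<alpha> = 1\<close> the
  available \<open>C\<close> would be \<open>t1\<close>, and analyticity would have to do the rest;
  for \<open>\<alpha> < 1\<close> every \<open>C\<close> is available, so the sums agree at almost
  all times, in particular at large ones, where decay rates can be compared. Up to a constant factor
  the sums are the values at \<open>x0\<close> of classical heat flows.

  The modewise estimates must be added up although the eigenvalues are unbounded. Dividing by the
  resolvent factor cancels the eigenvalue in the error; the remainder is summable by spatial
  regularity, since a bound in \<open>H10\<close> controls the square sum of frequency times
  coefficient, hence the absolute sum of the coefficients. The same fact makes the sine series the
  continuous representative, so point values need no separate embedding theorem.

  Weak derivatives, point values and \<open>P1\<close> are arbitrary choices among representatives;
  the argument therefore works with sine coefficients, which do not depend on the choice.\<close>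

definition flat :: "nat \<Rightarrow> real \<Rightarrow> real" where
  "flat k x = (if x > 0 then exp (- (1 / x)) / x ^ k else 0)"

lemma flat_nonneg: "0 \<le> flat k x"
  by (simp add: flat_def)

lemma power_le_fact_exp:
  fixes y :: real
  assumes "0 \<le> y"
  shows "y ^ n \<le> fact n * exp y"
proof -
  have "(\<Sum>i\<in>{n}. y ^ i /\<^sub>R fact i) \<le> (\<Sum>i. y ^ i /\<^sub>R fact i)"
    by (rule sum_le_suminf[OF summable_exp_generic]) (use assms in auto)
  then show ?thesis
    by (simp add: exp_def divide_simps mult.commute)
qed

text \<open>The exponential beats every power: this is \<open>y ^ n \<le> fact n * exp y\<close> at
  \<open>y = 1 / x\<close> and \<open>n = k + m\<close>. With \<open>m = 2\<close> it gives
  differentiability at 0, with \<open>m = 0\<close> boundedness.\<close>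

lemma flat_le: "flat k x \<le> fact (k + m) * \<bar>x\<bar> ^ m"
proof (cases "x > 0")
  case True
  have "(1 / x) ^ (k + m) \<le> fact (k + m) * exp (1 / x)"
    using power_le_fact_exp[of "1 / x" "k + m"] True by simp
  then have "exp (- (1 / x)) \<le> fact (k + m) * x ^ (k + m)"
    using True by (simp add: exp_minus field_simps)
  then show ?thesis using True by (simp add: flat_def power_add field_simps)
qed (simp add: flat_def)

text \<open>The index \<open>k\<close> exists for the sake of this formula: it makes the family
  closed under differentiation up to linear combinations.\<close>

lemma DERIV_flat: "(flat k has_real_derivative flat (k + 2) x - real k * flat (k + 1) x) (at x)"
proof -
  consider "x > 0" | "x < 0" | "x = 0" by linarith
  then show ?thesis
  proof cases
    case 1
    have "((\<lambda>x. exp (- (1 / x)) / x ^ k) has_real_derivative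
        flat (k + 2) x - real k * flat (k + 1) x) (at x)"
      using 1 by (cases k)
        (auto intro!: derivative_eq_intros simp: flat_def divide_simps power2_eq_square,
         auto simp: algebra_simps, metis Suc_pred neq0_conv power_Suc)
    then show ?thesis
      by (rule has_field_derivative_transform_within_open[where S = "{0<..}"])
        (use 1 in \<open>auto simp: flat_def\<close>)
  next
    case 2
    have "((\<lambda>x. 0) has_real_derivative flat (k + 2) x - real k * flat (k + 1) x) (at x)"
      using 2 by (simp add: flat_def)
    then show ?thesis
      by (rule has_field_derivative_transform_within_open[where S = "{..<0}"])
        (use 2 in \<open>auto simp: flat_def\<close>)
  next
    case 3
    have "((\<lambda>h. (flat k (0 + h) - flat k 0) / h) \<longlongrightarrow> 0) (at 0)"
    proof (rule Lim_null_comparison)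
      show "\<forall>\<^sub>F h in at 0. norm ((flat k (0 + h) - flat k 0) / h) \<le> fact (k + 2) * \<bar>h\<bar>"
      proof (rule always_eventually, intro allI)
        fix h :: real
        show "norm ((flat k (0 + h) - flat k 0) / h) \<le> fact (k + 2) * \<bar>h\<bar>"
        proof (cases "h = 0")
          case False
          then have "flat k h / \<bar>h\<bar> \<le> fact (k + 2) * \<bar>h\<bar>"
            using flat_le[of k h 2] by (simp add: pos_divide_le_eq power2_eq_square mult.assoc)
          then show ?thesis by (simp add: flat_nonneg flat_def)
        qed simp
      qed
      show "((\<lambda>h. fact (k + 2) * \<bar>h\<bar>) \<longlongrightarrow> (0::real)) (at 0)"
        by (auto intro!: tendsto_eq_intros)
    qed
    then show ?thesis using 3 by (simp add: DERIV_def flat_def)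
  qed
qed

text \<open>A concrete class that contains bumps and sines and is closed under differentiation.
  Closure alone provides the iterated derivatives of every order that \<open>test_functions\<close>
  asks for, without formulas for them. Cosines are covered as sines with shifted phase.\<close>

inductive_set smooth_funs :: "(real \<Rightarrow> real) set" where
  smooth_const: "(\<lambda>x. c) \<in> smooth_funs"
| smooth_flat: "(\<lambda>x. flat k (a * x + b)) \<in> smooth_funs"
| smooth_sin: "(\<lambda>x. sin (a * x + b)) \<in> smooth_funs"
| smooth_add: "f \<in> smooth_funs \<Longrightarrow> g \<in> smooth_funs \<Longrightarrow> (\<lambda>x. f x + g x) \<in> smooth_funs"
| smooth_mult: "f \<in> smooth_funs \<Longrightarrow> g \<in> smooth_funs \<Longrightarrow> (\<lambda>x. f x * g x) \<in> smooth_funs"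

lemma smooth_funs_DERIV:
  "f \<in> smooth_funs \<Longrightarrow> \<exists>f'\<in>smooth_funs. \<forall>x. (f has_real_derivative f' x) (at x)"
proof (induction rule: smooth_funs.induct)
  case (smooth_const c)
  then show ?case by (intro bexI[of _ "\<lambda>x. 0"]) (auto intro: smooth_funs.intros)
next
  case (smooth_flat k a b)
  have *: "\<forall>x. ((\<lambda>x. flat k (a * x + b)) has_real_derivative
      a * (flat (k + 2) (a * x + b) + (- real k) * flat (k + 1) (a * x + b))) (at x)"
  proof
    fix x
    have "((\<lambda>x. a * x + b) has_real_derivative a) (at x)"
      by (auto intro!: derivative_eq_intros)
    from DERIV_chain2[OF DERIV_flat[of k] this]
    show "((\<lambda>x. flat k (a * x + b)) has_real_derivative
      a * (flat (k + 2) (a * x + b) + (- real k) * flat (k + 1) (a * x + b))) (at x)"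
      by (simp add: algebra_simps)
  qed
  show ?case
    by (rule bexI[of _ "\<lambda>x. a * (flat (k + 2) (a * x + b) + (- real k) * flat (k + 1) (a * x + b))"])
      (use * in blast, intro smooth_funs.intros)
next
  case (smooth_sin a b)
  have *: "\<forall>x. ((\<lambda>x. sin (a * x + b)) has_real_derivative a * sin (a * x + (b + pi / 2))) (at x)"
    by (auto intro!: derivative_eq_intros simp: sin_add cos_add algebra_simps)
  show ?case
    by (rule bexI[of _ "\<lambda>x. a * sin (a * x + (b + pi / 2))"])
      (use * in blast, intro smooth_funs.intros)
next
  case (smooth_add f g)
  then obtain f' g' where *: "f' \<in> smooth_funs" "g' \<in> smooth_funs"
    "\<forall>x. (f has_real_derivative f' x) (at x)" "\<forall>x. (g has_real_derivative g' x) (at x)" by blast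
  show ?case
    by (rule bexI[of _ "\<lambda>x. f' x + g' x"])
      (use * in \<open>auto intro!: smooth_funs.intros derivative_eq_intros\<close>)
next
  case (smooth_mult f g)
  then obtain f' g' where *: "f' \<in> smooth_funs" "g' \<in> smooth_funs"
    "\<forall>x. (f has_real_derivative f' x) (at x)" "\<forall>x. (g has_real_derivative g' x) (at x)" by blast
  show ?case
    by (rule bexI[of _ "\<lambda>x. f' x * g x + g' x * f x"])
      (use * smooth_mult in \<open>auto intro!: smooth_funs.intros derivative_eq_intros\<close>)
qed

lemma smooth_funs_deriv_iter: "f \<in> smooth_funs \<Longrightarrow> (deriv ^^ n) f \<in> smooth_funs"
proof (induction n)
  case (Suc n)
  then obtain f' where "f' \<in> smooth_funs" "\<forall>x. ((deriv ^^ n) f has_real_derivative f' x) (at x)"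
    using smooth_funs_DERIV by blast
  moreover from this(2) have "deriv ((deriv ^^ n) f) = f'"
    by (auto intro!: DERIV_imp_deriv)
  ultimately show ?case by simp
qed simp

lemma smooth_funs_test_function:
  assumes "f \<in> smooth_funs" "compact K" "K \<subseteq> \<Omega>" "\<And>x. x \<notin> K \<Longrightarrow> f x = 0"
  shows "f \<in> test_functions \<Omega>"
proof -
  have "(deriv ^^ n) f field_differentiable at x" for n x
    using smooth_funs_DERIV[OF smooth_funs_deriv_iter[OF assms(1)]]
    by (meson field_differentiable_def)
  then show ?thesis using assms by (auto simp: test_functions_def)
qed

lemma smooth_funs_continuous: "f \<in> smooth_funs \<Longrightarrow> continuous_on A f"
  by (meson smooth_funs_DERIV DERIV_isCont continuous_at_imp_continuous_on)

section \<open>Weak derivatives on an interval\<close>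

lemma AE_zero_if_Ioc_integral_zero:
  fixes g :: "real \<Rightarrow> real"
  assumes g: "integrable lborel g"
    and zero: "\<And>a b. (LINT x:{a<..b}|lborel. g x) = 0"
  shows "AE x in lborel. g x = 0"
proof (rule sigma_finite_measure.density_zero[OF lborel.sigma_finite_measure_axioms g])
  \<comment> \<open>The integral over the whole line is needed for complements below; it is the
    limit of the integrals over growing intervals.\<close>
  have total: "(LINT x|lborel. g x) = 0"
  proof (rule LIMSEQ_unique)
    show "(\<lambda>n. LINT x:{- real n<..real n}|lborel. g x) \<longlonglongrightarrow> (LINT x|lborel. g x)"
      unfolding set_lebesgue_integral_def
    proof (rule integral_dominated_convergence[where w = "\<lambda>x. \<bar>g x\<bar>"])
      show "AE x in lborel. (\<lambda>n. indicat_real {- real n<..real n} x *\<^sub>R g x) \<longlonglongrightarrow> g x"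
      proof (rule AE_I2)
        fix x
        obtain N :: nat where N: "\<bar>x\<bar> < real N" using reals_Archimedean2 by blast
        have "\<forall>\<^sub>F n in sequentially. indicat_real {- real n<..real n} x *\<^sub>R g x = g x"
          using eventually_ge_at_top[of N] by eventually_elim (use N in \<open>auto simp: indicator_def\<close>)
        then show "(\<lambda>n. indicat_real {- real n<..real n} x *\<^sub>R g x) \<longlonglongrightarrow> g x"
          by (rule tendsto_eventually)
      qed
    qed (use g in \<open>auto simp: indicator_def\<close>)
    show "(\<lambda>n. LINT x:{- real n<..real n}|lborel. g x) \<longlonglongrightarrow> 0"
      by (simp add: zero)
  qed
  have si: "set_integrable lborel A g" if "A \<in> sets borel" for A
    unfolding set_integrable_def using integrable_mult_indicator[of A lborel g] g that by simp
  \<comment> \<open>Half-open intervals generate the Borel sets and are stable under intersection,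
    and the sets over which \<open>g\<close> integrates to 0 form a Dynkin system, so they comprise
    all Borel sets.\<close>
  let ?E = "range (\<lambda>(a, b). {a<..b::real})"
  have bs: "sets borel = sigma_sets UNIV ?E"
    by (subst borel_sigma_sets_Ioc) simp
  fix A :: "real set" assume "A \<in> sets lborel"
  then have A: "A \<in> sigma_sets UNIV ?E"
    by (simp add: bs)
  have "Int_stable ?E"
    unfolding Int_stable_def
  proof safe
    fix a b c d :: real
    have "{a<..b} \<inter> {c<..d} = (\<lambda>(a, b). {a<..b}) (max a c, min b d)" by auto
    then show "{a<..b} \<inter> {c<..d} \<in> ?E" by blast
  qed
  moreover have "?E \<subseteq> Pow UNIV" by simp
  ultimately show "(LINT x:A|lborel. g x) = 0"
    using A
  proof (induction rule: sigma_sets_induct_disjoint)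
    case (basic A)
    then show ?case using zero by auto
  next
    case empty
    show ?case by (simp add: set_lebesgue_integral_def)
  next
    case (compl A)
    then have A: "A \<in> sets borel" using bs by auto
    have "(LINT x:A \<union> (UNIV - A)|lborel. g x) = (LINT x:A|lborel. g x) + (LINT x:UNIV - A|lborel. g x)"
      by (rule set_integral_Un) (use A si in auto)
    then show ?case using total compl by (simp add: set_lebesgue_integral_def)
  next
    case (union A)
    have A: "A i \<in> sets borel" for i using union bs by auto
    have "(LINT x:(\<Union>i. A i)|lborel. g x) = (\<Sum>i. LINT x:A i|lborel. g x)"
      by (rule lebesgue_integral_countable_add)
        (use A si union in \<open>auto simp: disjoint_family_on_def\<close>)
    then show ?case using union by simp
  qed
qed

lemma AE_zero_if_Ioc_integral_zero_lebesgue: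
  fixes G :: "real \<Rightarrow> real"
  assumes G: "integrable lebesgue G"
    and zero: "\<And>a b. (LINT x|lebesgue. indicator {a<..b} x * G x) = 0"
  shows "AE x in lebesgue. G x = 0"
proof -
  obtain g where g[measurable]: "g \<in> borel_measurable lborel" and eq: "AE x in lborel. G x = g x"
    using completion_ex_borel_measurable_real[of G lborel] G by blast
  have eqc: "AE x in lebesgue. G x = g x" by (rule AE_completion[OF eq])
  have "integrable lebesgue g"
    using G integrable_cong_AE[of G lebesgue g] eqc measurable_completion[OF g] by auto
  then have gi: "integrable lborel g"
    using integrable_completion[of g lborel] g by simp
  have "AE x in lborel. g x = 0"
  proof (rule AE_zero_if_Ioc_integral_zero[OF gi])
    fix a b :: real
    have "(LINT x:{a<..b}|lborel. g x) = (LINT x|lebesgue. indicator {a<..b} x * g x)"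
      by (simp add: set_lebesgue_integral_def integral_completion)
    also have "\<dots> = (LINT x|lebesgue. indicator {a<..b} x * G x)"
      by (rule integral_cong_AE)
        (use eqc G measurable_completion[OF g] in
          \<open>auto intro!: borel_measurable_times borel_measurable_indicator\<close>)
    finally show "(LINT x:{a<..b}|lborel. g x) = 0" using zero by simp
  qed
  then show ?thesis using eqc AE_completion[of "\<lambda>x. g x = 0" lborel] by auto
qed

lemma continuous_imp_borel_measurable_lebesgue:
  fixes f :: "real \<Rightarrow> real"
  assumes "continuous_on UNIV f"
  shows "f \<in> borel_measurable lebesgue" "f \<in> borel_measurable (lebesgue_on S)"
proof -
  show *: "f \<in> borel_measurable lebesgue"
    using borel_measurable_continuous_onI[OF assms] by (intro measurable_completion) simp
  show "f \<in> borel_measurable (lebesgue_on S)"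
    using * by (rule measurable_restrict_space1)
qed

lemma test_functionsD:
  assumes "\<phi> \<in> test_functions \<Omega>"
  shows "\<exists>K. compact K \<and> K \<subseteq> \<Omega> \<and> (\<forall>x. x \<notin> K \<longrightarrow> \<phi> x = 0 \<and> deriv \<phi> x = 0)"
    "(\<phi> has_real_derivative deriv \<phi> x) (at x)" "continuous_on UNIV (deriv \<phi>)"
proof -
  from assms obtain K where K: "compact K" "K \<subseteq> \<Omega>" "\<And>x. x \<notin> K \<Longrightarrow> \<phi> x = 0"
    and d: "\<And>n x. (deriv ^^ n) \<phi> field_differentiable (at x)"
    by (auto simp: test_functions_def)
  show "(\<phi> has_real_derivative deriv \<phi> x) (at x)"
    using d[of 0 x] by (simp add: field_differentiable_derivI)
  show "continuous_on UNIV (deriv \<phi>)"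
    using d[of 1] by (auto intro!: continuous_at_imp_continuous_on field_differentiable_imp_continuous_at)
  have "deriv \<phi> x = 0" if "x \<notin> K" for x
  proof -
    have "((\<lambda>x. 0) has_real_derivative 0) (at x)" by simp
    then have "(\<phi> has_real_derivative 0) (at x)"
      by (rule has_field_derivative_transform_within_open[where S = "- K"])
        (use K that compact_imp_closed in auto)
    then show ?thesis by (rule DERIV_imp_deriv)
  qed
  then show "\<exists>K. compact K \<and> K \<subseteq> \<Omega> \<and> (\<forall>x. x \<notin> K \<longrightarrow> \<phi> x = 0 \<and> deriv \<phi> x = 0)"
    using K by blast
qed

lemma integrable_locally_integrable_mult:
  fixes f g :: "real \<Rightarrow> real"
  assumes g: "locally_integrable \<Omega> g" and K: "compact K" "K \<subseteq> \<Omega>" "\<And>x. x \<notin> K \<Longrightarrow> f x = 0"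
    and f: "continuous_on UNIV f" and \<Omega>: "\<Omega> \<in> sets lebesgue"
  shows "integrable (lebesgue_on \<Omega>) (\<lambda>x. g x * f x)"
proof -
  have Ks: "K \<in> sets lebesgue" using K by (simp add: compact_imp_closed)
  have gK: "integrable (lebesgue_on K) g" using g K by (simp add: locally_integrable_def)
  have fK: "continuous_on K f" using f continuous_on_subset by blast
  then have "compact (f ` K)" using K compact_continuous_image by blast
  then obtain B where B: "\<And>x. x \<in> K \<Longrightarrow> \<bar>f x\<bar> \<le> B"
    using compact_imp_bounded[of "f ` K"] by (auto simp: bounded_iff)
  have fm: "f \<in> borel_measurable (lebesgue_on K)"
    using continuous_imp_measurable_on_sets_lebesgue[OF fK Ks] .
  have "integrable (lebesgue_on K) (\<lambda>x. g x * f x)"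
  proof (rule Bochner_Integration.integrable_bound)
    show "integrable (lebesgue_on K) (\<lambda>x. B * g x)" using gK by simp
    show "AE x in lebesgue_on K. norm (g x * f x) \<le> norm (B * g x)"
    proof (rule AE_I2)
      fix x assume "x \<in> space (lebesgue_on K)"
      then have "\<bar>f x\<bar> \<le> \<bar>B\<bar>" using B by fastforce
      then show "norm (g x * f x) \<le> norm (B * g x)"
        by (simp add: abs_mult mult.commute mult_right_mono)
    qed
  qed (use gK fm in auto)
  then have "integrable lebesgue (\<lambda>x. if x \<in> K then g x * f x else 0)"
    by (simp add: Lebesgue_Measure.integrable_restrict_UNIV Ks)
  also have "(\<lambda>x. if x \<in> K then g x * f x else 0) = (\<lambda>x. if x \<in> \<Omega> then g x * f x else 0)"
    using K by (auto simp: fun_eq_iff)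
  finally show ?thesis by (simp add: Lebesgue_Measure.integrable_restrict_UNIV \<Omega>)
qed

lemma continuous_imp_locally_integrable:
  fixes f :: "real \<Rightarrow> real"
  assumes "continuous_on UNIV f"
  shows "locally_integrable \<Omega> f"
  unfolding locally_integrable_def
proof safe
  fix K :: "real set" assume K: "compact K"
  have fK: "continuous_on K f" using assms continuous_on_subset by blast
  then have "compact (f ` K)" using K compact_continuous_image by blast
  then obtain B where B: "\<And>x. x \<in> K \<Longrightarrow> \<bar>f x\<bar> \<le> B"
    using compact_imp_bounded[of "f ` K"] by (auto simp: bounded_iff)
  have Ks: "K \<in> lmeasurable" using K by (simp add: lmeasurable_compact)
  interpret finite_measure "lebesgue_on K" by (rule finite_measure_lebesgue_on[OF Ks])
  show "integrable (lebesgue_on K) f"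
    by (rule integrable_const_bound[where B = B])
      (use B continuous_imp_measurable_on_sets_lebesgue[OF fK] Ks in \<open>auto simp: fmeasurableD\<close>)
qed

text \<open>Bumps converge boundedly to the indicator of \<open>{a<..<b}\<close>, so
  \<open>g\<close> integrates to zero over intervals compactly contained in \<open>{p<..<q}\<close>.
  The detour over compact subintervals is forced because \<open>g\<close> may fail to be integrable
  up to the end points.\<close>

lemma integral_test_zero_imp_AE_zero:
  assumes g: "locally_integrable {p<..<q} g"
    and test: "\<And>\<phi>. \<phi> \<in> test_functions {p<..<q} \<Longrightarrow> (LINT x|lebesgue_on {p<..<q}. g x * \<phi> x) = 0"
  shows "AE x in lebesgue_on {p<..<q}. g x = 0"
proof -
  have gI: "integrable lebesgue (\<lambda>x. if x \<in> {a..b} then g x else 0)" if "p < a" "b < q" for a b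
  proof -
    have "integrable (lebesgue_on {a..b}) g"
      using g[unfolded locally_integrable_def, rule_format, of "{a..b}"] that subsetI[of "{a..b}" "{p<..<q}"]
      by fastforce
    then show ?thesis by (subst Lebesgue_Measure.integrable_restrict_UNIV) auto
  qed
  have zero: "(LINT x|lebesgue. indicator {a<..<b} x * (if x \<in> {a..b} then g x else 0)) = 0"
    if ab: "p < a" "a < b" "b < q" for a b
  proof (rule LIMSEQ_unique)
    \<comment> \<open>The product of \<open>flat 0 (m * (x - a))\<close> and
      \<open>flat 0 (m * (b - x))\<close>, with the affine arguments in the shape of
      \<open>smooth_funs\<close>. It lies between 0 and 1, vanishes outside \<open>{a<..<b}\<close>
      and tends to 1 inside, since \<open>flat 0\<close> tends to 1 at infinity.\<close>
    define \<phi> where "\<phi> m x = flat 0 (real m * x + - (real m * a)) * flat 0 (- real m * x + real m * b)" for m x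
    have \<phi>0: "\<phi> m x = 0" if "x \<notin> {a..b}" for m x
    proof -
      have "real m * x + - (real m * a) \<le> 0 \<or> - real m * x + real m * b \<le> 0"
        using that by (auto simp: not_le mult_left_mono)
      then show ?thesis by (auto simp: \<phi>_def flat_def)
    qed
    have sm: "\<phi> m \<in> smooth_funs" for m
      unfolding \<phi>_def by (intro smooth_funs.intros)
    have le1: "flat 0 y \<le> 1" for y by (simp add: flat_def)
    show "(\<lambda>m. LINT x|lebesgue. \<phi> m x * (if x \<in> {a..b} then g x else 0)) \<longlonglongrightarrow>
        (LINT x|lebesgue. indicator {a<..<b} x * (if x \<in> {a..b} then g x else 0))"
    proof (rule integral_dominated_convergence[where w = "\<lambda>x. \<bar>if x \<in> {a..b} then g x else 0\<bar>"])
      show "integrable lebesgue (\<lambda>x. \<bar>if x \<in> {a..b} then g x else 0\<bar>)"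
        using gI[of a b] ab by (intro integrable_abs) auto
      have mg: "(\<lambda>x. if x \<in> {a..b} then g x else 0) \<in> borel_measurable lebesgue"
        using gI[of a b] ab by auto
      show "(\<lambda>x. \<phi> m x * (if x \<in> {a..b} then g x else 0)) \<in> borel_measurable lebesgue" for m
        by (intro borel_measurable_times mg continuous_imp_borel_measurable_lebesgue
            smooth_funs_continuous sm)
      show "(\<lambda>x. indicator {a<..<b} x * (if x \<in> {a..b} then g x else 0)) \<in> borel_measurable lebesgue"
        using mg by (intro borel_measurable_times borel_measurable_indicator) auto
      show "AE x in lebesgue. norm (\<phi> m x * (if x \<in> {a..b} then g x else 0)) \<le>
          \<bar>if x \<in> {a..b} then g x else 0\<bar>" for m
      proof (rule AE_I2)
        fix x
        have "\<bar>\<phi> m x\<bar> \<le> 1" unfolding \<phi>_def abs_mult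
          using le1 flat_nonneg by (simp add: mult_le_one)
        then show "norm (\<phi> m x * (if x \<in> {a..b} then g x else 0)) \<le> \<bar>if x \<in> {a..b} then g x else 0\<bar>"
          by (simp add: abs_mult mult_left_le_one_le)
      qed
      show "AE x in lebesgue. (\<lambda>m. \<phi> m x * (if x \<in> {a..b} then g x else 0)) \<longlonglongrightarrow>
          indicator {a<..<b} x * (if x \<in> {a..b} then g x else 0)"
      proof (rule AE_I2)
        fix x
        have flat_lim: "(\<lambda>m. flat 0 (real m * y)) \<longlonglongrightarrow> 1" if "y > 0" for y
        proof (rule Lim_transform_eventually)
          show "\<forall>\<^sub>F m in sequentially. exp (- (1 / (real m * y))) = flat 0 (real m * y)"
            using eventually_gt_at_top[of 0] by eventually_elim (use that in \<open>auto simp: flat_def\<close>)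
          have "(\<lambda>m. exp (- (inverse y * inverse (real m)))) \<longlonglongrightarrow> exp (- (inverse y * 0))"
            by (intro tendsto_intros lim_inverse_n)
          then show "(\<lambda>m. exp (- (1 / (real m * y)))) \<longlonglongrightarrow> 1"
            by (simp add: field_simps)
        qed
        show "(\<lambda>m. \<phi> m x * (if x \<in> {a..b} then g x else 0)) \<longlonglongrightarrow>
          indicator {a<..<b} x * (if x \<in> {a..b} then g x else 0)"
        proof (cases "x \<in> {a<..<b}")
          case True
          have "(\<lambda>m. \<phi> m x) \<longlonglongrightarrow> 1 * 1"
            using tendsto_mult[OF flat_lim[of "x - a"] flat_lim[of "b - x"]] True
            by (simp add: \<phi>_def algebra_simps)
          then show ?thesis using True by (auto intro!: tendsto_eq_intros)
        next
          case False
          have "\<phi> m x = 0" for m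
            using False \<phi>0[of x m] by (cases "x = a \<or> x = b") (auto simp: \<phi>_def flat_def)
          then show ?thesis using False by simp
        qed
      qed
    qed
    have "(LINT x|lebesgue. \<phi> m x * (if x \<in> {a..b} then g x else 0)) = 0" for m
    proof -
      have "\<phi> m \<in> test_functions {p<..<q}"
        by (rule smooth_funs_test_function[OF sm, of "{a..b}"]) (use ab \<phi>0 in auto)
      then have "(LINT x|lebesgue. (if x \<in> {p<..<q} then g x * \<phi> m x else 0)) = 0"
        using test by (subst Lebesgue_Measure.integral_restrict_UNIV) auto
      moreover have "(\<lambda>x. if x \<in> {p<..<q} then g x * \<phi> m x else 0) =
          (\<lambda>x. \<phi> m x * (if x \<in> {a..b} then g x else 0))"
        using ab \<phi>0 by (auto simp: fun_eq_iff)
      ultimately show ?thesis by simp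
    qed
    then show "(\<lambda>m. LINT x|lebesgue. \<phi> m x * (if x \<in> {a..b} then g x else 0)) \<longlonglongrightarrow> 0" by simp
  qed
  have AEK: "AE x in lebesgue. x \<in> {a..b} \<longrightarrow> g x = 0" if ab: "p < a" "b < q" for a b
  proof -
    have "AE x in lebesgue. (if x \<in> {a..b} then g x else 0) = 0"
    proof (rule AE_zero_if_Ioc_integral_zero_lebesgue[OF gI[OF ab]])
      fix c d :: real
      \<comment> \<open>Up to the four end points, a null set, the two intervals meet in the open
        interval from \<open>?a\<close> to \<open>?b\<close>.\<close>
      let ?a = "max a c" and ?b = "min b d"
      have ne: "AE x in lebesgue. x \<noteq> y" for y :: real
        by (rule AE_completion) (rule AE_lborel_singleton)
      have "(LINT x|lebesgue. indicator {c<..d} x * (if x \<in> {a..b} then g x else 0)) =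
        (LINT x|lebesgue. indicator {?a<..<?b} x * (if x \<in> {?a..?b} then g x else 0))"
      proof (rule integral_cong_AE)
        show "(\<lambda>x. indicator {c<..d} x * (if x \<in> {a..b} then g x else 0)) \<in> borel_measurable lebesgue"
          using gI[OF ab] by (intro borel_measurable_times borel_measurable_indicator) auto
        show "(\<lambda>x. indicator {?a<..<?b} x * (if x \<in> {?a..?b} then g x else 0)) \<in> borel_measurable lebesgue"
          using gI[of ?a ?b] ab by (intro borel_measurable_times borel_measurable_indicator) auto
        show "AE x in lebesgue. indicator {c<..d} x * (if x \<in> {a..b} then g x else 0) =
          indicator {?a<..<?b} x * (if x \<in> {?a..?b} then g x else 0)"
          using ne[of a] ne[of b] ne[of c] ne[of d]
          by eventually_elim (auto simp: indicator_def)
      qed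
      also have "\<dots> = 0"
      proof (cases "?a < ?b")
        case True
        then show ?thesis using zero[of ?a ?b] ab by (auto simp: less_max_iff_disj min_less_iff_disj)
      next
        case False
        then have "{?a<..<?b} = {}" by (meson greaterThanLessThan_empty not_less)
        then show ?thesis by simp
      qed
      finally show "(LINT x|lebesgue. indicator {c<..d} x * (if x \<in> {a..b} then g x else 0)) = 0" .
    qed
    then show ?thesis by auto
  qed
  have "AE x in lebesgue. \<forall>n::nat. x \<in> {p + 1 / real (Suc n)..q - 1 / real (Suc n)} \<longrightarrow> g x = 0"
    by (subst AE_all_countable, rule allI, rule AEK) auto
  then have "AE x in lebesgue. x \<in> {p<..<q} \<longrightarrow> g x = 0"
  proof eventually_elim
    case (elim x)
    show ?case
    proof
      assume x: "x \<in> {p<..<q}"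
      then obtain n :: nat where "1 / real (Suc n) < min (x - p) (q - x)"
        by (metis nat_approx_posE diff_gt_0_iff_gt greaterThanLessThan_iff min_less_iff_conj)
      then have "x \<in> {p + 1 / real (Suc n)..q - 1 / real (Suc n)}" by auto
      then show "g x = 0" using elim by blast
    qed
  qed
  then show ?thesis by (simp add: AE_restrict_space_iff)
qed

lemma integrable_square_mult:
  fixes f g :: "'a \<Rightarrow> real"
  assumes "f \<in> borel_measurable M" "g \<in> borel_measurable M"
    and "integrable M (\<lambda>x. (f x)\<^sup>2)" "integrable M (\<lambda>x. (g x)\<^sup>2)"
  shows "integrable M (\<lambda>x. f x * g x)"
proof (rule Bochner_Integration.integrable_bound)
  show "integrable M (\<lambda>x. (f x)\<^sup>2 + (g x)\<^sup>2)" using assms by simp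
  have "\<bar>a * b\<bar> \<le> a\<^sup>2 + b\<^sup>2" for a b :: real
    using sum_squares_bound[of a b] sum_squares_bound[of a "- b"] sum_power2_ge_zero[of a b] by (simp add: abs_if)
  then show "AE x in M. norm (f x * g x) \<le> norm ((f x)\<^sup>2 + (g x)\<^sup>2)"
    by (intro AE_I2) (simp add: order.trans[OF _ abs_ge_self])
qed (use assms in measurable)

lemma Cauchy_Schwarz_integral:
  fixes f g :: "'a \<Rightarrow> real"
  assumes "f \<in> borel_measurable M" "g \<in> borel_measurable M"
    and f: "integrable M (\<lambda>x. (f x)\<^sup>2)" and g: "integrable M (\<lambda>x. (g x)\<^sup>2)"
  shows "(LINT x|M. f x * g x)\<^sup>2 \<le> (LINT x|M. (f x)\<^sup>2) * (LINT x|M. (g x)\<^sup>2)"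
proof -
  let ?a = "LINT x|M. (f x)\<^sup>2" and ?b = "LINT x|M. f x * g x" and ?c = "LINT x|M. (g x)\<^sup>2"
  have fg: "integrable M (\<lambda>x. f x * g x)" by (rule integrable_square_mult) fact+
  have quad: "0 \<le> ?a * y\<^sup>2 + 2 * y * ?b + ?c" for y
  proof -
    have "0 \<le> (LINT x|M. (y * f x + g x)\<^sup>2)" by simp
    also have "\<dots> = (LINT x|M. y\<^sup>2 * (f x)\<^sup>2 + 2 * y * (f x * g x) + (g x)\<^sup>2)"
      by (intro Bochner_Integration.integral_cong) (auto simp: power2_eq_square algebra_simps)
    also have "\<dots> = ?a * y\<^sup>2 + 2 * y * ?b + ?c" using f g fg by simp
    finally show ?thesis .
  qed
  show ?thesis
  proof (cases "?a = 0")
    case True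
    have "?b = 0"
    proof (rule ccontr)
      assume "?b \<noteq> 0"
      \<comment> \<open>With \<open>?a = 0\<close> the quadratic is affine in \<open>y\<close>, and
        this \<open>y\<close> gives it the value -1.\<close>
      then show False using quad[of "- (?c + 1) / (2 * ?b)"] True by (simp add: field_simps)
    qed
    then show ?thesis using True by simp
  next
    case False
    then have "?a > 0" by (metis integral_nonneg_AE AE_I2 zero_le_power2 order_le_less)
    then show ?thesis using quad[of "- ?b / ?a"] by (simp add: field_simps power2_eq_square)
  qed
qed

section \<open>Sobolev functions on a bounded interval\<close>

locale interval =
  fixes p q :: real
  assumes p_less_q: "p < q"
begin

abbreviation Om :: "real set" where "Om \<equiv> {p<..<q}"
abbreviation M :: "real measure" where "M \<equiv> lebesgue_on Om"

sublocale finite_measure M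
  by (rule finite_measure_lebesgue_on) auto

lemma measure_M: "measure M (space M) = q - p"
  using p_less_q by (simp add: measure_restrict_space)

lemma C1_is_weak_deriv:
  assumes f: "\<And>x. (f has_real_derivative f' x) (at x)" and f': "continuous_on UNIV f'"
  shows "is_weak_deriv Om f f'"
  unfolding is_weak_deriv_def
proof (intro conjI ballI)
  have fc: "continuous_on UNIV f"
    using f by (meson DERIV_isCont continuous_at_imp_continuous_on)
  show lf: "locally_integrable Om f" and lf': "locally_integrable Om f'"
    by (intro continuous_imp_locally_integrable fc f')+
  fix \<phi> assume \<phi>: "\<phi> \<in> test_functions Om"
  obtain K where K: "compact K" "K \<subseteq> Om" "\<And>x. x \<notin> K \<Longrightarrow> \<phi> x = 0" "\<And>x. x \<notin> K \<Longrightarrow> deriv \<phi> x = 0"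
    using test_functionsD(1)[OF \<phi>] by blast
  note K = K test_functionsD(2,3)[OF \<phi>]
  have \<phi>c: "continuous_on UNIV \<phi>"
    using K(5) by (meson DERIV_isCont continuous_at_imp_continuous_on)
  have i1: "integrable M (\<lambda>x. f x * deriv \<phi> x)" and i2: "integrable M (\<lambda>x. f' x * \<phi> x)"
    by (rule integrable_locally_integrable_mult[OF _ K(1,2)]; use lf lf' K \<phi>c in simp)+
  then have i: "integrable M (\<lambda>x. f x * deriv \<phi> x + f' x * \<phi> x)" by simp
  have "((\<lambda>x. f x * deriv \<phi> x + f' x * \<phi> x) has_integral (f q * \<phi> q - f p * \<phi> p)) {p..q}"
  proof (rule fundamental_theorem_of_calculus)
    fix x assume "x \<in> {p..q}"
    have "((\<lambda>x. f x * \<phi> x) has_real_derivative (f x * deriv \<phi> x + f' x * \<phi> x)) (at x)"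
      by (rule DERIV_cong, rule DERIV_mult[OF f K(5)]) simp
    then show "((\<lambda>x. f x * \<phi> x) has_vector_derivative (f x * deriv \<phi> x + f' x * \<phi> x)) (at x within {p..q})"
      using has_field_derivative_at_within has_real_derivative_iff_has_vector_derivative by blast
  qed (use p_less_q in simp)
  moreover have "\<phi> q = 0" "\<phi> p = 0" using K(2,3) p_less_q by fastforce+
  ultimately have "((\<lambda>x. f x * deriv \<phi> x + f' x * \<phi> x) has_integral 0) Om"
    by (simp add: has_integral_Icc_iff_Ioo)
  moreover have "((\<lambda>x. f x * deriv \<phi> x + f' x * \<phi> x) has_integral
      (LINT x|M. f x * deriv \<phi> x + f' x * \<phi> x)) Om"
    by (rule has_integral_integral_lebesgue_on[OF i]) auto
  ultimately have "(LINT x|M. f x * deriv \<phi> x + f' x * \<phi> x) = 0"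
    using has_integral_unique by blast
  then show "(LINT x|M. f x * deriv \<phi> x) = - (LINT x|M. f' x * \<phi> x)"
    using i1 i2 by simp
qed

lemma integrable_test_mult:
  assumes "locally_integrable Om g" "\<phi> \<in> test_functions Om"
  shows "integrable M (\<lambda>x. g x * \<phi> x)" "integrable M (\<lambda>x. g x * deriv \<phi> x)"
proof -
  obtain K where K: "compact K" "K \<subseteq> Om" "\<And>x. x \<notin> K \<Longrightarrow> \<phi> x = 0" "\<And>x. x \<notin> K \<Longrightarrow> deriv \<phi> x = 0"
    using test_functionsD(1)[OF assms(2)] by blast
  note K = K test_functionsD(2,3)[OF assms(2)]
  have \<phi>c: "continuous_on UNIV \<phi>"
    using K(5) by (meson DERIV_isCont continuous_at_imp_continuous_on)
  show "integrable M (\<lambda>x. g x * \<phi> x)" "integrable M (\<lambda>x. g x * deriv \<phi> x)"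
    by (rule integrable_locally_integrable_mult[OF assms(1) K(1,2)]; use K \<phi>c in simp)+
qed

lemma locally_integrable_lin:
  assumes "locally_integrable \<Omega> f" "locally_integrable \<Omega> g"
  shows "locally_integrable \<Omega> (\<lambda>x. c * f x + d * g x)"
  using assms unfolding locally_integrable_def by auto

lemma is_weak_deriv_lin:
  assumes "is_weak_deriv Om f f'" "is_weak_deriv Om g g'"
  shows "is_weak_deriv Om (\<lambda>x. c * f x + d * g x) (\<lambda>x. c * f' x + d * g' x)"
  unfolding is_weak_deriv_def
proof (intro conjI ballI)
  note a = assms[unfolded is_weak_deriv_def]
  show "locally_integrable Om (\<lambda>x. c * f x + d * g x)" "locally_integrable Om (\<lambda>x. c * f' x + d * g' x)"
    using a by (simp_all add: locally_integrable_lin)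
  fix \<phi> assume \<phi>: "\<phi> \<in> test_functions Om"
  have "(LINT x|M. (c * f x + d * g x) * deriv \<phi> x) =
      (LINT x|M. c * (f x * deriv \<phi> x) + d * (g x * deriv \<phi> x))"
    by (simp add: algebra_simps)
  also have "\<dots> = - (c * (LINT x|M. f' x * \<phi> x) + d * (LINT x|M. g' x * \<phi> x))"
    using a \<phi> integrable_test_mult[OF _ \<phi>] by simp
  also have "\<dots> = - (LINT x|M. c * (f' x * \<phi> x) + d * (g' x * \<phi> x))"
    using a integrable_test_mult[OF _ \<phi>] by simp
  finally show "(LINT x|M. (c * f x + d * g x) * deriv \<phi> x) = - (LINT x|M. (c * f' x + d * g' x) * \<phi> x)"
    by (simp add: algebra_simps)
qed

lemma is_weak_deriv_unique:
  assumes "is_weak_deriv Om f g" "is_weak_deriv Om f h"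
  shows "AE x in M. g x = h x"
proof -
  have "is_weak_deriv Om (\<lambda>x. 1 * f x + (-1) * f x) (\<lambda>x. 1 * g x + (-1) * h x)"
    by (rule is_weak_deriv_lin) fact+
  then have "AE x in M. g x - h x = 0"
    by (intro integral_test_zero_imp_AE_zero) (auto simp: is_weak_deriv_def)
  then show ?thesis by eventually_elim simp
qed

text \<open>\<open>weak_deriv\<close> is a choice that is determined only up to null sets, so all
  later formulas for it hold almost everywhere and are used under integrals.\<close>

lemma weak_deriv_AE_eq:
  assumes "is_weak_deriv Om f g"
  shows "is_weak_deriv Om f (weak_deriv Om f)" "AE x in M. weak_deriv Om f x = g x"
proof -
  show "is_weak_deriv Om f (weak_deriv Om f)"
    unfolding weak_deriv_def by (rule someI[where P = "is_weak_deriv Om f"]) (rule assms)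
  then show "AE x in M. weak_deriv Om f x = g x"
    using assms by (rule is_weak_deriv_unique)
qed

text \<open>Local integrability speaks of compact subsets only; exhausting \<open>Om\<close> by
  compact intervals gives measurability on all of it. This is what allows a chosen weak derivative
  to enter integrals over \<open>Om\<close>.\<close>

lemma locally_integrable_borel_measurable:
  assumes "locally_integrable Om g"
  shows "g \<in> borel_measurable M"
proof -
  let ?K = "\<lambda>n::nat. {p + 1 / real (Suc n)..q - 1 / real (Suc n)}"
  have sub: "?K n \<subseteq> Om" for n
  proof
    fix x assume "x \<in> ?K n"
    moreover have "1 / real (Suc n) > 0" by simp
    ultimately have "p < x" "x < q" unfolding atLeastAtMost_iff by linarith+
    then show "x \<in> Om" by simp
  qed
  have "(\<lambda>x. if x \<in> ?K n then g x else 0) \<in> borel_measurable M" for n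
  proof -
    have "integrable (lebesgue_on (?K n)) g"
      using assms sub[of n] unfolding locally_integrable_def by blast
    then have "g \<in> borel_measurable (lebesgue_on (?K n))" by (rule borel_measurable_integrable)
    then show ?thesis
      by (subst borel_measurable_if_lebesgue_on) (use sub[of n] in auto)
  qed
  moreover have "(\<lambda>n. if x \<in> ?K n then g x else 0) \<longlonglongrightarrow> g x" if "x \<in> space M" for x
  proof -
    have x: "x \<in> Om" using that by simp
    then obtain N :: nat where N: "1 / real (Suc N) < min (x - p) (q - x)"
      by (metis nat_approx_posE diff_gt_0_iff_gt greaterThanLessThan_iff min_less_iff_conj)
    have "\<forall>\<^sub>F n in sequentially. (if x \<in> ?K n then g x else 0) = g x"
      using eventually_ge_at_top[of N]
    proof eventually_elim
      case (elim n)
      then have "1 / real (Suc n) \<le> 1 / real (Suc N)" by (simp add: frac_le)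
      then show ?case using N by auto
    qed
    then show ?thesis by (rule tendsto_eventually)
  qed
  ultimately show ?thesis by (rule borel_measurable_LIMSEQ_real[rotated])
qed

lemma L2_bounded:
  assumes "f \<in> borel_measurable M" "\<And>x. x \<in> Om \<Longrightarrow> \<bar>f x\<bar> \<le> B"
  shows "f \<in> L2 Om"
proof -
  have "integrable M (\<lambda>x. (f x)\<^sup>2)"
  proof (rule integrable_const_bound[where B = "B\<^sup>2"])
    show "AE x in M. norm ((f x)\<^sup>2) \<le> B\<^sup>2"
    proof (rule AE_I2)
      fix x assume "x \<in> space M"
      then have "\<bar>f x\<bar> \<le> B" using assms(2) by simp
      then show "norm ((f x)\<^sup>2) \<le> B\<^sup>2"
        using power_mono[of "\<bar>f x\<bar>" B 2] by simp
    qed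
  qed (use assms in measurable)
  then show ?thesis using assms by (simp add: L2_def)
qed

lemma continuous_in_L2: "continuous_on UNIV f \<Longrightarrow> f \<in> L2 Om"
proof -
  assume f: "continuous_on UNIV f"
  have "compact (f ` {p..q})"
    using f by (intro compact_continuous_image) (auto intro: continuous_on_subset)
  then obtain B where "\<And>x. x \<in> {p..q} \<Longrightarrow> \<bar>f x\<bar> \<le> B"
    using compact_imp_bounded[of "f ` {p..q}"] unfolding bounded_iff by fastforce
  then show ?thesis
    by (intro L2_bounded[where B = B] continuous_imp_borel_measurable_lebesgue f) auto
qed

lemma L2_meas: "f \<in> L2 Om \<Longrightarrow> f \<in> borel_measurable M"
  by (simp add: L2_def)

lemma L2_sq: "f \<in> L2 Om \<Longrightarrow> integrable M (\<lambda>x. (f x)\<^sup>2)"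
  by (simp add: L2_def)

lemma L2_mult_integrable: "f \<in> L2 Om \<Longrightarrow> g \<in> L2 Om \<Longrightarrow> integrable M (\<lambda>x. f x * g x)"
  by (auto simp: L2_def intro: integrable_square_mult)

lemma L2_CS: "f \<in> L2 Om \<Longrightarrow> g \<in> L2 Om \<Longrightarrow>
    (LINT x|M. f x * g x)\<^sup>2 \<le> (LINT x|M. (f x)\<^sup>2) * (LINT x|M. (g x)\<^sup>2)"
  by (auto simp: L2_def intro: Cauchy_Schwarz_integral)

lemma L2_integrable: "f \<in> L2 Om \<Longrightarrow> integrable M f"
  using L2_mult_integrable[of f "\<lambda>x. 1"] continuous_in_L2[of "\<lambda>x. 1"] by simp

lemma L2_lin:
  assumes "f \<in> L2 Om" "g \<in> L2 Om"
  shows "(\<lambda>x. c * f x + d * g x) \<in> L2 Om"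
proof -
  have "integrable M (\<lambda>x. c\<^sup>2 * (f x)\<^sup>2 + (2 * c * d) * (f x * g x) + d\<^sup>2 * (g x)\<^sup>2)"
    using L2_sq[OF assms(1)] L2_sq[OF assms(2)] L2_mult_integrable[OF assms] by simp
  also have "(\<lambda>x. c\<^sup>2 * (f x)\<^sup>2 + (2 * c * d) * (f x * g x) + d\<^sup>2 * (g x)\<^sup>2) = (\<lambda>x. (c * f x + d * g x)\<^sup>2)"
    by (auto simp: power2_eq_square algebra_simps)
  finally show ?thesis using assms by (auto simp: L2_def)
qed

text \<open>The definition of \<open>H1\<close> provides some square integrable weak derivative; the
  chosen one agrees with it almost everywhere and inherits integrability.\<close>

lemma H1_D:
  assumes "f \<in> H1 Om"
  shows "f \<in> L2 Om" "weak_deriv Om f \<in> L2 Om" "is_weak_deriv Om f (weak_deriv Om f)"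
proof -
  obtain g where g: "f \<in> L2 Om" "g \<in> L2 Om" "is_weak_deriv Om f g"
    using assms by (auto simp: H1_def)
  show "f \<in> L2 Om" by fact
  show wd: "is_weak_deriv Om f (weak_deriv Om f)" using g weak_deriv_AE_eq by blast
  have m: "weak_deriv Om f \<in> borel_measurable M"
    using wd by (auto simp: is_weak_deriv_def intro: locally_integrable_borel_measurable)
  have "AE x in M. (weak_deriv Om f x)\<^sup>2 = (g x)\<^sup>2"
    using weak_deriv_AE_eq(2)[OF g(3)] by eventually_elim simp
  then have "integrable M (\<lambda>x. (weak_deriv Om f x)\<^sup>2)"
    using integrable_cong_AE[of "\<lambda>x. (weak_deriv Om f x)\<^sup>2" M "\<lambda>x. (g x)\<^sup>2"] m g(2)
    by (auto simp: L2_def)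
  then show "weak_deriv Om f \<in> L2 Om" using m by (simp add: L2_def)
qed

lemma H1_I: "f \<in> L2 Om \<Longrightarrow> g \<in> L2 Om \<Longrightarrow> is_weak_deriv Om f g \<Longrightarrow> f \<in> H1 Om"
  by (auto simp: H1_def)

lemma C1_in_H1:
  assumes f: "\<And>x. (f has_real_derivative f' x) (at x)" and f': "continuous_on UNIV f'"
  shows "f \<in> H1 Om" "AE x in M. weak_deriv Om f x = f' x"
proof -
  have fc: "continuous_on UNIV f"
    using f by (meson DERIV_isCont continuous_at_imp_continuous_on)
  have wd: "is_weak_deriv Om f f'" by (rule C1_is_weak_deriv) fact+
  show "f \<in> H1 Om"
    by (rule H1_I[OF _ _ wd]; intro continuous_in_L2 fc f')
  show "AE x in M. weak_deriv Om f x = f' x" using wd by (rule weak_deriv_AE_eq)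
qed

lemma test_in_H1:
  assumes "\<phi> \<in> test_functions Om"
  shows "\<phi> \<in> H1 Om" "AE x in M. weak_deriv Om \<phi> x = deriv \<phi> x"
    "continuous_on UNIV \<phi>" "continuous_on UNIV (deriv \<phi>)"
proof -
  note K = test_functionsD(2,3)[OF assms]
  show "\<phi> \<in> H1 Om" "AE x in M. weak_deriv Om \<phi> x = deriv \<phi> x" 
    using K by (rule C1_in_H1)+
  show "continuous_on UNIV \<phi>" "continuous_on UNIV (deriv \<phi>)"
    using K by (meson DERIV_isCont continuous_at_imp_continuous_on)+
qed

lemma H1_lin:
  assumes "f \<in> H1 Om" "g \<in> H1 Om"
  shows "(\<lambda>x. c * f x + d * g x) \<in> H1 Om"
    "AE x in M. weak_deriv Om (\<lambda>x. c * f x + d * g x) x = c * weak_deriv Om f x + d * weak_deriv Om g x"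
proof -
  have wd: "is_weak_deriv Om (\<lambda>x. c * f x + d * g x) (\<lambda>x. c * weak_deriv Om f x + d * weak_deriv Om g x)"
    by (intro is_weak_deriv_lin H1_D assms)
  show "(\<lambda>x. c * f x + d * g x) \<in> H1 Om"
    by (rule H1_I[OF _ _ wd]; intro L2_lin H1_D assms)
  show "AE x in M. weak_deriv Om (\<lambda>x. c * f x + d * g x) x = c * weak_deriv Om f x + d * weak_deriv Om g x"
    using wd by (rule weak_deriv_AE_eq)
qed

lemma H1_diff:
  assumes "f \<in> H1 Om" "g \<in> H1 Om"
  shows "f - g \<in> H1 Om" "AE x in M. weak_deriv Om (f - g) x = weak_deriv Om f x - weak_deriv Om g x"
  using H1_lin[OF assms, of 1 "-1"] by (simp_all add: fun_diff_def)

lemma H1_norm_ge: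
  shows "(LINT x|M. (f x)\<^sup>2) \<le> (H1_norm Om f)\<^sup>2" "(LINT x|M. (weak_deriv Om f x)\<^sup>2) \<le> (H1_norm Om f)\<^sup>2"
  by (simp_all add: H1_norm_def)

lemma H10_H1: "f \<in> H10 Om \<Longrightarrow> f \<in> H1 Om"
  by (simp add: H10_def)

text \<open>With a test function for \<open>v\<close> this is the definition of the weak derivative
  of \<open>g\<close>. Both sides are continuous in \<open>v\<close> for the norm in which test
  functions approximate \<open>v\<close>, by Cauchy-Schwarz. This identity is where the Dirichlet
  condition acts: there is no boundary term although \<open>g\<close> is free at the end
  points.\<close>

lemma H10_parts:
  assumes g: "g \<in> H1 Om" and v: "v \<in> H10 Om"
  shows "(LINT x|M. g x * weak_deriv Om v x) = - (LINT x|M. weak_deriv Om g x * v x)"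
proof -
  obtain \<psi> where \<psi>: "\<And>n::nat. \<psi> n \<in> test_functions Om" and lim: "(\<lambda>n. H1_norm Om (v - \<psi> n)) \<longlonglongrightarrow> 0"
    using v by (auto simp: H10_def)
  have v1: "v \<in> H1 Om" using v by (rule H10_H1)
  have \<psi>1: "\<psi> n \<in> H1 Om" for n using \<psi> by (rule test_in_H1)
  have conv: "(\<lambda>n. LINT x|M. h x * r n x) \<longlonglongrightarrow> (LINT x|M. h x * s x)"
    if h: "h \<in> L2 Om" and r: "\<And>n. r n \<in> L2 Om" and s: "s \<in> L2 Om"
      and le: "\<And>n. (LINT x|M. (s x - r n x)\<^sup>2) \<le> (H1_norm Om (v - \<psi> n))\<^sup>2" for h r s
  proof (rule LIM_zero_cancel)
    have sr: "(\<lambda>x. s x - r n x) \<in> L2 Om" for n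
      using L2_lin[OF s r[of n], of 1 "-1"] by simp
    show "(\<lambda>n. (LINT x|M. h x * r n x) - (LINT x|M. h x * s x)) \<longlonglongrightarrow> 0"
    proof (rule Lim_null_comparison)
      show "\<forall>\<^sub>F n in sequentially. norm ((LINT x|M. h x * r n x) - (LINT x|M. h x * s x)) \<le>
          sqrt (LINT x|M. (h x)\<^sup>2) * H1_norm Om (v - \<psi> n)"
      proof (rule always_eventually, rule allI)
        fix n
        have "(LINT x|M. h x * s x) - (LINT x|M. h x * r n x) = (LINT x|M. h x * (s x - r n x))"
          using L2_mult_integrable[OF h s] L2_mult_integrable[OF h r[of n]]
          by (simp add: right_diff_distrib)
        also have "\<bar>\<dots>\<bar> \<le> sqrt ((LINT x|M. (h x)\<^sup>2) * (LINT x|M. (s x - r n x)\<^sup>2))"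
          by (rule real_le_rsqrt) (use L2_CS[OF h sr[of n]] in simp)
        also have "\<dots> \<le> sqrt ((LINT x|M. (h x)\<^sup>2) * (H1_norm Om (v - \<psi> n))\<^sup>2)"
          using le[of n] by (intro real_sqrt_le_mono mult_left_mono) auto
        also have "\<dots> = sqrt (LINT x|M. (h x)\<^sup>2) * H1_norm Om (v - \<psi> n)"
          by (simp add: real_sqrt_mult H1_norm_def)
        finally show "norm ((LINT x|M. h x * r n x) - (LINT x|M. h x * s x)) \<le>
          sqrt (LINT x|M. (h x)\<^sup>2) * H1_norm Om (v - \<psi> n)" by (simp add: abs_minus_commute)
      qed
      show "(\<lambda>n. sqrt (LINT x|M. (h x)\<^sup>2) * H1_norm Om (v - \<psi> n)) \<longlonglongrightarrow> 0"
        using tendsto_mult_right_zero[OF lim] .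
    qed
  qed
  have "(\<lambda>n. LINT x|M. g x * deriv (\<psi> n) x) \<longlonglongrightarrow> (LINT x|M. g x * weak_deriv Om v x)"
  proof (rule conv)
    fix n
    show "deriv (\<psi> n) \<in> L2 Om" using test_in_H1(4)[OF \<psi>] by (rule continuous_in_L2)
    have "(LINT x|M. (weak_deriv Om v x - deriv (\<psi> n) x)\<^sup>2) = (LINT x|M. (weak_deriv Om (v - \<psi> n) x)\<^sup>2)"
    proof (rule integral_cong_AE)
      show "AE x in M. (weak_deriv Om v x - deriv (\<psi> n) x)\<^sup>2 = (weak_deriv Om (v - \<psi> n) x)\<^sup>2"
        using H1_diff(2)[OF v1 \<psi>1[of n]] test_in_H1(2)[OF \<psi>[of n]] by eventually_elim simp
    qed (use L2_meas[OF H1_D(2)[OF v1]] L2_meas[OF continuous_in_L2[OF test_in_H1(4)[OF \<psi>]]]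
        L2_meas[OF H1_D(2)[OF H1_diff(1)[OF v1 \<psi>1]]] in measurable)
    then show "(LINT x|M. (weak_deriv Om v x - deriv (\<psi> n) x)\<^sup>2) \<le> (H1_norm Om (v - \<psi> n))\<^sup>2"
      using H1_norm_ge(2) by simp
  qed (use g v1 H1_D in auto)
  moreover have "(\<lambda>n. LINT x|M. weak_deriv Om g x * \<psi> n x) \<longlonglongrightarrow> (LINT x|M. weak_deriv Om g x * v x)"
    by (rule conv) (use g v1 \<psi>1 H1_D H1_norm_ge(1) in \<open>auto simp: fun_diff_def\<close>)
  moreover have "(LINT x|M. g x * deriv (\<psi> n) x) = - (LINT x|M. weak_deriv Om g x * \<psi> n x)" for n
    using H1_D(3)[OF g] \<psi>[of n] by (simp add: is_weak_deriv_def)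
  ultimately show ?thesis
    using LIMSEQ_unique[OF _ tendsto_minus] by simp
qed

end

section \<open>Sine expansions\<close>

context interval
begin

text \<open>The shift by \<open>Suc\<close> puts the first Dirichlet mode at index 0 and leaves out
  the constant cosine, so that sines and cosines all have the same norm.\<close>

definition freq :: "nat \<Rightarrow> real" where "freq i = real (Suc i) * pi / (q - p)"

definition sine :: "nat \<Rightarrow> real \<Rightarrow> real" where "sine i x = sin (freq i * (x - p))"

definition cosine :: "nat \<Rightarrow> real \<Rightarrow> real" where "cosine i x = cos (freq i * (x - p))"

lemma freq_pos: "freq i > 0"
  using p_less_q by (simp add: freq_def divide_simps)

lemma DERIV_sine: "(sine i has_real_derivative freq i * cosine i x) (at x)"
  unfolding sine_def cosine_def by (auto intro!: derivative_eq_intros)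

lemma DERIV_cosine: "(cosine i has_real_derivative - (freq i * sine i x)) (at x)"
  unfolding sine_def cosine_def by (auto intro!: derivative_eq_intros)

lemma continuous_sine: "continuous_on A (sine i)"
  unfolding sine_def by (intro continuous_intros)

lemma continuous_cosine: "continuous_on A (cosine i)"
  unfolding cosine_def by (intro continuous_intros)

lemma sine_L2: "sine i \<in> L2 Om" and cosine_L2: "cosine i \<in> L2 Om"
  by (intro continuous_in_L2 continuous_sine continuous_cosine)+

lemma abs_sine_le: "\<bar>sine i x\<bar> \<le> 1"
  by (simp add: sine_def)

lemma sine_H1: "sine i \<in> H1 Om" "AE x in M. weak_deriv Om (sine i) x = freq i * cosine i x"
  by (rule C1_in_H1[OF DERIV_sine], intro continuous_intros continuous_cosine)+

lemma cosine_H1: "cosine i \<in> H1 Om" "AE x in M. weak_deriv Om (cosine i) x = - (freq i * sine i x)"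
  by (rule C1_in_H1[OF DERIV_cosine], intro continuous_intros continuous_sine)+

section \<open>Orthogonality and completeness of the sine system\<close>

lemma integral_FTC:
  assumes F: "\<And>x. (F has_real_derivative f x) (at x)" and f: "continuous_on UNIV f"
  shows "(LINT x|M. f x) = F q - F p"
proof -
  have "(f has_integral (F q - F p)) {p..q}"
    by (rule fundamental_theorem_of_calculus)
      (use p_less_q F has_field_derivative_at_within has_real_derivative_iff_has_vector_derivative in \<open>auto, blast\<close>)
  then have "(f has_integral (F q - F p)) Om"
    by (simp add: has_integral_Icc_iff_Ioo)
  moreover have "(f has_integral (LINT x|M. f x)) Om"
    by (rule has_integral_integral_lebesgue_on[OF L2_integrable[OF continuous_in_L2[OF f]]]) auto
  ultimately show ?thesis using has_integral_unique by blast
qed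

lemma integral_cos_multiple:
  "(LINT x|M. cos (real_of_int j * pi / (q - p) * (x - p))) = (if j = 0 then q - p else 0)"
proof (cases "j = 0")
  case True
  then show ?thesis using measure_M by simp
next
  case False
  let ?w = "real_of_int j * pi / (q - p)"
  have w: "?w \<noteq> 0" using False p_less_q by simp
  have "(LINT x|M. cos (?w * (x - p))) = sin (?w * (q - p)) / ?w - sin (?w * (p - p)) / ?w"
    by (rule integral_FTC[where F = "\<lambda>x. sin (?w * (x - p)) / ?w"])
      (use w in \<open>auto intro!: derivative_eq_intros continuous_intros\<close>)
  moreover have "?w * (q - p) = real_of_int j * pi" using p_less_q by simp
  moreover have "sin (real_of_int j * pi) = 0" by (auto simp: sin_zero_iff_int2)
  ultimately show ?thesis using False by simp
qed

text \<open>Prepares the product formulas. The 2 stems from the two \<open>Suc\<close> in the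
  frequencies; it keeps the sum frequency away from 0, so only the difference term can contribute,
  and only for \<open>i = j\<close>.\<close>

lemma freq_add: "freq i * (x - p) + freq j * (x - p) = real_of_int (int i + int j + 2) * pi / (q - p) * (x - p)"
  and freq_diff: "freq i * (x - p) - freq j * (x - p) = real_of_int (int i - int j) * pi / (q - p) * (x - p)"
  by (auto simp: freq_def add_divide_distrib diff_divide_distrib algebra_simps)

lemma integrable_cos_multiple: "integrable M (\<lambda>x. cos (w * (x - p)))"
  by (intro L2_integrable continuous_in_L2 continuous_intros)

lemma sine_orthogonal: "(LINT x|M. sine i x * sine j x) = (if i = j then (q - p) / 2 else 0)"
proof -
  have "(LINT x|M. sine i x * sine j x) =
      (LINT x|M. (1/2) * (cos (real_of_int (int i - int j) * pi / (q - p) * (x - p))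
        - cos (real_of_int (int i + int j + 2) * pi / (q - p) * (x - p))))"
    by (intro Bochner_Integration.integral_cong refl, unfold freq_add[symmetric] freq_diff[symmetric])
      (simp add: sine_def cos_add cos_diff)
  also have "\<dots> = (1/2) * ((if int i - int j = 0 then q - p else 0) - 0)"
    unfolding Bochner_Integration.integral_mult_right_zero
    by (subst Bochner_Integration.integral_diff)
      (auto simp only: integrable_cos_multiple integral_cos_multiple split: if_splits)
  finally show ?thesis by (cases "i = j") auto
qed

lemma cosine_orthogonal: "(LINT x|M. cosine i x * cosine j x) = (if i = j then (q - p) / 2 else 0)"
proof -
  have "(LINT x|M. cosine i x * cosine j x) =
      (LINT x|M. (1/2) * (cos (real_of_int (int i - int j) * pi / (q - p) * (x - p))
        + cos (real_of_int (int i + int j + 2) * pi / (q - p) * (x - p))))"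
    by (intro Bochner_Integration.integral_cong refl, unfold freq_add[symmetric] freq_diff[symmetric])
      (simp add: cosine_def cos_add cos_diff)
  also have "\<dots> = (1/2) * ((if int i - int j = 0 then q - p else 0) + 0)"
    unfolding Bochner_Integration.integral_mult_right_zero
    by (subst Bochner_Integration.integral_add)
      (auto simp only: integrable_cos_multiple integral_cos_multiple split: if_splits)
  finally show ?thesis by (cases "i = j") auto
qed

text \<open>Expand the square of \<open>K * g\<close> minus its combination of the
  \<open>e n\<close>. Multiplying by the common squared norm \<open>K\<close> replaces normalization
  of the system.\<close>

lemma Bessel_inequality:
  assumes e: "\<And>n. e n \<in> L2 Om" and g: "g \<in> L2 Om" and fin: "finite I"
    and orth: "\<And>n m. (LINT x|M. e n x * e m x) = (if n = m then K else 0)" and K: "K > 0"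
  shows "(\<Sum>n\<in>I. (LINT x|M. g x * e n x)\<^sup>2) \<le> K * (LINT x|M. (g x)\<^sup>2)"
proof -
  define a where "a n = (LINT x|M. g x * e n x)" for n
  have "0 \<le> (LINT x|M. (K * g x - (\<Sum>n\<in>I. a n * e n x))\<^sup>2)" by simp
  also have "(\<lambda>x. (K * g x - (\<Sum>n\<in>I. a n * e n x))\<^sup>2) =
      (\<lambda>x. K\<^sup>2 * (g x)\<^sup>2 - 2 * K * (\<Sum>n\<in>I. a n * (g x * e n x))
        + (\<Sum>n\<in>I. \<Sum>m\<in>I. a n * a m * (e n x * e m x)))"
    by (auto simp: power2_eq_square algebra_simps sum_product sum_distrib_left intro!: sum.cong)
  also have "(LINT x|M. K\<^sup>2 * (g x)\<^sup>2 - 2 * K * (\<Sum>n\<in>I. a n * (g x * e n x))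
        + (\<Sum>n\<in>I. \<Sum>m\<in>I. a n * a m * (e n x * e m x))) =
      K\<^sup>2 * (LINT x|M. (g x)\<^sup>2) - 2 * K * (\<Sum>n\<in>I. a n * a n)
        + (\<Sum>n\<in>I. \<Sum>m\<in>I. a n * a m * (if n = m then K else 0))"
    using L2_sq[OF g] L2_mult_integrable[OF g e] L2_mult_integrable[OF e e]
    by (simp add: a_def[symmetric] orth)
  also have "\<dots> = K * (K * (LINT x|M. (g x)\<^sup>2) - (\<Sum>n\<in>I. (a n)\<^sup>2))"
    using fin by (simp add: sum.delta if_distrib cong: if_cong)
      (simp add: power2_eq_square algebra_simps sum_distrib_left)
  finally show ?thesis using K by (simp add: zero_le_mult_iff a_def)
qed

lemma integrable_mult_continuous:
  fixes f g :: "real \<Rightarrow> real"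
  assumes "integrable M g" "continuous_on UNIV f"
  shows "integrable M (\<lambda>x. g x * f x)"
proof -
  have "compact (f ` {p..q})"
    using assms by (intro compact_continuous_image) (auto intro: continuous_on_subset)
  then obtain B where B: "\<And>x. x \<in> {p..q} \<Longrightarrow> \<bar>f x\<bar> \<le> B"
    using compact_imp_bounded[of "f ` {p..q}"] unfolding bounded_iff by fastforce
  show ?thesis
  proof (rule Bochner_Integration.integrable_bound)
    show "integrable M (\<lambda>x. B * g x)" using assms by simp
    show "(\<lambda>x. g x * f x) \<in> borel_measurable M"
      using assms continuous_imp_borel_measurable_lebesgue(2)[OF assms(2)] by measurable
    show "AE x in M. norm (g x * f x) \<le> norm (B * g x)"
    proof (rule AE_I2)
      fix x assume "x \<in> space M"
      then have "\<bar>f x\<bar> \<le> \<bar>B\<bar>" using B[of x] by auto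
      then show "norm (g x * f x) \<le> norm (B * g x)"
        by (simp add: abs_mult mult.commute mult_right_mono)
    qed
  qed
qed

lemma integrable_imp_locally_integrable:
  fixes g :: "real \<Rightarrow> real"
  assumes g: "integrable M g"
  shows "locally_integrable Om g"
  unfolding locally_integrable_def
proof safe
  fix K assume K: "compact K" "K \<subseteq> Om"
  have Ks: "K \<in> sets lebesgue" using K by (simp add: compact_imp_closed)
  have "integrable lebesgue (\<lambda>x. if x \<in> Om then g x else 0)"
    using g by (subst Lebesgue_Measure.integrable_restrict_UNIV) auto
  then have "integrable lebesgue (\<lambda>x. indicator K x *\<^sub>R (if x \<in> Om then g x else 0))"
    by (rule integrable_mult_indicator[OF Ks])
  also have "(\<lambda>x. indicator K x *\<^sub>R (if x \<in> Om then g x else 0)) = (\<lambda>x. if x \<in> K then g x else 0)"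
    using K by (auto simp: fun_eq_iff indicator_def)
  finally show "integrable (lebesgue_on K) g"
    using Ks by (simp add: Lebesgue_Measure.integrable_restrict_UNIV)
qed

text \<open>Each \<open>sin \<theta> cos\<^sup>j \<theta>\<close> is a combination of sines, so \<open>D sin \<theta>\<close> annihilates the polynomials in \<open>cos \<theta>\<close>, hence
  by Weierstrass all test functions.\<close>

lemma sine_coefficients_zero_imp_AE_zero:
  assumes D: "integrable M D" and zero: "\<And>i. (LINT x|M. D x * sine i x) = 0"
  shows "AE x in M. D x = 0"
proof -
  define th where "th x = pi / (q - p) * (x - p)" for x
  have thc: "continuous_on UNIV th" unfolding th_def by (intro continuous_intros)
  have sine_th: "sine i x = sin (real (Suc i) * th x)" for i x
    by (simp add: sine_def th_def freq_def mult.assoc)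
  have th_range: "0 < th x" "th x < pi" if "x \<in> Om" for x
    using that p_less_q by (auto simp: th_def field_simps)
  have int: "integrable M (\<lambda>x. D x * f x)" if "continuous_on UNIV f" for f
    using D that by (rule integrable_mult_continuous)
  have powers: "(LINT x|M. D x * (sin (real n * th x) * cos (th x) ^ j)) = 0" for n j
  proof (induction j arbitrary: n)
    case 0
    \<comment> \<open>Frequency \<open>n\<close> is mode \<open>n - 1\<close>, and for
      \<open>n = 0\<close> the integrand vanishes. The case 0 is included because the recursion
      below also refers to the lower neighbour of \<open>n\<close>.\<close>
    then show ?case using zero[of "n - 1"] by (cases n) (simp_all add: sine_th)
  next
    case (Suc j)
    show ?case
    proof (cases n)
      case (Suc m)
      have eq: "sin (real n * t) * cos t = (sin (real (Suc n) * t) + sin (real m * t)) / 2" for t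
      proof -
        have "real (Suc n) * t = real n * t + t" "real m * t = real n * t - t"
          using Suc by (simp_all add: algebra_simps)
        then show ?thesis by (simp only: sin_add sin_diff) simp
      qed
      have "D x * (sin (real n * th x) * cos (th x) ^ Suc j) =
          (1/2) * (D x * (sin (real (Suc n) * th x) * cos (th x) ^ j)
            + D x * (sin (real m * th x) * cos (th x) ^ j))" for x
      proof -
        have "D x * (sin (real n * th x) * cos (th x) ^ Suc j) = D x * ((sin (real n * th x) * cos (th x)) * cos (th x) ^ j)"
          by simp
        then show ?thesis unfolding eq by (simp add: algebra_simps)
      qed
      then have "(LINT x|M. D x * (sin (real n * th x) * cos (th x) ^ Suc j)) =
          (LINT x|M. (1/2) * (D x * (sin (real (Suc n) * th x) * cos (th x) ^ j)
            + D x * (sin (real m * th x) * cos (th x) ^ j)))" by presburger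
      also have "\<dots> = 0"
        unfolding Bochner_Integration.integral_mult_right_zero
        by (subst Bochner_Integration.integral_add)
          (auto simp only: Suc.IH add_0 mult_zero_right intro!: int continuous_intros thc)
      finally show ?thesis .
    qed simp
  qed
  have "AE x in M. D x * sin (th x) = 0"
  proof (rule integral_test_zero_imp_AE_zero)
    show "locally_integrable Om (\<lambda>x. D x * sin (th x))"
      by (intro integrable_imp_locally_integrable int continuous_intros thc)
    fix \<psi> assume "\<psi> \<in> test_functions Om"
    then have \<psi>c: "continuous_on UNIV \<psi>" by (rule test_in_H1)
    \<comment> \<open>\<open>\<psi>\<close> written in the variable \<open>cos (th x)\<close>. As
      \<open>arccos\<close> is continuous up to the end points, Weierstrass applies on all of
      \<open>{-1..1}\<close>.\<close>
    define F where "F y = \<psi> (p + (q - p) / pi * arccos y)" for y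
    have Fc: "continuous_on {-1..1} F"
      unfolding F_def
      by (rule continuous_on_compose2[OF \<psi>c]) (auto intro!: continuous_intros)
    have F: "F (cos (th x)) = \<psi> x" if "x \<in> Om" for x
      using th_range[OF that] p_less_q by (simp add: F_def arccos_cos) (simp add: th_def)
    have "\<bar>LINT x|M. D x * sin (th x) * \<psi> x\<bar> \<le> e * (LINT x|M. \<bar>D x\<bar>)" if e: "e > 0" for e
    proof -
      obtain P where "real_polynomial_function P" and P: "\<And>y. y \<in> {-1..1} \<Longrightarrow> \<bar>F y - P y\<bar> < e"
        using Stone_Weierstrass_real_polynomial_function[OF _ Fc e] by auto
      then obtain a n where Peq: "P = (\<lambda>y. \<Sum>i\<le>n. a i * y ^ i)"
        by (auto simp: real_polynomial_function_iff_sum)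
      have Pi: "integrable M (\<lambda>x. D x * (sin (th x) * P (cos (th x))))"
        unfolding Peq by (intro int continuous_intros thc)
      have "(LINT x|M. D x * (sin (th x) * P (cos (th x)))) =
          (LINT x|M. (\<Sum>i\<le>n. a i * (D x * (sin (real 1 * th x) * cos (th x) ^ i))))"
        by (simp add: Peq sum_distrib_left mult_ac)
      also have "\<dots> = (\<Sum>i\<le>n. a i * (LINT x|M. D x * (sin (real 1 * th x) * cos (th x) ^ i)))"
        by (subst Bochner_Integration.integral_sum)
          (auto intro!: integrable_mult_right int continuous_intros thc simp del: of_nat_1)
      also have "\<dots> = 0" by (simp only: powers mult_zero_right sum.neutral_const)
      finally have P0: "(LINT x|M. D x * (sin (th x) * P (cos (th x)))) = 0" .
      have i1: "integrable M (\<lambda>x. D x * (sin (th x) * \<psi> x))"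
        by (intro int continuous_intros thc \<psi>c)
      have "(LINT x|M. D x * sin (th x) * \<psi> x) =
          (LINT x|M. D x * (sin (th x) * \<psi> x) - D x * (sin (th x) * P (cos (th x))))"
        using i1 Pi P0 by (simp add: mult.assoc)
      also have "\<bar>\<dots>\<bar> \<le> (LINT x|M. e * \<bar>D x\<bar>)"
      proof (rule integral_abs_bound[THEN order_trans], rule integral_mono)
        show "integrable M (\<lambda>x. \<bar>D x * (sin (th x) * \<psi> x) - D x * (sin (th x) * P (cos (th x)))\<bar>)"
          using i1 Pi by simp
        show "integrable M (\<lambda>x. e * \<bar>D x\<bar>)" using D by simp
        fix x assume x: "x \<in> space M"
        have "D x * (sin (th x) * \<psi> x) - D x * (sin (th x) * P (cos (th x))) =
            D x * (sin (th x) * (F (cos (th x)) - P (cos (th x))))"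
          using F x by (simp add: right_diff_distrib)
        then have "\<bar>D x * (sin (th x) * \<psi> x) - D x * (sin (th x) * P (cos (th x)))\<bar> =
            \<bar>D x\<bar> * (\<bar>sin (th x)\<bar> * \<bar>F (cos (th x)) - P (cos (th x))\<bar>)"
          by (simp only: abs_mult)
        also have "\<dots> \<le> \<bar>D x\<bar> * (1 * e)"
          using P[of "cos (th x)"] by (intro mult_left_mono mult_mono) (auto intro: less_imp_le)
        finally show "\<bar>D x * (sin (th x) * \<psi> x) - D x * (sin (th x) * P (cos (th x)))\<bar> \<le> e * \<bar>D x\<bar>"
          by (simp add: mult.commute)
      qed
      finally show ?thesis by simp
    qed
    note bound = this
    have "\<bar>LINT x|M. D x * sin (th x) * \<psi> x\<bar> \<le> 0"
    proof (rule field_le_epsilon)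
      fix e :: real assume "e > 0"
      define B where "B = (LINT x|M. \<bar>D x\<bar>)"
      have B: "0 \<le> B" by (simp add: B_def)
      have "\<bar>LINT x|M. D x * sin (th x) * \<psi> x\<bar> \<le> e / (B + 1) * B"
        unfolding B_def by (rule bound) (use \<open>e > 0\<close> B in \<open>simp add: B_def add_nonneg_pos\<close>)
      also have "\<dots> \<le> e"
        using \<open>e > 0\<close> B by (simp add: divide_simps)
      finally show "\<bar>LINT x|M. D x * sin (th x) * \<psi> x\<bar> \<le> 0 + e" by simp
    qed
    then show "(LINT x|M. D x * sin (th x) * \<psi> x) = 0" by simp
  qed
  moreover have "AE x in M. x \<in> Om" by (rule AE_I2) simp
  ultimately show ?thesis
  proof eventually_elim
    case (elim x)
    then have "sin (th x) > 0" using th_range by (intro sin_gt_zero) auto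
    then show ?case using elim by simp
  qed
qed

end

section \<open>Membership of the sines in \<open>H10\<close>\<close>

lemma flat_0_le_1: "flat 0 y \<le> 1"
  by (simp add: flat_def)

text \<open>The derivative of a cutoff \<open>flat 0 (r * (x - p) - 1)\<close> is
  \<open>r * flat 2 y\<close> with \<open>y + 1 = r * (x - p)\<close>, so this product is that
  derivative times the distance to the end point. The 3 adds the bounds 1 for \<open>flat 1\<close>
  and 2 for \<open>flat 2\<close>.\<close>

lemma flat_2_affine_bounds: "0 \<le> (y + 1) * flat 2 y" "(y + 1) * flat 2 y \<le> 3"
proof -
  have "y * flat 2 y = flat 1 y" by (simp add: flat_def power2_eq_square)
  moreover have "flat 2 y \<le> 2" "flat 1 y \<le> 1"
    using flat_le[of 2 y 0] flat_le[of 1 y 0] by (simp_all add: numeral_2_eq_2)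
  ultimately show "0 \<le> (y + 1) * flat 2 y" "(y + 1) * flat 2 y \<le> 3"
    using flat_nonneg[of 1 y] flat_nonneg[of 2 y] by (simp_all add: algebra_simps)
qed

lemma flat_0_tendsto: "((\<lambda>y. flat 0 y) \<longlongrightarrow> 1) at_top"
proof (rule Lim_transform_eventually)
  show "((\<lambda>y::real. exp (- (1 / y))) \<longlongrightarrow> 1) at_top" by real_asymp
  show "\<forall>\<^sub>F y in at_top. exp (- (1 / y)) = flat 0 y"
    using eventually_gt_at_top[of 0] by eventually_elim (simp add: flat_def)
qed

lemma flat_2_affine_tendsto: "((\<lambda>y. (y + 1) * flat 2 y) \<longlongrightarrow> 0) at_top"
proof (rule Lim_transform_eventually)
  show "((\<lambda>y::real. (y + 1) * (exp (- (1 / y)) / y ^ 2)) \<longlongrightarrow> 0) at_top" by real_asymp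
  show "\<forall>\<^sub>F y in at_top. (y + 1) * (exp (- (1 / y)) / y ^ 2) = (y + 1) * flat 2 y"
    using eventually_gt_at_top[of 0] by eventually_elim (simp add: flat_def)
qed


context interval
begin

text \<open>On a bounded interval a constant is an integrable majorant, so bounded pointwise
  convergence suffices. Uniform convergence of the derivatives would be too much to ask: it fails
  near the end points when sines are cut off.\<close>

lemma H1_norm_tendsto_0:
  assumes f: "\<And>x. (f has_real_derivative f' x) (at x)" "continuous_on UNIV f'"
    and \<psi>: "\<And>n x. (\<psi> n has_real_derivative \<psi>' n x) (at x)" "\<And>n. continuous_on UNIV (\<psi>' n)"
    and bound: "\<And>n x. x \<in> Om \<Longrightarrow> \<bar>f x - \<psi> n x\<bar> \<le> B" "\<And>n x. x \<in> Om \<Longrightarrow> \<bar>f' x - \<psi>' n x\<bar> \<le> B"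
    and lim: "\<And>x. x \<in> Om \<Longrightarrow> (\<lambda>n. \<psi> n x) \<longlonglongrightarrow> f x" "\<And>x. x \<in> Om \<Longrightarrow> (\<lambda>n. \<psi>' n x) \<longlonglongrightarrow> f' x"
  shows "(\<lambda>n::nat. H1_norm Om (f - \<psi> n)) \<longlonglongrightarrow> 0"
proof -
  have conv: "(\<lambda>n. LINT x|M. (g x - r n x)\<^sup>2) \<longlonglongrightarrow> 0"
    if g: "continuous_on UNIV g" and r: "\<And>n. continuous_on UNIV (r n)"
      and b: "\<And>n x. x \<in> Om \<Longrightarrow> \<bar>g x - r n x\<bar> \<le> B" and l: "\<And>x. x \<in> Om \<Longrightarrow> (\<lambda>n. r n x) \<longlonglongrightarrow> g x"
    for g :: "real \<Rightarrow> real" and r :: "nat \<Rightarrow> real \<Rightarrow> real"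
  proof -
    have "(\<lambda>n. LINT x|M. (g x - r n x)\<^sup>2) \<longlonglongrightarrow> (LINT x|M. 0)"
    proof (rule integral_dominated_convergence[where w = "\<lambda>x. B\<^sup>2"])
      show "AE x in M. norm ((g x - r n x)\<^sup>2) \<le> B\<^sup>2" for n
      proof (rule AE_I2)
        fix x assume "x \<in> space M"
        then have "\<bar>g x - r n x\<bar> \<le> B" using b by simp
        then show "norm ((g x - r n x)\<^sup>2) \<le> B\<^sup>2"
          using power_mono[of "\<bar>g x - r n x\<bar>" B 2] by simp
      qed
      show "AE x in M. (\<lambda>n. (g x - r n x)\<^sup>2) \<longlonglongrightarrow> 0"
      proof (rule AE_I2)
        fix x assume "x \<in> space M"
        then have "(\<lambda>n. (g x - r n x)\<^sup>2) \<longlonglongrightarrow> (g x - g x)\<^sup>2"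
          by (intro tendsto_intros l) simp
        then show "(\<lambda>n. (g x - r n x)\<^sup>2) \<longlonglongrightarrow> 0" by simp
      qed
    qed (auto intro!: continuous_imp_borel_measurable_lebesgue continuous_intros g r)
    then show ?thesis by simp
  qed
  have fc: "continuous_on UNIV f" and \<psi>c: "continuous_on UNIV (\<psi> n)" for n
    using f(1) \<psi>(1) by (meson DERIV_isCont continuous_at_imp_continuous_on)+
  have norm_eq: "H1_norm Om (f - \<psi> n) = sqrt ((LINT x|M. (f x - \<psi> n x)\<^sup>2) + (LINT x|M. (f' x - \<psi>' n x)\<^sup>2))" for n
  proof -
    have "AE x in M. weak_deriv Om (\<lambda>x. f x - \<psi> n x) x = f' x - \<psi>' n x"
      by (rule C1_in_H1(2)) (auto intro!: derivative_eq_intros f \<psi> continuous_intros)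
    then have ae: "AE x in M. (weak_deriv Om (f - \<psi> n) x)\<^sup>2 = (f' x - \<psi>' n x)\<^sup>2"
      unfolding fun_diff_def by eventually_elim simp
    have "(\<lambda>x. f x - \<psi> n x) \<in> H1 Om"
      by (rule C1_in_H1(1)[where f' = "\<lambda>x. f' x - \<psi>' n x"]) (auto intro!: derivative_eq_intros f \<psi> continuous_intros)
    then have "weak_deriv Om (f - \<psi> n) \<in> borel_measurable M"
      unfolding fun_diff_def by (rule L2_meas[OF H1_D(2)])
    then have "(LINT x|M. (weak_deriv Om (f - \<psi> n) x)\<^sup>2) = (LINT x|M. (f' x - \<psi>' n x)\<^sup>2)"
      by (intro integral_cong_AE ae borel_measurable_power)
        (auto intro!: continuous_imp_borel_measurable_lebesgue continuous_intros f \<psi>)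
    then show ?thesis by (simp add: H1_norm_def)
  qed
  have "(\<lambda>n. sqrt ((LINT x|M. (f x - \<psi> n x)\<^sup>2) + (LINT x|M. (f' x - \<psi>' n x)\<^sup>2))) \<longlonglongrightarrow> sqrt (0 + 0)"
    by (intro tendsto_intros conv fc \<psi>c f \<psi> bound lim)
  then show ?thesis unfolding norm_eq by simp
qed

text \<open>The cutoffs \<open>flat 0 (r (x - p) - 1)\<close> are not 1 away from the end point but tend to 1; their derivatives,
  of size \<open>r\<close>, are compensated by the linear decay of \<open>f\<close> because \<open>(y + 1) * flat 2 y\<close> is bounded.\<close>

lemma H10_I_smooth:
  assumes f: "f \<in> smooth_funs"
    and le: "\<And>x. x \<in> Om \<Longrightarrow> \<bar>f x\<bar> \<le> C * (x - p)" "\<And>x. x \<in> Om \<Longrightarrow> \<bar>f x\<bar> \<le> C * (q - x)"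
  shows "f \<in> H10 Om"
proof -
  obtain f' where f': "f' \<in> smooth_funs" and df: "\<And>x. (f has_real_derivative f' x) (at x)"
    using smooth_funs_DERIV[OF f] by blast
  have f'c: "continuous_on UNIV f'" and fc: "continuous_on UNIV f"
    using f f' by (auto intro: smooth_funs_continuous)
  define r where "r n = real (Suc n)" for n
  have r: "r n > 0" for n by (simp add: r_def)
  \<comment> \<open>The offset 1 makes \<open>a n\<close> nonpositive up to distance
    \<open>1 / r n\<close> from \<open>p\<close>, and \<open>b n\<close> likewise at
    \<open>q\<close>; this gives the product compact support inside \<open>Om\<close>.\<close>
  define a where "a n x = r n * x + - (r n * p + 1)" for n x
  define b where "b n x = - r n * x + (r n * q - 1)" for n x
  have a1: "a n x + 1 = r n * (x - p)" and b1: "b n x + 1 = r n * (q - x)" for n x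
    by (simp_all add: a_def b_def algebra_simps)
  define \<psi> where "\<psi> n x = flat 0 (a n x) * flat 0 (b n x) * f x" for n x
  define \<psi>' where "\<psi>' n x = r n * flat 2 (a n x) * flat 0 (b n x) * f x
    - flat 0 (a n x) * (r n * flat 2 (b n x)) * f x + flat 0 (a n x) * flat 0 (b n x) * f' x" for n x
  have \<psi>s: "\<psi> n \<in> smooth_funs" for n
    unfolding \<psi>_def a_def b_def by (intro smooth_funs.intros f)
  have da: "((\<lambda>x. flat 0 (a n x)) has_real_derivative flat 2 (a n x) * r n) (at x)" for n x
  proof -
    have "(a n has_real_derivative r n) (at x)" unfolding a_def by (auto intro!: derivative_eq_intros)
    from DERIV_chain2[OF DERIV_flat[of 0] this] show ?thesis by (simp add: numeral_2_eq_2)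
  qed
  have db: "((\<lambda>x. flat 0 (b n x)) has_real_derivative flat 2 (b n x) * - r n) (at x)" for n x
  proof -
    have "(b n has_real_derivative - r n) (at x)" unfolding b_def by (auto intro!: derivative_eq_intros)
    from DERIV_chain2[OF DERIV_flat[of 0] this] show ?thesis by (simp add: numeral_2_eq_2)
  qed
  have d\<psi>: "(\<psi> n has_real_derivative \<psi>' n x) (at x)" for n x
    unfolding \<psi>_def \<psi>'_def
    by (rule DERIV_cong, rule DERIV_mult[OF DERIV_mult[OF da db] df]) (simp add: algebra_simps)
  have flatc: "continuous_on UNIV (\<lambda>x. flat k (a n x))" "continuous_on UNIV (\<lambda>x. flat k (b n x))" for k n
    unfolding a_def b_def by (intro smooth_funs_continuous smooth_funs.intros)+
  have \<psi>'c: "continuous_on UNIV (\<psi>' n)" for n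
    unfolding \<psi>'_def by (intro continuous_intros flatc fc f'c)
  have test: "\<psi> n \<in> test_functions Om" for n
  proof (rule smooth_funs_test_function[OF \<psi>s, of "{p + 1 / r n..q - 1 / r n}"])
    show "{p + 1 / r n..q - 1 / r n} \<subseteq> Om"
    proof
      fix x assume "x \<in> {p + 1 / r n..q - 1 / r n}"
      moreover have "1 / r n > 0" using r by simp
      ultimately have "p < x" "x < q" unfolding atLeastAtMost_iff by linarith+
      then show "x \<in> Om" by simp
    qed
    fix x assume "x \<notin> {p + 1 / r n..q - 1 / r n}"
    then have "a n x \<le> 0 \<or> b n x \<le> 0"
      using r[of n] by (auto simp: a_def b_def not_le field_simps)
    then show "\<psi> n x = 0" by (auto simp: \<psi>_def flat_def)
  qed simp
  have "compact (f' ` {p..q})" "compact (f ` {p..q})"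
    using f'c fc by (intro compact_continuous_image; auto intro: continuous_on_subset)+
  then have "bounded (f' ` {p..q} \<union> f ` {p..q})" by (simp add: compact_imp_bounded)
  then obtain B where B: "\<And>x. x \<in> {p..q} \<Longrightarrow> \<bar>f' x\<bar> \<le> B" "\<And>x. x \<in> {p..q} \<Longrightarrow> \<bar>f x\<bar> \<le> B"
    unfolding bounded_iff by (metis UnCI imageI real_norm_def)
  have C: "C \<ge> 0"
  proof -
    have "0 \<le> C * ((p + q) / 2 - p)"
      using le(1)[of "(p + q) / 2"] p_less_q by (auto intro: order_trans[OF abs_ge_zero])
    then show ?thesis using p_less_q by (simp add: zero_le_mult_iff)
  qed
  have A: "0 \<le> flat 0 y * flat 0 z" "flat 0 y * flat 0 z \<le> 1" for y z
    using flat_nonneg flat_0_le_1 by (auto intro: mult_le_one)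
  have P: "\<bar>(1 - flat 0 y * flat 0 z) * w\<bar> \<le> \<bar>w\<bar>" for y z w
    using A[of y z] by (simp add: abs_mult mult_left_le_one_le)
  have bound1: "\<bar>r n * flat 2 (a n x) * flat 0 (b n x) * f x\<bar> \<le> 3 * C" if "x \<in> Om" for n x
  proof -
    have "\<bar>r n * flat 2 (a n x) * flat 0 (b n x) * f x\<bar> = (r n * flat 2 (a n x)) * flat 0 (b n x) * \<bar>f x\<bar>"
      using r[of n] by (simp add: abs_mult flat_nonneg)
    also have "\<dots> \<le> (r n * flat 2 (a n x)) * 1 * (C * (x - p))"
      using r[of n] le(1)[OF that] by (intro mult_mono) (auto simp: flat_nonneg flat_0_le_1)
    also have "\<dots> = C * ((a n x + 1) * flat 2 (a n x))" by (simp add: a1)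
    also have "\<dots> \<le> C * 3" by (intro mult_left_mono flat_2_affine_bounds C)
    finally show ?thesis by simp
  qed
  have bound2: "\<bar>flat 0 (a n x) * (r n * flat 2 (b n x)) * f x\<bar> \<le> 3 * C" if "x \<in> Om" for n x
  proof -
    have "\<bar>flat 0 (a n x) * (r n * flat 2 (b n x)) * f x\<bar> = flat 0 (a n x) * (r n * flat 2 (b n x)) * \<bar>f x\<bar>"
      using r[of n] by (simp add: abs_mult flat_nonneg)
    also have "\<dots> \<le> 1 * (r n * flat 2 (b n x)) * (C * (q - x))"
      using r[of n] le(2)[OF that] by (intro mult_mono) (auto simp: flat_nonneg flat_0_le_1)
    also have "\<dots> = C * ((b n x + 1) * flat 2 (b n x))" by (simp add: b1)
    also have "\<dots> \<le> C * 3" by (intro mult_left_mono flat_2_affine_bounds C)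
    finally show ?thesis by simp
  qed
  have "(\<lambda>n. H1_norm Om (f - \<psi> n)) \<longlonglongrightarrow> 0"
  proof (rule H1_norm_tendsto_0[where B = "B + 6 * C", OF df f'c d\<psi> \<psi>'c])
    fix n x assume x: "x \<in> Om"
    then have xB: "\<bar>f x\<bar> \<le> B" "\<bar>f' x\<bar> \<le> B" using B by auto
    have "f x - \<psi> n x = (1 - flat 0 (a n x) * flat 0 (b n x)) * f x"
      by (simp add: \<psi>_def algebra_simps)
    then show "\<bar>f x - \<psi> n x\<bar> \<le> B + 6 * C"
      using P[of "a n x" "b n x" "f x"] xB C by simp
    have "f' x - \<psi>' n x = (1 - flat 0 (a n x) * flat 0 (b n x)) * f' x
        - r n * flat 2 (a n x) * flat 0 (b n x) * f x + flat 0 (a n x) * (r n * flat 2 (b n x)) * f x"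
      by (simp add: \<psi>'_def left_diff_distrib)
    then show "\<bar>f' x - \<psi>' n x\<bar> \<le> B + 6 * C"
      using P[of "a n x" "b n x" "f' x"] xB bound1[OF x, of n] bound2[OF x, of n] by linarith
  next
    fix x assume x: "x \<in> Om"
    have r_top: "filterlim r at_top sequentially"
      unfolding r_def by (rule filterlim_compose[OF filterlim_real_sequentially filterlim_Suc])
    have a_top: "filterlim (\<lambda>n. a n x) at_top sequentially"
    proof -
      have "filterlim (\<lambda>n. - 1 + (x - p) * r n) at_top sequentially"
        using x by (intro filterlim_tendsto_add_at_top[OF tendsto_const]
            filterlim_tendsto_pos_mult_at_top[OF tendsto_const _ r_top]) auto
      then show ?thesis by (simp add: a_def algebra_simps)
    qed
    have b_top: "filterlim (\<lambda>n. b n x) at_top sequentially"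
    proof -
      have "filterlim (\<lambda>n. - 1 + (q - x) * r n) at_top sequentially"
        using x by (intro filterlim_tendsto_add_at_top[OF tendsto_const]
            filterlim_tendsto_pos_mult_at_top[OF tendsto_const _ r_top]) auto
      then show ?thesis by (simp add: b_def algebra_simps)
    qed
    note l0 = filterlim_compose[OF flat_0_tendsto a_top] filterlim_compose[OF flat_0_tendsto b_top]
    have ra: "(\<lambda>n. r n * flat 2 (a n x)) \<longlonglongrightarrow> 0"
    proof -
      have "(\<lambda>n. (a n x + 1) * flat 2 (a n x) / (x - p)) \<longlonglongrightarrow> 0 / (x - p)"
        using x by (intro tendsto_intros filterlim_compose[OF flat_2_affine_tendsto a_top]) auto
      moreover have "(a n x + 1) * flat 2 (a n x) / (x - p) = r n * flat 2 (a n x)" for n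
        using x by (simp add: a1)
      ultimately show ?thesis by simp
    qed
    have rb: "(\<lambda>n. r n * flat 2 (b n x)) \<longlonglongrightarrow> 0"
    proof -
      have "(\<lambda>n. (b n x + 1) * flat 2 (b n x) / (q - x)) \<longlonglongrightarrow> 0 / (q - x)"
        using x by (intro tendsto_intros filterlim_compose[OF flat_2_affine_tendsto b_top]) auto
      moreover have "(b n x + 1) * flat 2 (b n x) / (q - x) = r n * flat 2 (b n x)" for n
        using x by (simp add: b1)
      ultimately show ?thesis by simp
    qed
    have "(\<lambda>n. \<psi> n x) \<longlonglongrightarrow> 1 * 1 * f x"
      unfolding \<psi>_def by (intro tendsto_intros l0)
    then show "(\<lambda>n. \<psi> n x) \<longlonglongrightarrow> f x" by simp
    have "(\<lambda>n. \<psi>' n x) \<longlonglongrightarrow> 0 * 1 * f x - 1 * 0 * f x + 1 * 1 * f' x"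
      unfolding \<psi>'_def by (intro tendsto_intros l0 ra rb)
    then show "(\<lambda>n. \<psi>' n x) \<longlonglongrightarrow> f' x" by simp
  qed
  moreover have "f \<in> H1 Om" using df f'c by (rule C1_in_H1)
  ultimately show ?thesis using test by (auto simp: H10_def)
qed

text \<open>At \<open>p\<close> the linear bound is \<open>|sin y| \<le> |y|\<close>; at
  \<open>q\<close> the sine equals, up to sign, the sine of \<open>freq i * (q - x)\<close>.
  Carrying the factor \<open>c\<close> spares a proof that \<open>H10 Om\<close> is closed under
  scaling.\<close>

lemma sine_scaled_H10: "(\<lambda>x. c * sine i x) \<in> H10 Om"
proof (rule H10_I_smooth[where C = "\<bar>c\<bar> * freq i"])
  have "(\<lambda>x. c * sin (freq i * x + (- (freq i * p)))) \<in> smooth_funs" by (intro smooth_funs.intros)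
  then show "(\<lambda>x. c * sine i x) \<in> smooth_funs" by (simp add: sine_def right_diff_distrib)
  fix x assume x: "x \<in> Om"
  have "\<bar>sine i x\<bar> \<le> \<bar>freq i * (x - p)\<bar>" unfolding sine_def by (rule abs_sin_x_le_abs_x)
  also have "\<dots> = freq i * (x - p)" using x freq_pos[of i] by simp
  finally show "\<bar>c * sine i x\<bar> \<le> \<bar>c\<bar> * freq i * (x - p)"
    by (simp add: abs_mult mult.assoc mult_left_mono)
  have "freq i * (x - p) = real (Suc i) * pi - freq i * (q - x)"
    using p_less_q by (simp add: freq_def field_simps)
  then have "sine i x = sin (real (Suc i) * pi) * cos (freq i * (q - x)) - cos (real (Suc i) * pi) * sin (freq i * (q - x))"
    unfolding sine_def by (simp only: sin_diff)
  then have "\<bar>sine i x\<bar> = \<bar>sin (freq i * (q - x))\<bar>"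
    by (simp only: sin_npi cos_npi) (simp add: abs_mult power_abs)
  also have "\<dots> \<le> \<bar>freq i * (q - x)\<bar>" by (rule abs_sin_x_le_abs_x)
  also have "\<dots> = freq i * (q - x)" using x freq_pos[of i] by simp
  finally show "\<bar>c * sine i x\<bar> \<le> \<bar>c\<bar> * freq i * (q - x)"
    by (simp add: abs_mult mult.assoc mult_left_mono)
qed

lemma sine_H10: "sine i \<in> H10 Om"
  using sine_scaled_H10[of 1 i] by simp


section \<open>Sine coefficients and absolutely convergent sine series\<close>

definition sine_coeff :: "(real \<Rightarrow> real) \<Rightarrow> nat \<Rightarrow> real" where "sine_coeff u i = (LINT x|M. u x * sine i x)"

lemma sine_coeff_cong_AE:
  assumes "AE x in M. u x = v x" "u \<in> borel_measurable M" "v \<in> borel_measurable M"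
  shows "sine_coeff u i = sine_coeff v i"
  unfolding sine_coeff_def
proof (rule integral_cong_AE)
  show "AE x in M. u x * sine i x = v x * sine i x" using assms(1) by eventually_elim simp
qed (use assms L2_meas[OF sine_L2] in measurable)

lemma sine_coeff_scaled_sine: "sine_coeff (\<lambda>x. c * sine j x) i = (if i = j then c * (q - p) / 2 else 0)"
  by (simp add: sine_coeff_def mult.assoc sine_orthogonal)

lemma sine_coeff_diff:
  assumes "u \<in> L2 Om" "v \<in> L2 Om"
  shows "sine_coeff (u - v) i = sine_coeff u i - sine_coeff v i"
  using L2_mult_integrable[OF assms(1) sine_L2] L2_mult_integrable[OF assms(2) sine_L2]
  by (simp add: sine_coeff_def left_diff_distrib)

lemma sine_coeff_sq_le_H1_norm:
  assumes "u \<in> L2 Om"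
  shows "(sine_coeff u i)\<^sup>2 \<le> (q - p) / 2 * (H1_norm Om u)\<^sup>2"
proof -
  have "(sine_coeff u i)\<^sup>2 \<le> (LINT x|M. (u x)\<^sup>2) * (LINT x|M. (sine i x)\<^sup>2)"
    unfolding sine_coeff_def by (rule L2_CS[OF assms sine_L2])
  also have "(LINT x|M. (sine i x)\<^sup>2) = (q - p) / 2"
    using sine_orthogonal[of i i] by (simp add: power2_eq_square)
  also have "(LINT x|M. (u x)\<^sup>2) * ((q - p) / 2) \<le> (H1_norm Om u)\<^sup>2 * ((q - p) / 2)"
    using p_less_q by (intro mult_right_mono H1_norm_ge) auto
  finally show ?thesis by (simp add: mult.commute)
qed

lemma sine_coeff_weak_deriv:
  assumes u: "u \<in> H10 Om"
  shows "(LINT x|M. weak_deriv Om u x * cosine i x) = freq i * sine_coeff u i"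
proof -
  have "(LINT x|M. cosine i x * weak_deriv Om u x) = - (LINT x|M. weak_deriv Om (cosine i) x * u x)"
    by (rule H10_parts[OF cosine_H1(1) u])
  also have "(LINT x|M. weak_deriv Om (cosine i) x * u x) = (LINT x|M. - freq i * (u x * sine i x))"
  proof (rule integral_cong_AE)
    show "AE x in M. weak_deriv Om (cosine i) x * u x = - freq i * (u x * sine i x)"
      using cosine_H1(2)[of i] by eventually_elim simp
  qed (use L2_meas[OF H1_D(1)[OF H10_H1[OF u]]] L2_meas[OF H1_D(2)[OF cosine_H1(1)]] L2_meas[OF sine_L2] in measurable)
  finally show ?thesis by (simp add: sine_coeff_def mult.commute)
qed

lemma sine_coeff_weak_deriv_sine:
  assumes u: "u \<in> H10 Om"
  shows "(LINT x|M. weak_deriv Om u x * weak_deriv Om (sine i) x) = (freq i)\<^sup>2 * sine_coeff u i"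
proof -
  have "(LINT x|M. weak_deriv Om u x * weak_deriv Om (sine i) x) = (LINT x|M. freq i * (weak_deriv Om u x * cosine i x))"
  proof (rule integral_cong_AE)
    show "AE x in M. weak_deriv Om u x * weak_deriv Om (sine i) x = freq i * (weak_deriv Om u x * cosine i x)"
      using sine_H1(2)[of i] by eventually_elim simp
  qed (use L2_meas[OF H1_D(2)[OF H10_H1[OF u]]] L2_meas[OF H1_D(2)[OF sine_H1(1)]] L2_meas[OF cosine_L2] in measurable)
  then show ?thesis by (simp add: sine_coeff_weak_deriv[OF u] power2_eq_square)
qed

text \<open>Bessel's inequality for the weak derivative against the cosines: integration by parts
  turns its coefficients into \<open>freq i * sine_coeff u i\<close>. The weight is the source of
  all absolute convergence in space.\<close>

lemma sum_sine_coeff_le: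
  assumes u: "u \<in> H10 Om" and "finite I"
  shows "(\<Sum>i\<in>I. (freq i * sine_coeff u i)\<^sup>2) \<le> (q - p) / 2 * (H1_norm Om u)\<^sup>2"
proof -
  have "(\<Sum>i\<in>I. (LINT x|M. weak_deriv Om u x * cosine i x)\<^sup>2) \<le> (q - p) / 2 * (LINT x|M. (weak_deriv Om u x)\<^sup>2)"
    by (rule Bessel_inequality[OF cosine_L2 H1_D(2)[OF H10_H1[OF u]]])
      (use assms cosine_orthogonal p_less_q in auto)
  also have "\<dots> \<le> (q - p) / 2 * (H1_norm Om u)\<^sup>2"
    using p_less_q by (intro mult_left_mono H1_norm_ge) auto
  finally show ?thesis by (simp add: sine_coeff_weak_deriv[OF u])
qed

lemma summable_freq: "summable (\<lambda>i. 1 / (freq i)\<^sup>2)"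
proof -
  have "summable (\<lambda>i. ((q - p) / pi)\<^sup>2 * inverse (real (Suc i) ^ 2))"
    by (intro summable_mult) (use inverse_power_summable[of 2] in \<open>subst summable_Suc_iff, simp\<close>)
  moreover have "((q - p) / pi)\<^sup>2 * inverse (real (Suc i) ^ 2) = 1 / (freq i)\<^sup>2" for i
    by (simp add: freq_def power_divide power_mult_distrib inverse_eq_divide del: of_nat_Suc)
  ultimately show ?thesis by (simp only:)
qed

text \<open>Arithmetic-geometric mean for the factors \<open>1 / freq i\<close> and
  \<open>freq i * |c|\<close>. With \<open>summable_freq\<close> it converts weighted square sums
  into absolute sums, pointwise in time here and integrated over time later.\<close>

lemma abs_le_freq_squares: "\<bar>c\<bar> \<le> (1 / (freq i)\<^sup>2 + (freq i * c)\<^sup>2) / 2"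
proof -
  have "0 \<le> (1 / freq i - \<bar>freq i * c\<bar>)\<^sup>2" by simp
  then show ?thesis
    using freq_pos[of i] by (simp add: power2_diff abs_mult power_divide power_mult_distrib)
qed

lemma summable_sine_coeff_sq:
  assumes u: "u \<in> H10 Om"
  shows "summable (\<lambda>i. (freq i * sine_coeff u i)\<^sup>2)"
  by (rule bounded_imp_summable[where B = "(q - p) / 2 * (H1_norm Om u)\<^sup>2"])
    (use sum_sine_coeff_le[OF u] in auto)

lemma summable_abs_sine_coeff:
  assumes u: "u \<in> H10 Om"
  shows "summable (\<lambda>i. \<bar>sine_coeff u i\<bar>)"
proof (rule summable_comparison_test')
  show "summable (\<lambda>i. (1 / (freq i)\<^sup>2 + (freq i * sine_coeff u i)\<^sup>2) / 2)"
    by (intro summable_divide summable_add summable_freq summable_sine_coeff_sq[OF u])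
  show "norm \<bar>sine_coeff u i\<bar> \<le> (1 / (freq i)\<^sup>2 + (freq i * sine_coeff u i)\<^sup>2) / 2" if "i \<ge> 0" for i
    using abs_le_freq_squares[of "sine_coeff u i" i] by simp
qed

text \<open>The prefactor makes up for \<open>sine_coeff\<close> not being normalized: the squared
  norm of each sine is \<open>(q - p) / 2\<close>.\<close>

definition sine_series :: "(nat \<Rightarrow> real) \<Rightarrow> real \<Rightarrow> real" where
  "sine_series c x = 2 / (q - p) * (\<Sum>i. c i * sine i x)"

lemma continuous_sine_series:
  assumes c: "summable (\<lambda>i. \<bar>c i\<bar>)"
  shows "continuous_on A (sine_series c)"
proof -
  have "uniform_limit A (\<lambda>n x. \<Sum>i<n. c i * sine i x) (\<lambda>x. \<Sum>i. c i * sine i x) sequentially"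
    by (rule Weierstrass_m_test[OF _ c]) (simp add: abs_mult mult_left_le abs_sine_le)
  then have "continuous_on A (\<lambda>x. \<Sum>i. c i * sine i x)"
    by (rule uniform_limit_theorem[rotated]) (auto intro!: always_eventually continuous_intros continuous_sine)
  then show ?thesis unfolding sine_series_def by (intro continuous_intros)
qed

lemma summable_mult_sine:
  assumes c: "summable (\<lambda>i. \<bar>c i\<bar>)"
  shows "summable (\<lambda>i. c i * sine i x)"
  by (rule summable_comparison_test'[OF c, of 0]) (simp add: abs_mult mult_left_le abs_sine_le)

lemma sine_coeff_sine_series:
  assumes c: "summable (\<lambda>i. \<bar>c i\<bar>)"
  shows "sine_coeff (sine_series c) j = c j"
proof -
  have int: "integrable M (\<lambda>x. c i * (sine i x * sine j x))" for i
    using L2_mult_integrable[OF sine_L2 sine_L2] by simp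
  have le: "norm (c i * (sine i x * sine j x)) \<le> \<bar>c i\<bar>" for i x
    using abs_sine_le[of i x] abs_sine_le[of j x] by (simp add: abs_mult mult_left_le mult_le_one)
  have "sine_coeff (sine_series c) j = (LINT x|M. 2 / (q - p) * (\<Sum>i. c i * (sine i x * sine j x)))"
    unfolding sine_coeff_def sine_series_def
    by (intro Bochner_Integration.integral_cong refl)
      (simp add: suminf_mult2[OF summable_mult_sine[OF c]] mult.assoc)
  also have "\<dots> = 2 / (q - p) * (\<Sum>i. LINT x|M. c i * (sine i x * sine j x))"
  proof (subst Bochner_Integration.integral_mult_right_zero, subst integral_suminf)
    show "AE x in M. summable (\<lambda>i. norm (c i * (sine i x * sine j x)))"
      using le by (intro AE_I2 summable_comparison_test'[OF c, of 0]) auto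
    show "summable (\<lambda>i. LINT x|M. norm (c i * (sine i x * sine j x)))"
    proof (rule summable_comparison_test'[where N = 0])
      show "summable (\<lambda>i. \<bar>c i\<bar> * (q - p))" using c by (rule summable_mult2)
      fix i :: nat
      have "(LINT x|M. norm (c i * (sine i x * sine j x))) \<le> (LINT x|M. \<bar>c i\<bar>)"
        using le[of i] int[of i] by (intro integral_mono) auto
      then show "norm (LINT x|M. norm (c i * (sine i x * sine j x))) \<le> \<bar>c i\<bar> * (q - p)"
        using measure_M by (simp add: mult.commute)
    qed
  qed (use int in auto)
  also have "(\<Sum>i. LINT x|M. c i * (sine i x * sine j x)) = (\<Sum>i. if i = j then c j * ((q - p) / 2) else 0)"
    by (intro suminf_cong) (simp add: sine_orthogonal)
  also have "\<dots> = c j * ((q - p) / 2)"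
    using sums_unique[OF sums_single[of j "\<lambda>_. c j * ((q - p) / 2)"]] by simp
  finally show ?thesis using p_less_q by simp
qed

text \<open>Both functions have the same sine coefficients, and the sines are complete. Since the
  series converges uniformly, it is the continuous representative of \<open>u\<close>.\<close>

lemma H10_AE_eq_sine_series:
  assumes u: "u \<in> H10 Om"
  shows "AE x in M. sine_series (sine_coeff u) x = u x"
proof -
  have u2: "u \<in> L2 Om" by (rule H1_D(1)[OF H10_H1[OF u]])
  have s2: "sine_series (sine_coeff u) \<in> L2 Om"
    by (intro continuous_in_L2 continuous_sine_series summable_abs_sine_coeff u)
  have "AE x in M. (sine_series (sine_coeff u) - u) x = 0"
  proof (rule sine_coefficients_zero_imp_AE_zero)
    show "integrable M (sine_series (sine_coeff u) - u)"
      unfolding fun_diff_def using L2_integrable[OF u2] L2_integrable[OF s2] by simp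
    show "(LINT x|M. (sine_series (sine_coeff u) - u) x * sine i x) = 0" for i
      using sine_coeff_diff[OF s2 u2, of i] sine_coeff_sine_series[OF summable_abs_sine_coeff[OF u], of i]
      by (simp add: sine_coeff_def[of "sine_series (sine_coeff u) - u"])
  qed
  then show ?thesis by simp
qed

section \<open>Point values of continuous representatives\<close>

lemma continuous_AE_eq_imp_eq:
  fixes g h :: "real \<Rightarrow> real"
  assumes g: "continuous_on Om g" and h: "continuous_on Om h" and ae: "AE x in M. g x = h x" and x: "x \<in> Om"
  shows "g x = h x"
proof (rule ccontr)
  assume ne: "g x \<noteq> h x"
  let ?S = "{x \<in> Om. g x - h x \<in> - {0}}"
  have "?S = Om \<inter> (\<lambda>x. g x - h x) -` (- {0})" by auto
  moreover have "open (Om \<inter> (\<lambda>x. g x - h x) -` (- {0}))"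
    by (rule continuous_open_preimage) (auto intro!: continuous_intros g h)
  ultimately have S: "open ?S" by simp
  moreover have "x \<in> ?S" using x ne by simp
  ultimately have "\<not> negligible ?S" using open_not_negligible by blast
  moreover have "AE x in lebesgue. x \<in> Om \<longrightarrow> g x = h x"
    using ae by (simp add: AE_restrict_space_iff)
  then have "AE x in lebesgue. x \<notin> ?S" by eventually_elim auto
  then have "negligible ?S"
    using AE_iff_null_sets[of ?S lebesgue] S by (simp add: negligible_iff_null_sets)
  ultimately show False by simp
qed

text \<open>The definition chooses among the continuous representatives; on \<open>Om\<close> they
  all coincide, because a nonempty open set is not a null set.\<close>

lemma point_value_eq:
  assumes g: "continuous_on {p..q} g" and ae: "AE y in M. g y = f y" and x: "x \<in> Om"
  shows "point_value Om f x = g x"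
proof -
  have cl: "closure Om = {p..q}" using p_less_q by simp
  let ?P = "\<lambda>g. continuous_on (closure Om) g \<and> (AE y in M. g y = f y)"
  have "?P (SOME g. ?P g)" by (rule someI[of ?P g]) (use g ae cl in simp)
  then have c: "continuous_on {p..q} (SOME g. ?P g)" and a: "AE y in M. (SOME g. ?P g) y = f y"
    using cl by auto
  have "AE y in M. (SOME g. ?P g) y = g y" using a ae by eventually_elim simp
  then have "(SOME g. ?P g) x = g x"
    by (rule continuous_AE_eq_imp_eq[rotated 2])
      (use g c x in \<open>auto elim!: continuous_on_subset\<close>)
  then show ?thesis by (simp add: point_value_def)
qed

lemma point_value_H10:
  assumes "u \<in> H10 Om" "x \<in> Om"
  shows "point_value Om u x = sine_series (sine_coeff u) x"
  by (intro point_value_eq continuous_sine_series summable_abs_sine_coeff H10_AE_eq_sine_series assms)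

section \<open>The first Dirichlet eigenspace and its projection\<close>

lemma eigenspace_sine_coeff:
  assumes f: "f \<in> eigenspace Om \<kappa>"
  shows "(\<kappa> - (freq i)\<^sup>2) * sine_coeff f i = 0"
proof -
  have f1: "f \<in> H1 Om" and f10: "f \<in> H10 Om" and d: "weak_deriv Om f \<in> H1 Om"
    and ae: "AE x in M. neg_laplace Om f x - \<kappa> * f x = 0"
    using f by (auto simp: eigenspace_def H2_def)
  have "(freq i)\<^sup>2 * sine_coeff f i = - (LINT x|M. weak_deriv Om (weak_deriv Om f) x * sine i x)"
    using H10_parts[OF d sine_H10[of i]] sine_coeff_weak_deriv_sine[OF f10, of i] by simp
  also have "(LINT x|M. weak_deriv Om (weak_deriv Om f) x * sine i x) = (LINT x|M. - \<kappa> * (f x * sine i x))"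
  proof (rule integral_cong_AE)
    show "AE x in M. weak_deriv Om (weak_deriv Om f) x * sine i x = - \<kappa> * (f x * sine i x)"
      using ae
    proof eventually_elim
      case (elim x)
      then have "weak_deriv Om (weak_deriv Om f) x = - \<kappa> * f x" by (simp add: neg_laplace_def)
      then show ?case by simp
    qed
  qed (use L2_meas[OF H1_D(2)[OF d]] L2_meas[OF H1_D(1)[OF f1]] L2_meas[OF sine_L2] in measurable)
  finally show ?thesis by (auto simp: sine_coeff_def left_diff_distrib)
qed

lemma scaled_sine_eigenspace: "(\<lambda>x. c * sine i x) \<in> eigenspace Om ((freq i)\<^sup>2)"
proof -
  let ?f = "\<lambda>x. c * sine i x" and ?g = "\<lambda>x. c * (freq i * cosine i x)" and ?h = "\<lambda>x. - (freq i)\<^sup>2 * (c * sine i x)"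
  have df: "(?f has_real_derivative ?g x) (at x)" for x
    by (auto intro!: derivative_eq_intros DERIV_sine)
  have dg: "(?g has_real_derivative ?h x) (at x)" for x
    by (auto intro!: derivative_eq_intros DERIV_cosine simp: power2_eq_square)
  have gc: "continuous_on UNIV ?g" and hc: "continuous_on UNIV ?h"
    by (intro continuous_intros continuous_sine continuous_cosine)+
  have f1: "?f \<in> H1 Om" using df gc by (rule C1_in_H1)
  have wg: "AE x in M. weak_deriv Om ?f x = ?g x" using df gc by (rule C1_in_H1)
  have lw: "locally_integrable Om (weak_deriv Om ?f)"
    using H1_D(3)[OF f1] by (simp add: is_weak_deriv_def)
  have m: "weak_deriv Om ?f \<in> borel_measurable M" by (rule locally_integrable_borel_measurable[OF lw])
  have "is_weak_deriv Om ?g ?h" using dg hc by (rule C1_is_weak_deriv)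
  \<comment> \<open>The second weak derivative is taken of the chosen first one, which equals
    \<open>?g\<close> only almost everywhere, so the identity is carried over under the
    integral.\<close>
  then have wd: "is_weak_deriv Om (weak_deriv Om ?f) ?h"
    unfolding is_weak_deriv_def
  proof (intro conjI ballI lw)
    fix \<phi> assume \<phi>: "\<phi> \<in> test_functions Om"
    assume "locally_integrable Om ?g \<and> locally_integrable Om ?h \<and>
      (\<forall>\<phi>\<in>test_functions Om. (LINT x|M. ?g x * deriv \<phi> x) = - (LINT x|M. ?h x * \<phi> x))"
    then have "(LINT x|M. ?g x * deriv \<phi> x) = - (LINT x|M. ?h x * \<phi> x)" using \<phi> by blast
    moreover have "(LINT x|M. weak_deriv Om ?f x * deriv \<phi> x) = (LINT x|M. ?g x * deriv \<phi> x)"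
    proof (rule integral_cong_AE)
      show "AE x in M. weak_deriv Om ?f x * deriv \<phi> x = ?g x * deriv \<phi> x"
        using wg by eventually_elim simp
    qed (use m continuous_imp_borel_measurable_lebesgue(2)[OF test_in_H1(4)[OF \<phi>]]
        continuous_imp_borel_measurable_lebesgue(2)[OF gc] in measurable)
    ultimately show "(LINT x|M. weak_deriv Om ?f x * deriv \<phi> x) = - (LINT x|M. ?h x * \<phi> x)" by simp
  qed simp
  have "weak_deriv Om ?f \<in> H1 Om"
    by (rule H1_I[OF _ _ wd]) (intro H1_D f1 continuous_in_L2 hc)+
  moreover have "AE x in M. neg_laplace Om ?f x - (freq i)\<^sup>2 * ?f x = 0"
    using weak_deriv_AE_eq(2)[OF wd] by eventually_elim (simp add: neg_laplace_def)
  ultimately show ?thesis using f1 sine_scaled_H10 by (simp add: eigenspace_def H2_def)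
qed

lemma AE_zero_if_sine_coeff_zero:
  assumes "u \<in> L2 Om" "\<And>i. sine_coeff u i = 0"
  shows "AE x in M. u x = 0"
  by (rule sine_coefficients_zero_imp_AE_zero) (use assms L2_integrable in \<open>auto simp: sine_coeff_def\<close>)

lemma freq_mono: "freq 0 \<le> freq i"
  using p_less_q by (simp add: freq_def divide_right_mono)

text \<open>If \<open>\<kappa>\<close> is none of the squared frequencies, all sine coefficients of
  an eigenfunction vanish and completeness makes it null. So every eigenvalue is a squared
  frequency.\<close>

lemma lambda1_eq: "lambda1 Om = (freq 0)\<^sup>2"
  unfolding lambda1_def
proof (rule Least_equality)
  have "\<not> (AE x in M. sine 0 x = 0)"
  proof
    assume "AE x in M. sine 0 x = 0"
    then have "sine_coeff (sine 0) 0 = sine_coeff (\<lambda>x. 0) 0"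
      by (rule sine_coeff_cong_AE) (auto intro: L2_meas sine_L2)
    then show False using sine_coeff_scaled_sine[of 1 0 0] p_less_q by (simp add: sine_coeff_def)
  qed
  then show "is_eigenvalue Om ((freq 0)\<^sup>2)"
    using scaled_sine_eigenspace[of 1 0] by (auto simp: is_eigenvalue_def)
  fix \<kappa> assume "is_eigenvalue Om \<kappa>"
  then obtain f where f: "f \<in> eigenspace Om \<kappa>" and ne: "\<not> (AE x in M. f x = 0)"
    by (auto simp: is_eigenvalue_def)
  have "f \<in> L2 Om" using f H1_D by (auto simp: eigenspace_def H2_def)
  then obtain i where "sine_coeff f i \<noteq> 0" using AE_zero_if_sine_coeff_zero ne by blast
  then have "\<kappa> = (freq i)\<^sup>2" using eigenspace_sine_coeff[OF f, of i] by simp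
  then show "(freq 0)\<^sup>2 \<le> \<kappa>"
    using freq_mono[of i] freq_pos[of 0] by (simp add: power_mono)
qed

lemma freq_inj: "freq i = freq j \<longleftrightarrow> i = j"
  using p_less_q by (simp add: freq_def)

text \<open>Elements of the first eigenspace are multiples of \<open>sine 0\<close> almost
  everywhere, and orthogonality to \<open>sine 0\<close> fixes the multiple. Existence of a
  projection must be shown as well, since \<open>P1\<close> is a choice. The formula turns the
  assumption on \<open>P1\<close> at \<open>x0\<close> into a nonzero first coefficient.\<close>

lemma P1_point_value:
  assumes u: "u \<in> L2 Om" and x: "x \<in> Om"
  shows "point_value Om (P1 Om u) x = 2 / (q - p) * sine_coeff u 0 * sine 0 x"
proof -
  let ?E = "eigenspace Om ((freq 0)\<^sup>2)"
  let ?P = "\<lambda>v. v \<in> ?E \<and> (\<forall>w\<in>?E. (LINT x|M. (u x - v x) * w x) = 0)"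
  let ?v = "\<lambda>x. 2 / (q - p) * sine_coeff u 0 * sine 0 x"
  have E10: "w \<in> H10 Om" if "w \<in> ?E" for w using that by (simp add: eigenspace_def)
  have E0: "sine_coeff w i = 0" if "w \<in> ?E" "i \<noteq> 0" for w i
  proof -
    have "(freq 0)\<^sup>2 \<noteq> (freq i)\<^sup>2"
      using freq_pos[of 0] freq_pos[of i] freq_inj[of 0 i] that by (simp add: power2_eq_iff_nonneg)
    then show ?thesis using eigenspace_sine_coeff[OF that(1), of i] by simp
  qed
  have ser: "sine_series (sine_coeff w) y = 2 / (q - p) * (sine_coeff w 0 * sine 0 y)" if "w \<in> ?E" for w y
  proof -
    have "(\<Sum>i. sine_coeff w i * sine i y) = (\<Sum>i\<in>{0}. sine_coeff w i * sine i y)"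
      by (rule suminf_finite) (use E0[OF that] in auto)
    then show ?thesis by (simp add: sine_series_def)
  qed
  have E: "AE y in M. w y = 2 / (q - p) * (sine_coeff w 0 * sine 0 y)" if "w \<in> ?E" for w
    using H10_AE_eq_sine_series[OF E10[OF that]] by eventually_elim (metis ser that)
  have v2: "?v \<in> L2 Om" by (intro continuous_in_L2 continuous_intros continuous_sine)
  have uv: "u - ?v \<in> L2 Om" using L2_lin[OF u v2, of 1 "-1"] by (simp add: fun_diff_def)
  have "?P ?v"
  proof (intro conjI ballI)
    show "?v \<in> ?E" by (rule scaled_sine_eigenspace)
    fix w assume w: "w \<in> ?E"
    have wm: "w \<in> borel_measurable M" using H1_D(1)[OF H10_H1[OF E10[OF w]]] L2_meas by blast
    have "(LINT x|M. (u x - ?v x) * w x) = (LINT x|M. 2 / (q - p) * sine_coeff w 0 * ((u - ?v) x * sine 0 x))"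
    proof (rule integral_cong_AE)
      show "AE x in M. (u x - ?v x) * w x = 2 / (q - p) * sine_coeff w 0 * ((u - ?v) x * sine 0 x)"
        using E[OF w] by eventually_elim simp
    qed (use L2_meas[OF u] L2_meas[OF uv] wm L2_meas[OF sine_L2[of 0]] in measurable)
    also have "\<dots> = 2 / (q - p) * sine_coeff w 0 * sine_coeff (u - ?v) 0" by (simp add: sine_coeff_def)
    also have "sine_coeff (u - ?v) 0 = 0"
      using sine_coeff_diff[OF u v2, of 0] sine_coeff_scaled_sine[of "2 / (q - p) * sine_coeff u 0" 0 0] p_less_q by simp
    finally show "(LINT x|M. (u x - ?v x) * w x) = 0" by simp
  qed
  then have P: "?P (P1 Om u)" unfolding P1_def lambda1_eq by (rule someI[of ?P])
  then have p2: "P1 Om u \<in> L2 Om" using E10 H10_H1 H1_D(1) by blast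
  have "sine 0 \<in> ?E" using scaled_sine_eigenspace[of 1 0] by simp
  then have "sine_coeff (u - P1 Om u) 0 = 0" using P by (simp add: sine_coeff_def)
  then have "sine_coeff (P1 Om u) 0 = sine_coeff u 0" using sine_coeff_diff[OF u p2, of 0] by simp
  then show ?thesis using point_value_H10[OF E10 x] ser P by simp
qed

lemma sine_0_pos: "x \<in> Om \<Longrightarrow> sine 0 x > 0"
  using p_less_q unfolding sine_def freq_def by (intro sin_gt_zero) (auto simp: field_simps)

end

section \<open>Truncated Laplace transforms\<close>

text \<open>The kernel of \<open>J_frac\<close> without the Gamma factor, extended by 0, so that the
  fractional integral becomes a convolution over the whole line and translations need no case
  distinctions.\<close>

definition pker :: "real \<Rightarrow> real \<Rightarrow> real" where
  "pker \<alpha> t = (if t > 0 then t powr (\<alpha> - 1) else 0)"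

lemma pker_nonneg: "0 \<le> pker \<alpha> t"
  by (simp add: pker_def)

lemma pker_measurable [measurable]: "pker \<alpha> \<in> borel_measurable borel"
  unfolding pker_def by measurable

lemma laplace_pker:
  assumes \<alpha>: "\<alpha> > 0" and s: "s > 0"
  shows "has_bochner_integral lborel (\<lambda>t. exp (- s * t) * pker \<alpha> t) (Gamma \<alpha> * s powr (- \<alpha>))"
proof -
  have eq: "indicator {0..} t * t powr (\<alpha> - 1) / exp t = exp (- t) * pker \<alpha> t" for t :: real
    by (auto simp: pker_def indicator_def exp_minus field_simps)
  have "has_bochner_integral lborel (\<lambda>t. exp (- t) * pker \<alpha> t) (Gamma \<alpha>)"
  proof (rule has_bochner_integral_nn_integral)
    show "(\<integral>\<^sup>+ t. ennreal (exp (- t) * pker \<alpha> t) \<partial>lborel) = ennreal (Gamma \<alpha>)"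
      using Gamma_conv_nn_integral_real[OF \<alpha>] by (simp add: eq)
    show "0 \<le> Gamma \<alpha>" using \<alpha> Gamma_real_pos[of \<alpha>] by simp
    show "AE t in lborel. 0 \<le> exp (- t) * pker \<alpha> t" by (simp add: pker_nonneg)
  qed measurable
  then have "has_bochner_integral lborel (\<lambda>t. exp (- (0 + s * t)) * pker \<alpha> (0 + s * t)) (Gamma \<alpha> /\<^sub>R \<bar>s\<bar>)"
    using s by (subst (asm) lborel_has_bochner_integral_real_affine_iff[of s _ _ 0]) auto
  then have "has_bochner_integral lborel (\<lambda>t. s powr (1 - \<alpha>) * (exp (- (0 + s * t)) * pker \<alpha> (0 + s * t)))
      (s powr (1 - \<alpha>) * (Gamma \<alpha> /\<^sub>R \<bar>s\<bar>))"
    by (rule has_bochner_integral_mult_right)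
  moreover have "s powr (1 - \<alpha>) * (exp (- (0 + s * t)) * pker \<alpha> (0 + s * t)) = exp (- s * t) * pker \<alpha> t" for t
  proof (cases "t > 0")
    case True
    have "s powr (1 - \<alpha>) * (s powr (\<alpha> - 1)) = 1" using s by (simp flip: powr_add)
    then show ?thesis using True s by (simp add: pker_def powr_mult zero_less_mult_iff)
  next
    case False
    then show ?thesis using s by (simp add: pker_def zero_less_mult_iff)
  qed
  moreover have "s powr (1 - \<alpha>) * (Gamma \<alpha> /\<^sub>R \<bar>s\<bar>) = Gamma \<alpha> * s powr (- \<alpha>)"
    using s powr_add[of s 1 "- \<alpha>"] by (simp add: field_simps)
  ultimately show ?thesis by (simp only:)
qed

lemma laplace_exp:
  fixes s :: real
  assumes "s > 0"
  shows "has_bochner_integral lborel (\<lambda>t. indicator {0<..} t * exp (- s * t)) (1 / s)"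
proof -
  have "exp (- s * t) * pker 1 t = indicator {0<..} t * exp (- s * t)" for t :: real
    by (simp add: pker_def indicator_def)
  then show ?thesis
    using laplace_pker[of 1 s] assms by (simp add: powr_minus_divide mult.commute)
qed

text \<open>As \<open>\<alpha> < 1\<close> the kernel decreases, so beyond \<open>b\<close> it lies
  below its own translate by \<open>b\<close>. The transform of that translate is
  \<open>exp (- s * b)\<close> times the full transform.\<close>

lemma laplace_pker_tail:
  assumes \<alpha>: "0 < \<alpha>" "\<alpha> < 1" and s: "s > 0" and b: "b > 0"
  shows "\<bar>(LINT t|lborel. indicator {..<b} t * (exp (- s * t) * pker \<alpha> t)) - Gamma \<alpha> * s powr (- \<alpha>)\<bar>
    \<le> exp (- s * b) * (Gamma \<alpha> * s powr (- \<alpha>))"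
proof -
  let ?f = "\<lambda>t. exp (- s * t) * pker \<alpha> t"
  have f: "integrable lborel ?f" "(LINT t|lborel. ?f t) = Gamma \<alpha> * s powr (- \<alpha>)"
    using laplace_pker[OF \<alpha>(1) s] by (simp_all add: has_bochner_integral_iff)
  have fi: "integrable lborel (\<lambda>t. indicator A t * ?f t)" if "A \<in> sets borel" for A
    using integrable_mult_indicator[of A lborel ?f] f that by simp
  have ft: "integrable lborel (\<lambda>t. ?f (- b + 1 * t))" "(LINT t|lborel. ?f (- b + 1 * t)) = Gamma \<alpha> * s powr (- \<alpha>)"
    using lborel_integrable_real_affine[OF f(1), of 1 "- b"] lborel_integral_real_affine[of 1 ?f "- b"] f by simp_all
  have "(LINT t|lborel. indicator {b..} t * ?f t) \<le> (LINT t|lborel. exp (- s * b) * ?f (- b + 1 * t))"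
  proof (rule integral_mono_AE)
    show "AE t in lborel. indicator {b..} t * ?f t \<le> exp (- s * b) * ?f (- b + 1 * t)"
      using AE_lborel_singleton[of b]
    proof eventually_elim
      case (elim t)
      show ?case
      proof (cases "t > b")
        case True
        then have "t powr (\<alpha> - 1) \<le> (t - b) powr (\<alpha> - 1)"
          using b \<alpha> by (intro powr_mono2') auto
        then have "exp (- s * t) * t powr (\<alpha> - 1) \<le> exp (- s * t) * (t - b) powr (\<alpha> - 1)"
          by (intro mult_left_mono) auto
        moreover have "exp (- s * t) = exp (- s * b) * exp (- s * (- b + 1 * t))"
          by (simp flip: exp_add add: algebra_simps)
        ultimately show ?thesis using True b by (simp add: pker_def algebra_simps)
      next
        case False
        then have "indicator {b..} t = (0::real)" using elim by (simp add: indicator_def)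
        then show ?thesis by (simp add: pker_nonneg)
      qed
    qed
  qed (use fi ft in auto)
  moreover have "0 \<le> (LINT t|lborel. indicator {b..} t * ?f t)"
    by (simp add: pker_nonneg)
  moreover have "(LINT t|lborel. indicator {..<b} t * ?f t) =
      (LINT t|lborel. ?f t - indicator {b..} t * ?f t)"
    by (intro Bochner_Integration.integral_cong refl) (simp add: indicator_def)
  ultimately show ?thesis using f fi[of "{b..}"] ft by simp
qed

text \<open>The reason for uniformity over the modes: solving for \<open>C\<close> divides the error
  by \<open>1 + \<kappa> * P\<close>, and \<open>\<kappa> * P / (1 + \<kappa> * P) \<le> 1\<close>
  absorbs the factor \<open>\<kappa>\<close>. In the application \<open>C\<close> is a truncated
  transform, \<open>G * P\<close> the transform of the kernel, \<open>e\<close> is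
  \<open>exp (- s * \<tau>)\<close>, \<open>E\<close> the truncation error of the convolution and
  \<open>N\<close> the integral norm of the coefficient function.\<close>

lemma volterra_resolvent_bound:
  fixes C c0 s G P \<kappa> E e N :: real
  assumes s: "s > 0" and G: "G > 0" and P: "P \<ge> 0" and \<kappa>: "\<kappa> \<ge> 0"
    and eq: "\<kappa> / G * (G * P * C - E) = c0 * ((1 - e) / s) - C"
    and E: "\<bar>E\<bar> \<le> e * (G * P) * N" and e: "e \<ge> 0" and N: "N \<ge> 0"
  shows "\<bar>C - c0 / s / (1 + \<kappa> * P)\<bar> \<le> e * (\<bar>c0\<bar> / s + N)"
proof -
  let ?d = "1 + \<kappa> * P"
  have d: "?d \<ge> 1" using \<kappa> P by simp
  have "\<kappa> / G * (G * P * C - E) = \<kappa> * P * C - \<kappa> / G * E"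
    using G by (simp add: right_diff_distrib)
  moreover have "c0 * ((1 - e) / s) = c0 / s - c0 * e / s" by (simp add: diff_divide_distrib right_diff_distrib)
  moreover have "C * ?d = C + \<kappa> * P * C" by (simp add: algebra_simps)
  ultimately have Cd: "C * ?d - c0 / s = \<kappa> / G * E - c0 * e / s" using eq by linarith
  have "C - c0 / s / ?d = (C * ?d - c0 / s) / ?d" using d by (simp add: diff_divide_distrib)
  then have C: "C - c0 / s / ?d = (\<kappa> / G * E) / ?d - (c0 * e / s) / ?d"
    unfolding Cd by (simp only: diff_divide_distrib)
  have r1: "\<bar>(c0 * e / s) / ?d\<bar> \<le> e * (\<bar>c0\<bar> / s)"
  proof -
    have "\<bar>(c0 * e / s) / ?d\<bar> = (e * (\<bar>c0\<bar> / s)) / ?d"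
      using d s e by (simp add: abs_mult)
    also have "\<dots> \<le> (e * (\<bar>c0\<bar> / s)) / 1"
      using d s e by (intro divide_left_mono) auto
    finally show ?thesis by simp
  qed
  have r2: "\<bar>(\<kappa> / G * E) / ?d\<bar> \<le> e * N"
  proof -
    have "\<bar>(\<kappa> / G * E) / ?d\<bar> = (\<kappa> / G * \<bar>E\<bar>) / ?d"
      using d \<kappa> G by (simp add: abs_mult)
    also have "\<dots> \<le> (\<kappa> / G * (e * (G * P) * N)) / ?d"
      using d \<kappa> G E by (intro divide_right_mono mult_left_mono) auto
    also have "\<dots> = (e * N) * ((\<kappa> * P) / ?d)"
      using G by simp
    also have "\<dots> \<le> (e * N) * 1"
      using d \<kappa> e N by (intro mult_left_mono) (auto simp: divide_le_eq)
    finally show ?thesis by simp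
  qed
  show ?thesis using C r1 r2 unfolding distrib_left by linarith
qed

text \<open>Fubini almost factorizes the transform of the convolution over
  \<open>{0<..<\<tau>}\<close>: the part of \<open>c\<close> at time \<open>r\<close> meets the
  kernel cut off at \<open>\<tau> - r\<close>. The missing tail costs
  \<open>exp (- s * (\<tau> - r))\<close>, which combines with the weight
  \<open>exp (- s * r)\<close> to \<open>exp (- s * \<tau>)\<close> for every \<open>r\<close>.
  Causality of the equation means that \<open>c\<close> beyond \<open>\<tau>\<close> never
  enters.\<close>

lemma truncated_laplace_volterra:
  assumes \<alpha>: "0 < \<alpha>" "\<alpha> < 1" and s: "s > 0" and \<tau>: "\<tau> > 0" and \<kappa>: "\<kappa> \<ge> 0"
    and c: "integrable lborel c" and supp: "\<And>t. t \<notin> {0<..<\<tau>} \<Longrightarrow> c t = 0"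
    and volterra: "AE t in lborel. t \<in> {0<..<\<tau>} \<longrightarrow>
      c t = c0 - \<kappa> / Gamma \<alpha> * (LINT r|lborel. pker \<alpha> (t - r) * c r)"
  shows "\<bar>(LINT t|lborel. exp (- s * t) * c t) - c0 * s powr (\<alpha> - 1) / (s powr \<alpha> + \<kappa>)\<bar>
    \<le> exp (- s * \<tau>) * (\<bar>c0\<bar> / s + (LINT t|lborel. \<bar>c t\<bar>))"
proof -
  let ?G = "Gamma \<alpha> * s powr (- \<alpha>)"
  have G: "Gamma \<alpha> > 0" using \<alpha> by simp
  have cm [measurable]: "c \<in> borel_measurable borel" using c by auto
  \<comment> \<open>Transform of the kernel cut off at \<open>b\<close>; it takes the place of the
    full transform in the Fubini computation.\<close>
  define I where "I b = (LINT t|lborel. indicator {..<b} t * (exp (- s * t) * pker \<alpha> t))" for b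
  have kint: "integrable lborel (\<lambda>t. indicator A t * (exp (- s * t) * pker \<alpha> t))" if "A \<in> sets borel" for A
    using integrable_mult_indicator[of A lborel "\<lambda>t. exp (- s * t) * pker \<alpha> t"] that
      laplace_pker[OF \<alpha>(1) s] by (simp add: has_bochner_integral_iff)
  have shift: "(LINT t|lborel. indicator {..<\<tau>} t * exp (- s * t) * pker \<alpha> (t - r)) = exp (- s * r) * I (\<tau> - r)"
    and shift_int: "integrable lborel (\<lambda>t. indicator {..<\<tau>} t * exp (- s * t) * pker \<alpha> (t - r))" for r
  proof -
    have eq: "indicator {..<\<tau>} (r + 1 * t) * exp (- s * (r + 1 * t)) * pker \<alpha> (r + 1 * t - r) =
        exp (- s * r) * (indicator {..<\<tau> - r} t * (exp (- s * t) * pker \<alpha> t))" for t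
      by (auto simp: indicator_def distrib_left simp flip: exp_add)
    show "(LINT t|lborel. indicator {..<\<tau>} t * exp (- s * t) * pker \<alpha> (t - r)) = exp (- s * r) * I (\<tau> - r)"
      by (subst lborel_integral_real_affine[of 1 _ r], simp, subst eq) (simp add: I_def)
    show "integrable lborel (\<lambda>t. indicator {..<\<tau>} t * exp (- s * t) * pker \<alpha> (t - r))"
      by (subst lborel_integrable_real_affine_iff[of 1 _ r, symmetric], simp, subst eq)
        (rule integrable_mult_right, rule kint, simp)
  qed
  have I_nonneg: "0 \<le> I b" for b by (simp add: I_def pker_nonneg)
  have I_le: "I b \<le> ?G" for b
  proof -
    have "I b \<le> (LINT t|lborel. exp (- s * t) * pker \<alpha> t)"
      unfolding I_def
    proof (rule integral_mono)
      show "integrable lborel (\<lambda>t. indicator {..<b} t * (exp (- s * t) * pker \<alpha> t))"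
        by (rule kint) simp
    qed (use laplace_pker[OF \<alpha>(1) s] in \<open>auto simp: has_bochner_integral_iff indicator_def pker_nonneg\<close>)
    then show ?thesis using laplace_pker[OF \<alpha>(1) s] by (simp add: has_bochner_integral_iff)
  qed
  have Im [measurable]: "(\<lambda>r. I (\<tau> - r)) \<in> borel_measurable borel"
  proof -
    have "I (\<tau> - r) = (LINT t|lborel. (if t < \<tau> - r then exp (- s * t) * pker \<alpha> t else 0))" for r
      unfolding I_def by (intro Bochner_Integration.integral_cong refl) simp
    then show ?thesis by simp
  qed
  define F where "F r t = indicator {..<\<tau>} t * exp (- s * t) * pker \<alpha> (t - r) * c r" for r t
  have exp_le1: "exp (- s * r) \<le> 1" if "c r \<noteq> 0" for r
    using supp[of r] that s by fastforce
  have cI: "integrable lborel (\<lambda>r. exp (- s * r) * I (\<tau> - r) * c r)"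
  proof (rule Bochner_Integration.integrable_bound)
    show "integrable lborel (\<lambda>r. ?G * c r)" using c by simp
    show "AE r in lborel. norm (exp (- s * r) * I (\<tau> - r) * c r) \<le> norm (?G * c r)"
    proof (rule AE_I2)
      fix r
      show "norm (exp (- s * r) * I (\<tau> - r) * c r) \<le> norm (?G * c r)"
      proof (cases "c r = 0")
        case False
        have "exp (- s * r) * I (\<tau> - r) \<le> 1 * ?G"
          by (intro mult_mono exp_le1 I_le I_nonneg False) auto
        then show ?thesis using G I_nonneg[of "\<tau> - r"] by (simp add: abs_mult mult_right_mono)
      qed simp
    qed
  qed measurable
  have Fint: "integrable (lborel \<Otimes>\<^sub>M lborel) (case_prod F)"
  proof (rule lborel_pair.Fubini_integrable)
    show "case_prod F \<in> borel_measurable (lborel \<Otimes>\<^sub>M lborel)"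
      unfolding F_def by measurable
    have "(LINT t|lborel. norm (case_prod F (r, t))) = \<bar>exp (- s * r) * I (\<tau> - r) * c r\<bar>" for r
    proof -
      have "(LINT t|lborel. norm (case_prod F (r, t))) =
          (LINT t|lborel. indicator {..<\<tau>} t * exp (- s * t) * pker \<alpha> (t - r) * \<bar>c r\<bar>)"
        by (intro Bochner_Integration.integral_cong refl) (simp add: F_def abs_mult pker_nonneg)
      also have "\<dots> = exp (- s * r) * I (\<tau> - r) * \<bar>c r\<bar>" using shift[of r] by simp
      finally show ?thesis by (simp add: abs_mult I_nonneg)
    qed
    then show "integrable lborel (\<lambda>r. LINT t|lborel. norm (case_prod F (r, t)))"
      using cI by simp
    show "AE r in lborel. integrable lborel (\<lambda>t. case_prod F (r, t))"
      using shift_int by (simp add: F_def)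
  qed
  let ?C = "LINT t|lborel. exp (- s * t) * c t"
  let ?N = "LINT t|lborel. \<bar>c t\<bar>"
  have eint: "integrable lborel (\<lambda>t. exp (- s * t) * c t)"
  proof (rule Bochner_Integration.integrable_bound[OF c])
    show "AE r in lborel. norm (exp (- s * r) * c r) \<le> norm (c r)"
    proof (rule AE_I2)
      fix r
      show "norm (exp (- s * r) * c r) \<le> norm (c r)"
        using exp_le1[of r] by (cases "c r = 0") (simp_all add: abs_mult)
    qed
  qed measurable
  define J where "J t = (LINT r|lborel. pker \<alpha> (t - r) * c r)" for t
  have Jm [measurable]: "J \<in> borel_measurable borel"
    unfolding J_def by measurable
  have e0: "has_bochner_integral lborel (\<lambda>t. indicator {0<..<\<tau>} t * exp (- s * t)) ((1 - exp (- s * \<tau>)) / s)"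
  proof -
    have *: "has_bochner_integral lborel (\<lambda>t. indicator {0<..} t * exp (- s * t)) (1 / s)"
      by (rule laplace_exp[OF s])
    then have "has_bochner_integral lborel (\<lambda>t. indicator {0<..} (- \<tau> + 1 * t) * exp (- s * (- \<tau> + 1 * t))) (1 / s)"
      by (subst (asm) lborel_has_bochner_integral_real_affine_iff[of 1 _ _ "- \<tau>"]) auto
    then have "has_bochner_integral lborel (\<lambda>t. exp (- s * \<tau>) * (indicator {0<..} (- \<tau> + 1 * t) * exp (- s * (- \<tau> + 1 * t))))
        (exp (- s * \<tau>) * (1 / s))"
      by (rule has_bochner_integral_mult_right)
    also have "(\<lambda>t. exp (- s * \<tau>) * (indicator {0<..} (- \<tau> + 1 * t) * exp (- s * (- \<tau> + 1 * t)))) =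
        (\<lambda>t. indicator {\<tau><..} t * exp (- s * t))"
      by (auto simp: fun_eq_iff indicator_def algebra_simps simp flip: exp_add)
    finally have "has_bochner_integral lborel (\<lambda>t. indicator {0<..} t * exp (- s * t) - indicator {\<tau><..} t * exp (- s * t))
      (1 / s - exp (- s * \<tau>) * (1 / s))"
      using * by (intro has_bochner_integral_diff)
    moreover have "AE t in lborel. indicator {0<..} t * exp (- s * t) - indicator {\<tau><..} t * exp (- s * t) =
        indicator {0<..<\<tau>} t * exp (- s * t)"
      using AE_lborel_singleton[of \<tau>] by eventually_elim (use \<tau> in \<open>auto simp: indicator_def\<close>)
    ultimately have "has_bochner_integral lborel (\<lambda>t. indicator {0<..<\<tau>} t * exp (- s * t)) (1 / s - exp (- s * \<tau>) * (1 / s))"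
      by (subst has_bochner_integral_cong_AE[symmetric]) auto
    then show ?thesis by (simp add: diff_divide_distrib)
  qed
  have fubini: "(LINT t|lborel. LINT r|lborel. F r t) = (LINT r|lborel. LINT t|lborel. F r t)"
    using lborel_pair.Fubini_integral[OF Fint] .
  have lhs: "\<kappa> / Gamma \<alpha> * (LINT t|lborel. LINT r|lborel. F r t) = c0 * ((1 - exp (- s * \<tau>)) / s) - ?C"
  proof -
    have "\<kappa> / Gamma \<alpha> * (LINT t|lborel. LINT r|lborel. F r t) = (LINT t|lborel. \<kappa> / Gamma \<alpha> * (indicator {..<\<tau>} t * exp (- s * t) * J t))"
      by (simp add: F_def J_def mult.assoc)
    also have "\<dots> = (LINT t|lborel. c0 * (indicator {0<..<\<tau>} t * exp (- s * t)) - exp (- s * t) * c t)"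
    proof (rule integral_cong_AE)
      show "AE t in lborel. \<kappa> / Gamma \<alpha> * (indicator {..<\<tau>} t * exp (- s * t) * J t) =
          c0 * (indicator {0<..<\<tau>} t * exp (- s * t)) - exp (- s * t) * c t"
        using volterra
      proof eventually_elim
        case (elim t)
        show ?case
        proof (cases "t \<in> {0<..<\<tau>}")
          case True
          then have "\<kappa> / Gamma \<alpha> * J t = c0 - c t" using elim by (simp add: J_def)
          then have "exp (- s * t) * (\<kappa> / Gamma \<alpha> * J t) = exp (- s * t) * (c0 - c t)" by simp
          then show ?thesis using True by (simp add: algebra_simps)
        next
          case False
          \<comment> \<open>For \<open>t \<le> 0\<close> the kernel vanishes on the support of
            \<open>c\<close>; for \<open>t \<ge> \<tau>\<close> the indicator is 0.\<close>
          have "indicator {..<\<tau>} t * J t = 0"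
          proof (cases "t < \<tau>")
            case True
            then have "pker \<alpha> (t - r) * c r = 0" for r
              using False supp[of r] by (cases "r \<in> {0<..<\<tau>}") (auto simp: pker_def)
            then have "J t = 0" unfolding J_def by (intro integral_eq_zero_AE AE_I2)
            then show ?thesis by simp
          qed simp
          then show ?thesis using False supp[of t] by auto
        qed
      qed
    qed measurable
    also have "\<dots> = c0 * ((1 - exp (- s * \<tau>)) / s) - ?C"
      using e0 eint by (simp add: has_bochner_integral_iff)
    finally show ?thesis .
  qed
  define E where "E = ?G * ?C - (LINT r|lborel. LINT t|lborel. F r t)"
  have E: "\<bar>E\<bar> \<le> exp (- s * \<tau>) * ?G * ?N"
  proof -
    define Gs where "Gs = ?G"
    have "(LINT r|lborel. LINT t|lborel. F r t) = (LINT r|lborel. exp (- s * r) * I (\<tau> - r) * c r)"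
      by (simp only: F_def Bochner_Integration.integral_mult_left_zero shift)
    then have "E = (LINT r|lborel. Gs * (exp (- s * r) * c r) - exp (- s * r) * I (\<tau> - r) * c r)"
      by (simp only: E_def Gs_def[symmetric] Bochner_Integration.integral_mult_right_zero
          Bochner_Integration.integral_diff[OF integrable_mult_right[OF eint] cI])
    also have "\<bar>\<dots>\<bar> \<le> (LINT r|lborel. exp (- s * \<tau>) * Gs * \<bar>c r\<bar>)"
    proof (rule integral_abs_bound[THEN order_trans], rule integral_mono)
      show "integrable lborel (\<lambda>r. \<bar>Gs * (exp (- s * r) * c r) - exp (- s * r) * I (\<tau> - r) * c r\<bar>)"
        by (intro integrable_abs Bochner_Integration.integrable_diff integrable_mult_right eint cI)
      show "integrable lborel (\<lambda>r. exp (- s * \<tau>) * Gs * \<bar>c r\<bar>)"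
        by (intro integrable_mult_right integrable_abs c)
      fix r
      show "\<bar>Gs * (exp (- s * r) * c r) - exp (- s * r) * I (\<tau> - r) * c r\<bar> \<le> exp (- s * \<tau>) * Gs * \<bar>c r\<bar>"
      proof (cases "r \<in> {0<..<\<tau>}")
        case True
        have "Gs * (exp (- s * r) * c r) - exp (- s * r) * I (\<tau> - r) * c r =
            exp (- s * r) * (Gs - I (\<tau> - r)) * c r"
          by (simp only: right_diff_distrib left_diff_distrib mult_ac)
        then have "\<bar>Gs * (exp (- s * r) * c r) - exp (- s * r) * I (\<tau> - r) * c r\<bar> =
            exp (- s * r) * \<bar>I (\<tau> - r) - Gs\<bar> * \<bar>c r\<bar>"
          by (simp only: abs_mult abs_minus_commute[of Gs] abs_exp_cancel)
        also have "\<dots> \<le> exp (- s * r) * (exp (- s * (\<tau> - r)) * Gs) * \<bar>c r\<bar>"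
          unfolding I_def Gs_def using True
          by (intro mult_right_mono mult_left_mono laplace_pker_tail \<alpha> s) auto
        also have "exp (- s * r) * (exp (- s * (\<tau> - r)) * Gs) = exp (- s * \<tau>) * Gs"
          by (simp only: mult.assoc[symmetric] exp_add[symmetric]) (simp add: right_diff_distrib)
        finally show ?thesis .
      next
        case False
        then have "c r = 0" by (rule supp)
        then show ?thesis by simp
      qed
    qed
    also have "\<dots> = exp (- s * \<tau>) * Gs * ?N" by (rule Bochner_Integration.integral_mult_right_zero)
    finally show ?thesis unfolding Gs_def .
  qed
  have "\<kappa> / Gamma \<alpha> * (Gamma \<alpha> * s powr (- \<alpha>) * ?C - E) = c0 * ((1 - exp (- s * \<tau>)) / s) - ?C"
    using lhs fubini by (simp add: E_def)
  from volterra_resolvent_bound[OF s G _ \<kappa> this E]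
  have "\<bar>?C - c0 / s / (1 + \<kappa> * s powr (- \<alpha>))\<bar> \<le> exp (- s * \<tau>) * (\<bar>c0\<bar> / s + ?N)" by simp
  moreover have "c0 / s / (1 + \<kappa> * s powr (- \<alpha>)) = c0 * s powr (\<alpha> - 1) / (s powr \<alpha> + \<kappa>)"
  proof -
    have sp: "s powr \<alpha> > 0" using s by simp
    have e1: "s powr (- \<alpha>) = 1 / s powr \<alpha>" by (simp add: powr_minus_divide)
    have e2: "s powr (\<alpha> - 1) = s powr \<alpha> / s" using s by (simp add: powr_diff)
    have nz: "s powr \<alpha> + \<kappa> > 0" using sp \<kappa> by linarith
    have "1 + \<kappa> * s powr (- \<alpha>) = (s powr \<alpha> + \<kappa>) / s powr \<alpha>"
      using sp by (simp add: e1 add_divide_distrib)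
    then show ?thesis using sp nz s by (simp add: e2)
  qed
  ultimately show ?thesis by simp
qed

section \<open>Uniqueness for Laplace transforms that decay faster than every exponential\<close>

lemma sums_one_minus_exp:
  fixes u :: real
  shows "(\<lambda>k. (-1) ^ k / fact (Suc k) * u ^ Suc k) sums (1 - exp (- u))"
proof -
  have "(\<lambda>k. (- u) ^ k /\<^sub>R fact k) sums exp (- u)" by (rule exp_converges)
  then have "(\<lambda>k. (- u) ^ Suc k /\<^sub>R fact (Suc k)) sums (exp (- u) - 1)"
    by (subst sums_Suc_iff) simp
  then have "(\<lambda>k. - ((- u) ^ Suc k /\<^sub>R fact (Suc k))) sums (- (exp (- u) - 1))"
    by (rule sums_minus)
  moreover have "- ((- u) ^ Suc k /\<^sub>R fact (Suc k)) = (-1) ^ k / fact (Suc k) * u ^ Suc k" for k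
    by (subst power_minus) (simp add: field_simps)
  ultimately show ?thesis by simp
qed

text \<open>As \<open>z\<close> tends to infinity, \<open>1 - exp (- exp (z (x - t)))\<close> tends to the indicator of \<open>t < x\<close>, and its
  expansion in powers of \<open>exp (z (x - t))\<close> integrates termwise to values of the Laplace transform (Mikusinski).\<close>

lemma laplace_rapid_decay_imp_integral_zero:
  fixes h :: "real \<Rightarrow> real"
  assumes [measurable]: "h \<in> borel_measurable borel" and B: "\<And>t. t > 0 \<Longrightarrow> \<bar>h t\<bar> \<le> B"
    and decay: "\<And>C. C > 0 \<Longrightarrow> \<exists>K z0. \<forall>z\<ge>z0. \<bar>LINT t|lborel. indicator {0<..} t * (exp (- z * t) * h t)\<bar> \<le> K * exp (- C * z)"
    and x: "x > 0"
  shows "(LINT t|lborel. indicator {0<..<x} t * h t) = 0"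
proof (rule LIMSEQ_unique)
  define H where "H z = (LINT t|lborel. indicator {0<..} t * (exp (- z * t) * h t))" for z
  define R where "R z = (LINT t|lborel. indicator {0<..} t * (h t * (1 - exp (- exp (z * (x - t))))))" for z
  have B0: "B \<ge> 0" using B[of 1] by simp
  have ei: "integrable lborel (\<lambda>t. indicator {0<..} t * exp (- z * t))"
    "(LINT t|lborel. indicator {0<..} t * exp (- z * t)) = 1 / z" if "z > 0" for z :: real
    using laplace_exp[OF that] by (simp_all add: has_bochner_integral_iff)
  have hi: "integrable lborel (\<lambda>t. indicator {0<..} t * (exp (- z * t) * h t))"
    and hle: "(LINT t|lborel. norm (indicator {0<..} t * (exp (- z * t) * h t))) \<le> B / z" if z: "z > 0" for z
  proof -
    have le: "norm (indicator {0<..} t * (exp (- z * t) * h t)) \<le> B * (indicator {0<..} t * exp (- z * t))" for t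
      using B[of t] by (auto simp: indicator_def abs_mult mult.commute mult_left_mono)
    show hi: "integrable lborel (\<lambda>t. indicator {0<..} t * (exp (- z * t) * h t))"
    proof (rule Bochner_Integration.integrable_bound)
      show "integrable lborel (\<lambda>t. B * (indicator {0<..} t * exp (- z * t)))"
        using ei[OF z] by simp
      show "AE t in lborel. norm (indicator {0<..} t * (exp (- z * t) * h t)) \<le> norm (B * (indicator {0<..} t * exp (- z * t)))"
        using le by (intro AE_I2) (metis abs_ge_self order_trans real_norm_def)
    qed measurable
    have "(LINT t|lborel. norm (indicator {0<..} t * (exp (- z * t) * h t))) \<le> (LINT t|lborel. B * (indicator {0<..} t * exp (- z * t)))"
      using hi ei[OF z] le by (intro integral_mono) auto
    also have "\<dots> = B / z" using ei[OF z] by simp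
    finally show "(LINT t|lborel. norm (indicator {0<..} t * (exp (- z * t) * h t))) \<le> B / z" .
  qed
  have series: "(\<lambda>k. (-1) ^ k / fact (Suc k) * exp (real (Suc k) * z * x) * H (real (Suc k) * z)) sums R z" if z: "z > 0" for z
  proof -
    define f where "f k t = ((-1) ^ k / fact (Suc k) * exp (real (Suc k) * z * x)) * (indicator {0<..} t * (exp (- (real (Suc k) * z) * t) * h t))" for k t
    have f_eq: "f k t = (-1) ^ k / fact (Suc k) * exp (z * (x - t)) ^ Suc k * (indicator {0<..} t * h t)" for k t
    proof -
      have "exp (z * (x - t)) ^ Suc k = exp (real (Suc k) * z * x) * exp (- (real (Suc k) * z) * t)"
        by (simp only: exp_of_nat_mult[symmetric] exp_add[symmetric]) (simp add: algebra_simps)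
      then show ?thesis by (simp add: f_def mult_ac)
    qed
    have fi: "integrable lborel (f k)" for k
      unfolding f_def using z by (intro integrable_mult_right hi) simp
    have sm: "summable (\<lambda>k. \<bar>(-1) ^ k / fact (Suc k) * u ^ Suc k * v\<bar>)" for u v :: real
    proof -
      have "summable (\<lambda>k. \<bar>u\<bar> ^ Suc k /\<^sub>R fact (Suc k) * \<bar>v\<bar>)"
        using summable_exp_generic[of "\<bar>u\<bar>"] by (intro summable_mult2) (subst summable_Suc_iff)
      then show ?thesis by (simp add: abs_mult power_abs divide_inverse mult_ac)
    qed
    have "(\<lambda>k. integral\<^sup>L lborel (f k)) sums (LINT t|lborel. (\<Sum>k. f k t))"
    proof (rule sums_integral[OF fi])
      show "AE t in lborel. summable (\<lambda>k. norm (f k t))"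
        unfolding f_eq using sm by (intro AE_I2) simp
      show "summable (\<lambda>k. LINT t|lborel. norm (f k t))"
      proof (rule summable_comparison_test'[where N = 0])
        show "summable (\<lambda>k. \<bar>(-1) ^ k / fact (Suc k) * exp (z * x) ^ Suc k * (B / z)\<bar>)" by (rule sm)
        fix k :: nat
        let ?a = "(-1) ^ k / fact (Suc k) * exp (real (Suc k) * z * x) :: real"
        have "(LINT t|lborel. norm (f k t)) = \<bar>?a\<bar> * (LINT t|lborel. norm (indicator {0<..} t * (exp (- (real (Suc k) * z) * t) * h t)))"
          unfolding f_def norm_mult[of ?a] by simp
        also have "\<dots> \<le> \<bar>?a\<bar> * (B / (real (Suc k) * z))"
          using z by (intro mult_left_mono hle) auto
        also have "\<dots> \<le> \<bar>?a\<bar> * (B / z)"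
          using z B0 by (intro mult_left_mono divide_left_mono) auto
        also have "\<dots> = \<bar>(-1) ^ k / fact (Suc k) * exp (z * x) ^ Suc k * (B / z)\<bar>"
          using z B0 exp_of_nat_mult[of "Suc k" "z * x"] by (simp add: abs_mult mult.assoc)
        finally show "norm (LINT t|lborel. norm (f k t)) \<le> \<bar>(-1) ^ k / fact (Suc k) * exp (z * x) ^ Suc k * (B / z)\<bar>"
          by simp
      qed
    qed
    moreover have "(\<Sum>k. f k t) = indicator {0<..} t * (h t * (1 - exp (- exp (z * (x - t)))))" for t
      unfolding f_eq using sums_mult2[OF sums_one_minus_exp[of "exp (z * (x - t))"], of "indicator {0<..} t * h t", THEN sums_unique]
      by (simp add: mult_ac)
    moreover have "integral\<^sup>L lborel (f k) = (-1) ^ k / fact (Suc k) * exp (real (Suc k) * z * x) * H (real (Suc k) * z)" for k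
      unfolding f_def H_def by simp
    ultimately show ?thesis by (simp add: R_def)
  qed
  show "(\<lambda>n. R (real n)) \<longlonglongrightarrow> (LINT t|lborel. indicator {0<..<x} t * h t)"
    unfolding R_def
  \<comment> \<open>The offset keeps the factor of \<open>x - t\<close> at least 1. Then
    \<open>exp (x - t)\<close> majorizes \<open>1 - exp (- exp (...))\<close> for all
    \<open>n\<close>: up to \<open>x\<close> because it is at least 1, beyond \<open>x\<close> by
    \<open>1 - exp (- u) \<le> u\<close>.\<close>
  proof (rule LIMSEQ_offset[where k = 1], rule integral_dominated_convergence[where w = "\<lambda>t. B * exp x * (indicator {0<..} t * exp (- 1 * t))"])
    show "integrable lborel (\<lambda>t. B * exp x * (indicator {0<..} t * exp (- 1 * t)))"
      using ei[of 1] by simp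
    show "AE t in lborel. (\<lambda>n. indicator {0<..} t * (h t * (1 - exp (- exp (real (n + 1) * (x - t)))))) \<longlonglongrightarrow>
        indicator {0<..<x} t * h t"
      using AE_lborel_singleton[of x]
    proof eventually_elim
      case (elim t)
      show ?case
      proof (cases "t < x")
        case True
        have "filterlim (\<lambda>n. real (n + 1) * (x - t)) at_top sequentially"
          by (rule filterlim_at_top_mult_tendsto_pos[OF tendsto_const])
            (use True filterlim_compose[OF filterlim_real_sequentially filterlim_Suc] in auto)
        then have "(\<lambda>n. exp (- exp (real (n + 1) * (x - t)))) \<longlonglongrightarrow> 0"
          by (intro filterlim_compose[OF exp_at_bot] filterlim_compose[OF filterlim_uminus_at_bot_at_top]
              filterlim_compose[OF exp_at_top])
        then have "(\<lambda>n. indicator {0<..} t * (h t * (1 - exp (- exp (real (n + 1) * (x - t)))))) \<longlonglongrightarrow>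
          indicator {0<..} t * (h t * (1 - 0))"
          by (intro tendsto_intros)
        then show ?thesis using True by (simp add: indicator_def)
      next
        case False
        then have "t > x" using elim by simp
        have "filterlim (\<lambda>n. real (n + 1) * (t - x)) at_top sequentially"
          by (rule filterlim_at_top_mult_tendsto_pos[OF tendsto_const])
            (use \<open>t > x\<close> filterlim_compose[OF filterlim_real_sequentially filterlim_Suc] in auto)
        then have "(\<lambda>n. exp (- (real (n + 1) * (t - x)))) \<longlonglongrightarrow> 0"
          by (intro filterlim_compose[OF exp_at_bot] filterlim_compose[OF filterlim_uminus_at_bot_at_top])
        then have "(\<lambda>n. exp (real (n + 1) * (x - t))) \<longlonglongrightarrow> 0"
          by (simp add: right_diff_distrib)
        then have "(\<lambda>n. indicator {0<..} t * (h t * (1 - exp (- exp (real (n + 1) * (x - t)))))) \<longlonglongrightarrow>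
          indicator {0<..} t * (h t * (1 - exp (- 0)))"
          by (intro tendsto_intros)
        then show ?thesis using False by (simp add: indicator_def)
      qed
    qed
    fix n :: nat
    show "AE t in lborel. norm (indicator {0<..} t * (h t * (1 - exp (- exp (real (n + 1) * (x - t)))))) \<le>
        B * exp x * (indicator {0<..} t * exp (- 1 * t))"
    proof (rule AE_I2)
      fix t
      show "norm (indicator {0<..} t * (h t * (1 - exp (- exp (real (n + 1) * (x - t)))))) \<le>
        B * exp x * (indicator {0<..} t * exp (- 1 * t))"
      proof (cases "t > 0")
        case True
        let ?e = "exp (real (n + 1) * (x - t))"
        have "1 - exp (- ?e) \<le> exp (x - t)"
        proof (cases "t \<le> x")
          case True
          then have "1 \<le> exp (x - t)" by simp
          then show ?thesis by (smt (verit) exp_gt_zero)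
        next
          case False
          have "1 - exp (- ?e) \<le> ?e" using exp_ge_add_one_self[of "- ?e"] by linarith
          also have "real (n + 1) * (x - t) \<le> 1 * (x - t)"
            using False by (intro mult_right_mono_neg) auto
          then have "?e \<le> exp (x - t)" by simp
          finally show ?thesis .
        qed
        then have "\<bar>h t\<bar> * (1 - exp (- ?e)) \<le> B * exp (x - t)"
          using B[OF True] B0 by (intro mult_mono) auto
        moreover have nn: "0 \<le> 1 - exp (- ?e)" by simp
        have "norm (indicator {0<..} t * (h t * (1 - exp (- ?e)))) = \<bar>h t\<bar> * (1 - exp (- ?e))"
          unfolding real_norm_def abs_mult abs_of_nonneg[OF nn] using True by simp
        moreover have "B * exp (x - t) = B * exp x * (indicator {0<..} t * exp (- 1 * t))"
          using True by (simp add: exp_diff exp_minus divide_inverse)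
        ultimately show ?thesis by linarith
      qed simp
    qed
  qed measurable
  show "(\<lambda>n. R (real n)) \<longlonglongrightarrow> 0"
  proof -
    \<comment> \<open>The term of index \<open>k\<close> grows like \<open>exp (z * x)\<close> to
      the power \<open>Suc k\<close>. Decay at rate \<open>x + 1\<close> at the point
      \<open>Suc k * z\<close> beats this with \<open>exp (- z) ^ Suc k\<close> to spare, and these
      powers over factorials sum to \<open>exp (exp (- z)) - 1\<close>.\<close>
    obtain K z0 where K: "\<And>z. z \<ge> z0 \<Longrightarrow> \<bar>H z\<bar> \<le> K * exp (- (x + 1) * z)"
      using decay[of "x + 1"] x unfolding H_def by auto
    have "\<bar>R z\<bar> \<le> \<bar>K\<bar> * (exp (exp (- z)) - 1)" if z: "z > 0" "z \<ge> z0" for z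
    proof -
      have exps: "(\<lambda>k. \<bar>K\<bar> * (exp (- z) ^ Suc k / fact (Suc k))) sums (\<bar>K\<bar> * (exp (exp (- z)) - 1))"
      proof (rule sums_mult)
        have "(\<lambda>k. exp (- z) ^ k /\<^sub>R fact k) sums exp (exp (- z))" by (rule exp_converges)
        then have "(\<lambda>k. exp (- z) ^ Suc k /\<^sub>R fact (Suc k)) sums (exp (exp (- z)) - 1)"
          by (subst sums_Suc_iff) simp
        then show "(\<lambda>k. exp (- z) ^ Suc k / fact (Suc k)) sums (exp (exp (- z)) - 1)"
          by (simp add: divide_inverse mult.commute)
      qed
      have le: "\<bar>(-1) ^ k / fact (Suc k) * exp (real (Suc k) * z * x) * H (real (Suc k) * z)\<bar> \<le>
          \<bar>K\<bar> * (exp (- z) ^ Suc k / fact (Suc k))" for k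
      proof -
        have "z0 \<le> 1 * z" using z by simp
        also have "\<dots> \<le> real (Suc k) * z" using z by (intro mult_right_mono) auto
        finally have "\<bar>H (real (Suc k) * z)\<bar> \<le> K * exp (- (x + 1) * (real (Suc k) * z))" by (rule K)
        also have "\<dots> \<le> \<bar>K\<bar> * exp (- (x + 1) * (real (Suc k) * z))" by (intro mult_right_mono) auto
        finally have "exp (real (Suc k) * z * x) * \<bar>H (real (Suc k) * z)\<bar> \<le>
            exp (real (Suc k) * z * x) * (\<bar>K\<bar> * exp (- (x + 1) * (real (Suc k) * z)))"
          by (intro mult_left_mono) auto
        also have "\<dots> = \<bar>K\<bar> * exp (- z) ^ Suc k"
        proof -
          have "exp (real (Suc k) * z * x) * exp (- (x + 1) * (real (Suc k) * z)) = exp (- z) ^ Suc k"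
            by (simp only: exp_of_nat_mult[symmetric] exp_add[symmetric]) (simp add: algebra_simps)
          then show ?thesis by simp
        qed
        finally show ?thesis by (simp add: abs_mult divide_right_mono)
      qed
      have "norm (\<Sum>k. (-1) ^ k / fact (Suc k) * exp (real (Suc k) * z * x) * H (real (Suc k) * z)) \<le>
          (\<Sum>k. \<bar>K\<bar> * (exp (- z) ^ Suc k / fact (Suc k)))"
        by (rule norm_suminf_le[OF _ sums_summable[OF exps]]) (simp only: real_norm_def le)
      then have "\<bar>R z\<bar> \<le> (\<Sum>k. \<bar>K\<bar> * (exp (- z) ^ Suc k / fact (Suc k)))"
        by (simp only: real_norm_def sums_unique[OF series[OF z(1)], symmetric])
      also have "\<dots> = \<bar>K\<bar> * (exp (exp (- z)) - 1)" using sums_unique[OF exps] by simp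
      finally show ?thesis .
    qed
    note R_le = this
    have "\<forall>\<^sub>F n in sequentially. norm (R (real n)) \<le> \<bar>K\<bar> * (exp (exp (- real n)) - 1)"
      using eventually_gt_at_top[of 0] eventually_ge_at_top[of "nat \<lceil>z0\<rceil>"]
    proof eventually_elim
      case (elim n)
      then have "z0 \<le> real n" by linarith
      then show ?case using R_le[of "real n"] elim by simp
    qed
    moreover have "(\<lambda>n. \<bar>K\<bar> * (exp (exp (- real n)) - 1)) \<longlonglongrightarrow> \<bar>K\<bar> * (exp 0 - 1)"
      by (intro tendsto_intros filterlim_compose[OF exp_at_bot]
          filterlim_compose[OF filterlim_uminus_at_bot_at_top filterlim_real_sequentially])
    then have "(\<lambda>n. \<bar>K\<bar> * (exp (exp (- real n)) - 1)) \<longlonglongrightarrow> 0" by simp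
    ultimately show ?thesis by (rule Lim_null_comparison)
  qed
qed

text \<open>Integrals over half-open intervals are differences of integrals starting at 0, all of
  which vanish. The restriction to a bounded interval makes the bounded function \<open>h\<close>
  integrable.\<close>

lemma laplace_rapid_decay_imp_AE_zero:
  fixes h :: "real \<Rightarrow> real"
  assumes hm [measurable]: "h \<in> borel_measurable borel" and B: "\<And>t. t > 0 \<Longrightarrow> \<bar>h t\<bar> \<le> B"
    and decay: "\<And>C. C > 0 \<Longrightarrow> \<exists>K z0. \<forall>z\<ge>z0. \<bar>LINT t|lborel. indicator {0<..} t * (exp (- z * t) * h t)\<bar> \<le> K * exp (- C * z)"
    and x: "x > 0"
  shows "AE t in lborel. t \<in> {0<..<x} \<longrightarrow> h t = 0"
proof -
  have int: "integrable lborel (\<lambda>t. indicator {0<..<y} t * h t)" for y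
  proof (cases "y > 0")
    case True
    show ?thesis
    proof (rule Bochner_Integration.integrable_bound)
      show "integrable lborel (\<lambda>t. B * indicator {0<..<y} t)" using True by simp
      show "AE t in lborel. norm (indicator {0<..<y} t * h t) \<le> norm (B * indicator {0<..<y} t)"
        using B by (intro AE_I2) (auto simp: indicator_def intro: order_trans[OF _ abs_ge_self])
    qed measurable
  next
    case False
    then have "{0<..<y} = {}" by simp
    then show ?thesis by simp
  qed
  have zero: "(LINT t|lborel. indicator {0<..<y} t * h t) = 0" for y
  proof (cases "y > 0")
    case True
    show ?thesis by (rule laplace_rapid_decay_imp_integral_zero[OF hm, of B]) (fact B, fact decay, fact True)
  next
    case False
    then have "{0<..<y} = {}" by simp
    then show ?thesis by simp
  qed
  have "AE t in lborel. indicator {0<..<x} t * h t = 0"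
  proof (rule AE_zero_if_Ioc_integral_zero[OF int])
    fix a b :: real
    show "(LINT t:{a<..b}|lborel. indicator {0<..<x} t * h t) = 0"
    proof (cases "a \<le> b")
      case True
      have "(LINT t:{a<..b}|lborel. indicator {0<..<x} t * h t) =
        (LINT t|lborel. indicator {0<..<min b x} t * h t - indicator {0<..<min a x} t * h t)"
        unfolding set_lebesgue_integral_def
      proof (rule integral_cong_AE)
        show "AE t in lborel. indicator {a<..b} t *\<^sub>R (indicator {0<..<x} t * h t) =
            indicator {0<..<min b x} t * h t - indicator {0<..<min a x} t * h t"
          using AE_lborel_singleton[of a] AE_lborel_singleton[of b]
          by eventually_elim (use True in \<open>auto simp: indicator_def\<close>)
      qed measurable
      then show ?thesis using int zero by simp
    next
      case False
      then have "{a<..b} = {}" by simp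
      then show ?thesis by (simp add: set_lebesgue_integral_def)
    qed
  qed
  then show ?thesis by eventually_elim (auto simp: indicator_def split: if_splits)
qed

text \<open>With the sine terms at \<open>x0\<close> for \<open>b\<close> and \<open>A\<close> times
  the squared frequencies for \<open>\<kappa>\<close> this is, up to the factor
  \<open>2 / (q - p)\<close>, the value at \<open>x0\<close> of the heat flow with diffusion
  coefficient \<open>A\<close>.\<close>

definition expsum :: "(nat \<Rightarrow> real) \<Rightarrow> (nat \<Rightarrow> real) \<Rightarrow> real \<Rightarrow> real" where
  "expsum b \<kappa> t = (\<Sum>i. b i * exp (- \<kappa> i * t))"

context
  fixes b \<kappa> :: "nat \<Rightarrow> real"
  assumes b: "summable (\<lambda>i. \<bar>b i\<bar>)" and \<kappa>: "\<And>i. \<kappa> i \<ge> 0"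
begin

lemma expsum_term_le:
  assumes "t \<ge> 0" "\<And>i. m \<le> \<kappa> i"
  shows "\<bar>b i * exp (- \<kappa> i * t)\<bar> \<le> \<bar>b i\<bar> * exp (- m * t)"
  using assms by (auto simp: abs_mult intro!: mult_left_mono mult_right_mono)

lemma expsum_summable:
  assumes "t \<ge> 0"
  shows "summable (\<lambda>i. b i * exp (- \<kappa> i * t))"
  by (rule summable_comparison_test'[OF b, of 0]) (use expsum_term_le[OF assms \<kappa>] in simp)

text \<open>Any common lower bound \<open>m\<close> of the rates is allowed: 0 serves for
  boundedness, the smallest rate for decay.\<close>

lemma expsum_le:
  assumes "t \<ge> 0" "\<And>i. m \<le> \<kappa> i"
  shows "\<bar>expsum b \<kappa> t\<bar> \<le> (\<Sum>i. \<bar>b i\<bar>) * exp (- m * t)"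
proof -
  have "norm (\<Sum>i. b i * exp (- \<kappa> i * t)) \<le> (\<Sum>i. \<bar>b i\<bar> * exp (- m * t))"
    by (rule norm_suminf_le[OF _ summable_mult2[OF b]])
      (simp only: real_norm_def expsum_term_le[OF assms])
  then show ?thesis by (simp add: expsum_def suminf_mult2[OF b])
qed

lemma expsum_measurable: "expsum b \<kappa> \<in> borel_measurable borel"
  unfolding expsum_def by measurable

lemma laplace_expsum:
  assumes z: "z > 0"
  shows "has_bochner_integral lborel (\<lambda>t. indicator {0<..} t * (exp (- z * t) * expsum b \<kappa> t)) (\<Sum>i. b i / (z + \<kappa> i))"
proof -
  define f where "f i t = b i * (indicator {0<..} t * exp (- (z + \<kappa> i) * t))" for i t
  have zk: "z + \<kappa> i > 0" for i using z \<kappa>[of i] by simp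
  have ei: "integrable lborel (\<lambda>t. indicator {0<..} t * exp (- (z + \<kappa> i) * t))"
    "(LINT t|lborel. indicator {0<..} t * exp (- (z + \<kappa> i) * t)) = 1 / (z + \<kappa> i)" for i
    using laplace_exp[OF zk[of i]] by (simp_all add: has_bochner_integral_iff)
  have fi: "integrable lborel (f i)" for i
    unfolding f_def by (intro integrable_mult_right ei)
  have f_int: "integral\<^sup>L lborel (f i) = b i / (z + \<kappa> i)" for i
    unfolding f_def Bochner_Integration.integral_mult_right_zero ei by simp
  have f_eq: "f i t = indicator {0<..} t * exp (- z * t) * (b i * exp (- \<kappa> i * t))" for i t
    by (simp add: f_def algebra_simps exp_add[symmetric])
  have f_sum: "(\<Sum>i. f i t) = indicator {0<..} t * (exp (- z * t) * expsum b \<kappa> t)" for t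
  proof (cases "t > 0")
    case True
    then show ?thesis
      unfolding f_eq expsum_def by (subst suminf_mult[OF expsum_summable]) auto
  qed (simp add: f_eq)
  have f_abs: "AE t in lborel. summable (\<lambda>i. norm (f i t))"
  proof (rule AE_I2, rule summable_comparison_test'[OF b, of 0])
    fix t :: real and i :: nat
    have "\<bar>indicator {0<..} t * exp (- (z + \<kappa> i) * t)\<bar> \<le> 1"
      using zk[of i] by (auto simp: indicator_def mult_nonpos_nonneg less_imp_le)
    then have "\<bar>b i\<bar> * \<bar>indicator {0<..} t * exp (- (z + \<kappa> i) * t)\<bar> \<le> \<bar>b i\<bar> * 1"
      by (intro mult_left_mono) auto
    then show "norm (norm (f i t)) \<le> \<bar>b i\<bar>" by (simp add: f_def abs_mult)
  qed
  have f_norm: "summable (\<lambda>i. LINT t|lborel. norm (f i t))"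
  proof (rule summable_comparison_test'[where N = 0])
    show "summable (\<lambda>i. \<bar>b i\<bar> * (1 / z))" using b by (rule summable_mult2)
    fix i :: nat
    have "(LINT t|lborel. norm (f i t)) = \<bar>b i\<bar> * (LINT t|lborel. indicator {0<..} t * exp (- (z + \<kappa> i) * t))"
      by (simp only: f_def real_norm_def abs_mult abs_exp_cancel abs_indicator Bochner_Integration.integral_mult_right_zero)
    also have "\<dots> \<le> \<bar>b i\<bar> * (1 / z)"
      unfolding ei using z \<kappa>[of i] by (intro mult_left_mono divide_left_mono) auto
    finally show "norm (LINT t|lborel. norm (f i t)) \<le> \<bar>b i\<bar> * (1 / z)" by simp
  qed
  show ?thesis
    using integrable_suminf[OF fi f_abs f_norm] integral_suminf[OF fi f_abs f_norm]
    by (simp only: has_bochner_integral_iff f_sum f_int)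
qed

end

text \<open>Here \<open>\<alpha> < 1\<close> is decisive: \<open>C * s powr \<alpha>\<close> is
  negligible against \<open>s * \<tau>\<close> whatever \<open>C\<close> is. The factor
  \<open>s powr (1 - \<alpha>)\<close> is what removing \<open>s powr (\<alpha> - 1)\<close> from
  the transformed solution costs.\<close>

lemma powr_exp_decay:
  fixes \<alpha> \<tau> C :: real
  assumes "0 < \<alpha>" "\<alpha> < 1" "0 < \<tau>" "0 < C"
  shows "((\<lambda>s. s powr (1 - \<alpha>) * exp (- s * \<tau>) * exp (C * s powr \<alpha>)) \<longlongrightarrow> 0) at_top"
  using assms by real_asymp

text \<open>Multiplied by \<open>exp (A' * lam 0 * t)\<close>, the primed sum has constant first
  term, while all other terms decay: those of the unprimed sum because \<open>A' < A\<close>, the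
  remaining primed ones because of the gap between \<open>lam 0\<close> and \<open>lam 1\<close>.
  Large times at which the sums agree therefore force the first coefficient to 0.\<close>

lemma leading_coefficient_zero:
  fixes b b' lam :: "nat \<Rightarrow> real"
  assumes b: "summable (\<lambda>i. \<bar>b i\<bar>)" and b': "summable (\<lambda>i. \<bar>b' i\<bar>)"
    and lam: "0 < lam 0" "\<And>i. lam 0 \<le> lam i" "lam 0 < lam 1" "\<And>i. lam 1 \<le> lam (Suc i)"
    and A: "0 < A'" "A' < A" and \<alpha>: "0 < \<alpha>" "\<alpha> < 1" and \<tau>: "0 < \<tau>"
    and bound: "\<And>s. s > 0 \<Longrightarrow> \<bar>s powr (\<alpha> - 1) * (\<Sum>i. b i / (s powr \<alpha> + A * lam i))
      - s powr (\<alpha> - 1) * (\<Sum>i. b' i / (s powr \<alpha> + A' * lam i))\<bar> \<le> K * exp (- s * \<tau>) * (1 / s + 1)"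
  shows "b' 0 = 0"
proof (rule ccontr)
  assume b'0: "b' 0 \<noteq> 0"
  define \<kappa> where "\<kappa> i = A * lam i" for i
  define \<kappa>' where "\<kappa>' i = A' * lam i" for i
  have lam0: "0 \<le> lam i" for i using lam(1) lam(2)[of i] by simp
  have \<kappa>: "\<kappa> i \<ge> 0" "\<kappa>' i \<ge> 0" for i using A lam0[of i] by (simp_all add: \<kappa>_def \<kappa>'_def)
  define h where "h t = expsum b \<kappa> t - expsum b' \<kappa>' t" for t
  define S where "S = (\<Sum>i. \<bar>b i\<bar>)"
  define S' where "S' = (\<Sum>i. \<bar>b' i\<bar>)"
  have hm: "h \<in> borel_measurable borel"
    unfolding h_def using expsum_measurable[of b \<kappa>, OF b \<kappa>(1)] expsum_measurable[of b' \<kappa>', OF b' \<kappa>(2)] by measurable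
  have hB: "\<bar>h t\<bar> \<le> S + S'" if "t > 0" for t
    using expsum_le[of b \<kappa>, OF b \<kappa>(1), of t 0] expsum_le[of b' \<kappa>', OF b' \<kappa>(2), of t 0] that \<kappa>
    by (simp add: h_def S_def S'_def)
  have hL: "(LINT t|lborel. indicator {0<..} t * (exp (- z * t) * h t)) =
      (\<Sum>i. b i / (z + \<kappa> i)) - (\<Sum>i. b' i / (z + \<kappa>' i))" if "z > 0" for z
    using has_bochner_integral_diff[OF laplace_expsum[of b \<kappa>, OF b \<kappa>(1) that] laplace_expsum[of b' \<kappa>', OF b' \<kappa>(2) that]]
    by (simp add: h_def right_diff_distrib has_bochner_integral_iff)
  have decay: "\<exists>K' z0. \<forall>z\<ge>z0. \<bar>LINT t|lborel. indicator {0<..} t * (exp (- z * t) * h t)\<bar> \<le> K' * exp (- C * z)"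
    if C: "C > 0" for C
  proof -
    have "\<forall>\<^sub>F s in at_top. s powr (1 - \<alpha>) * exp (- s * \<tau>) * exp (C * s powr \<alpha>) < 1"
      using powr_exp_decay[OF \<alpha> \<tau> C] by (rule order_tendstoD) simp
    moreover have "filterlim (\<lambda>z::real. z powr (1 / \<alpha>)) at_top at_top"
      using \<alpha> by real_asymp
    ultimately have "\<forall>\<^sub>F z in at_top. (z powr (1 / \<alpha>)) powr (1 - \<alpha>) * exp (- (z powr (1 / \<alpha>)) * \<tau>)
        * exp (C * (z powr (1 / \<alpha>)) powr \<alpha>) < 1"
      by (rule eventually_compose_filterlim)
    then have "\<forall>\<^sub>F z in at_top. \<bar>LINT t|lborel. indicator {0<..} t * (exp (- z * t) * h t)\<bar> \<le> (2 * \<bar>K\<bar>) * exp (- C * z)"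
      using eventually_ge_at_top[of 1]
    proof eventually_elim
      case (elim z)
      define s where "s = z powr (1 / \<alpha>)"
      have z: "z \<ge> 1" by fact
      have s1: "s \<ge> 1" unfolding s_def using z \<alpha> by (intro ge_one_powr_ge_zero) auto
      have sz: "s powr \<alpha> = z" using z \<alpha> by (simp add: s_def powr_powr)
      let ?D = "(\<Sum>i. b i / (z + \<kappa> i)) - (\<Sum>i. b' i / (z + \<kappa>' i))"
      have "s powr (\<alpha> - 1) * \<bar>?D\<bar> = \<bar>s powr (\<alpha> - 1) * ?D\<bar>" by (simp add: abs_mult)
      also have "\<dots> \<le> K * exp (- s * \<tau>) * (1 / s + 1)"
        using bound[of s] s1 by (simp add: sz \<kappa>_def \<kappa>'_def right_diff_distrib)
      also have "\<dots> \<le> \<bar>K\<bar> * exp (- s * \<tau>) * (1 / s + 1)" using s1 by (intro mult_right_mono) auto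
      also have "\<dots> \<le> \<bar>K\<bar> * exp (- s * \<tau>) * 2" using s1 by (intro mult_left_mono) (auto simp: divide_le_eq)
      finally have "s powr (1 - \<alpha>) * (s powr (\<alpha> - 1) * \<bar>?D\<bar>) \<le> s powr (1 - \<alpha>) * (\<bar>K\<bar> * exp (- s * \<tau>) * 2)"
        by (intro mult_left_mono) auto
      moreover have "s powr (1 - \<alpha>) * (s powr (\<alpha> - 1) * \<bar>?D\<bar>) = \<bar>?D\<bar>"
        using s1 by (simp add: mult.assoc[symmetric] powr_add[symmetric])
      ultimately have "\<bar>?D\<bar> \<le> 2 * \<bar>K\<bar> * (s powr (1 - \<alpha>) * exp (- s * \<tau>))"
        by (simp add: mult_ac)
      also have "\<dots> \<le> 2 * \<bar>K\<bar> * exp (- C * z)"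
      proof (rule mult_left_mono)
        have "s powr (1 - \<alpha>) * exp (- s * \<tau>) * exp (C * z) < 1" using elim(1) sz by (simp only: s_def)
        then have "s powr (1 - \<alpha>) * exp (- s * \<tau>) < 1 / exp (C * z)" by (simp add: pos_less_divide_eq)
        then show "s powr (1 - \<alpha>) * exp (- s * \<tau>) \<le> exp (- C * z)" by (simp add: exp_minus inverse_eq_divide)
      qed simp
      finally show ?case using hL[of z] z by simp
    qed
    then show ?thesis unfolding eventually_at_top_linorder by blast
  qed
  \<comment> \<open>Vanishing almost everywhere is enough to pick arbitrarily late zeros, since an
    interval of length 1 is not a null set.\<close>
  have zeros: "\<exists>t>X. h t = 0" if X: "X > 0" for X
  proof (rule ccontr)
    assume "\<not> (\<exists>t>X. h t = 0)"
    then have nz: "\<And>t. t > X \<Longrightarrow> h t \<noteq> 0" by blast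
    have "AE t in lborel. t \<in> {0<..<X + 1} \<longrightarrow> h t = 0"
      by (rule laplace_rapid_decay_imp_AE_zero[OF hm hB]) (use decay X in auto)
    then have "AE t in lborel. t \<notin> {X<..<X + 1}"
      by eventually_elim (use nz X in force)
    then have "{X<..<X + 1} \<in> null_sets lborel" by (subst AE_iff_null_sets) auto
    then show False by (auto simp: null_sets_def)
  qed
  have tail: "\<bar>b' 0\<bar> \<le> S * exp (- ((A - A') * lam 0) * t) + S' * exp (- (A' * (lam 1 - lam 0)) * t)"
    if t: "t > 0" and ht: "h t = 0" for t
  proof -
    have b'S: "summable (\<lambda>i. \<bar>b' (Suc i)\<bar>)" using b' by (subst summable_Suc_iff)
    have "expsum b' \<kappa>' t = b' 0 * exp (- \<kappa>' 0 * t) + expsum (\<lambda>i. b' (Suc i)) (\<lambda>i. \<kappa>' (Suc i)) t"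
      unfolding expsum_def using suminf_split_head[OF expsum_summable[of b' \<kappa>', OF b' \<kappa>(2), of t]] t by simp
    then have "b' 0 * exp (- \<kappa>' 0 * t) = expsum b \<kappa> t - expsum (\<lambda>i. b' (Suc i)) (\<lambda>i. \<kappa>' (Suc i)) t"
      using ht by (simp add: h_def)
    moreover have "\<bar>expsum b \<kappa> t\<bar> \<le> S * exp (- (A * lam 0) * t)"
      unfolding S_def by (rule expsum_le[of b \<kappa>, OF b \<kappa>(1)]) (use t A lam in \<open>auto simp: \<kappa>_def\<close>)
    moreover have "\<bar>expsum (\<lambda>i. b' (Suc i)) (\<lambda>i. \<kappa>' (Suc i)) t\<bar> \<le> (\<Sum>i. \<bar>b' (Suc i)\<bar>) * exp (- (A' * lam 1) * t)"
      by (rule expsum_le[of "\<lambda>i. b' (Suc i)" "\<lambda>i. \<kappa>' (Suc i)", OF b'S \<kappa>(2)]) (use t A lam in \<open>auto simp: \<kappa>'_def\<close>)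
    moreover have "(\<Sum>i. \<bar>b' (Suc i)\<bar>) * exp (- (A' * lam 1) * t) \<le> S' * exp (- (A' * lam 1) * t)"
      using suminf_split_head[OF b'] by (intro mult_right_mono) (auto simp: S'_def)
    moreover have "\<bar>b' 0\<bar> * exp (- \<kappa>' 0 * t) = \<bar>b' 0 * exp (- \<kappa>' 0 * t)\<bar>" by (simp add: abs_mult)
    ultimately have "\<bar>b' 0\<bar> * exp (- \<kappa>' 0 * t) \<le> S * exp (- (A * lam 0) * t) + S' * exp (- (A' * lam 1) * t)"
      by linarith
    then have "(\<bar>b' 0\<bar> * exp (- \<kappa>' 0 * t)) * exp (\<kappa>' 0 * t) \<le>
        (S * exp (- (A * lam 0) * t) + S' * exp (- (A' * lam 1) * t)) * exp (\<kappa>' 0 * t)"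
      by (rule mult_right_mono) simp
    then show ?thesis
      by (simp add: distrib_right mult.assoc exp_add[symmetric] \<kappa>'_def)
        (simp add: algebra_simps)
  qed
  have "((\<lambda>t. S * exp (- ((A - A') * lam 0) * t) + S' * exp (- (A' * (lam 1 - lam 0)) * t)) \<longlongrightarrow> S * 0 + S' * 0) at_top"
  proof -
    have "((\<lambda>t::real. exp (- k * t)) \<longlongrightarrow> 0) at_top" if "k > 0" for k
      using that by real_asymp
    then show ?thesis using A lam by (intro tendsto_add tendsto_mult tendsto_const) auto
  qed
  then have "\<forall>\<^sub>F t in at_top. S * exp (- ((A - A') * lam 0) * t) + S' * exp (- (A' * (lam 1 - lam 0)) * t) < \<bar>b' 0\<bar>"
    using b'0 by (intro order_tendstoD(2)) auto
  then obtain X where X: "\<And>t. t \<ge> X \<Longrightarrow> S * exp (- ((A - A') * lam 0) * t) + S' * exp (- (A' * (lam 1 - lam 0)) * t) < \<bar>b' 0\<bar>"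
    unfolding eventually_at_top_linorder by blast
  obtain t where "t > max X 1" "h t = 0" using zeros[of "max X 1"] by (auto simp: less_max_iff_disj)
  then show False using tail[of t] X[of t] by simp
qed

section \<open>Weak solutions\<close>

lemma AE_lebesgue_on_iff_lborel:
  assumes "S \<in> sets borel"
  shows "(AE t in lebesgue_on S. P t) \<longleftrightarrow> (AE t in lborel. t \<in> S \<longrightarrow> P t)"
  using assms by (simp add: AE_restrict_space_iff AE_completion_iff)

text \<open>Completeness of Lebesgue measure passes measurability from the Borel function
  \<open>g\<close> to \<open>f\<close>. Integrals of data given only almost everywhere are thereby
  moved to Borel versions.\<close>

lemma integral_lebesgue_on_eq_lborel:
  fixes f g :: "real \<Rightarrow> real"
  assumes S: "S \<in> sets borel" and g [measurable]: "g \<in> borel_measurable borel"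
    and eq: "AE t in lborel. indicator S t * f t = g t"
  shows "(LINT t|lebesgue_on S. f t) = (LINT t|lborel. g t)"
proof -
  have gl: "g \<in> borel_measurable lebesgue" by (rule measurable_completion) simp
  have eq': "AE t in lebesgue. indicator S t * f t = g t" by (rule AE_completion[OF eq])
  have fm: "(\<lambda>t. indicator S t * f t) \<in> borel_measurable lebesgue"
    by (rule borel_measurable_AE[OF gl]) (use eq' in \<open>auto elim: eventually_mono\<close>)
  have "(LINT t|lebesgue_on S. f t) = (LINT t|lebesgue. indicator S t * f t)"
    using S by (simp add: integral_restrict_space)
  also have "\<dots> = (LINT t|lebesgue. g t)"
    by (rule integral_cong_AE[OF fm gl eq'])
  also have "\<dots> = (LINT t|lborel. g t)" by (rule integral_completion) simp
  finally show ?thesis .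
qed

section \<open>Sine coefficients of time-dependent functions\<close>

context interval
begin

text \<open>Sine coefficients are continuous in \<open>H1_norm\<close>, so the simple functions
  approximating \<open>u\<close> yield real simple functions approximating the coefficient. A Borel
  version is extracted because the Fubini argument runs over \<open>lborel\<close>.\<close>

lemma sine_coeff_time_measurable:
  assumes u: "u \<in> L2_time T (H10 Om) (H1_norm Om)"
  shows "\<exists>c\<in>borel_measurable borel. AE t in lborel. t \<in> {0<..<T} \<longrightarrow> sine_coeff (u t) i = c t"
proof -
  let ?MT = "lebesgue_on {0<..<T}"
  obtain S where simple: "\<And>n. simple_function ?MT (S n)" and S: "\<And>n t. S n t \<in> H10 Om"
    and lim: "AE t in ?MT. (\<lambda>n. H1_norm Om (S n t - u t)) \<longlonglongrightarrow> 0"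
    using u by (auto simp: L2_time_def strongly_measurable_def)
  have uH: "AE t in ?MT. u t \<in> H10 Om" using u by (simp add: L2_time_def)
  \<comment> \<open>\<open>lim\<close> takes arbitrary values where the sequence diverges; this
    happens only on a null set of times, and measurability of \<open>g\<close> is
    unaffected.\<close>
  define g where "g t = lim (\<lambda>n. sine_coeff (S n t) i)" for t
  have m: "(\<lambda>t. sine_coeff (S n t) i) \<in> borel_measurable ?MT" for n
    using simple_function_compose[OF simple[of n], of "\<lambda>v. sine_coeff v i"]
    by (intro borel_measurable_simple_function) (simp add: comp_def)
  have gm: "g \<in> borel_measurable ?MT"
    unfolding g_def by (intro borel_measurable_lim_metric m)
  have geq: "AE t in ?MT. sine_coeff (u t) i = g t"
    using lim uH
  proof eventually_elim
    case (elim t)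
    have uL: "u t \<in> L2 Om" using elim by (intro H1_D(1) H10_H1)
    have SL: "S n t \<in> L2 Om" for n using S by (intro H1_D(1) H10_H1)
    have diff: "S n t - u t \<in> L2 Om" for n
      using L2_lin[OF SL[of n] uL, of 1 "-1"] by (simp add: fun_diff_def)
    have "(\<lambda>n. sine_coeff (S n t) i - sine_coeff (u t) i) \<longlonglongrightarrow> 0"
    proof (rule Lim_null_comparison)
      show "\<forall>\<^sub>F n in sequentially. norm (sine_coeff (S n t) i - sine_coeff (u t) i) \<le> sqrt ((q - p) / 2) * H1_norm Om (S n t - u t)"
      proof (rule always_eventually, rule allI)
        fix n
        have "\<bar>sine_coeff (S n t - u t) i\<bar> \<le> sqrt ((q - p) / 2 * (H1_norm Om (S n t - u t))\<^sup>2)"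
          by (rule real_le_rsqrt) (use sine_coeff_sq_le_H1_norm[OF diff[of n], of i] in simp)
        also have "\<dots> = sqrt ((q - p) / 2) * H1_norm Om (S n t - u t)"
          unfolding real_sqrt_mult real_sqrt_abs by (simp add: H1_norm_def)
        finally show "norm (sine_coeff (S n t) i - sine_coeff (u t) i) \<le> sqrt ((q - p) / 2) * H1_norm Om (S n t - u t)"
          by (simp add: sine_coeff_diff[OF SL uL])
      qed
      show "(\<lambda>n. sqrt ((q - p) / 2) * H1_norm Om (S n t - u t)) \<longlonglongrightarrow> 0"
        using elim by (intro tendsto_mult_right_zero)
    qed
    then have "(\<lambda>n. sine_coeff (S n t) i) \<longlonglongrightarrow> sine_coeff (u t) i" by (rule LIM_zero_cancel)
    then show ?case by (simp add: g_def limI)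
  qed
  have "(\<lambda>t. if t \<in> {0<..<T} then g t else 0) \<in> borel_measurable lebesgue"
    using gm by (subst borel_measurable_if) auto
  then obtain c where c: "c \<in> borel_measurable lborel" and ceq: "AE t in lborel. (if t \<in> {0<..<T} then g t else 0) = c t"
    using completion_ex_borel_measurable_real by blast
  have "AE t in lborel. t \<in> {0<..<T} \<longrightarrow> sine_coeff (u t) i = c t"
    using geq[unfolded AE_lebesgue_on_iff_lborel[OF borel_open[OF open_greaterThanLessThan]]] ceq
    by eventually_elim (auto split: if_splits)
  then show ?thesis using c by auto
qed

text \<open>The squared \<open>H1_norm\<close> is integrable in time and, by Bessel, dominates the
  weighted square sum of the coefficients. Integrating the arithmetic-geometric mean bound over the
  bounded interval makes the integral norms of the \<open>c i\<close> summable, as needed to add up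
  the errors of all modes.\<close>

lemma sine_coeff_time_coefficients:
  assumes u: "u \<in> L2_time T (H10 Om) (H1_norm Om)" and \<tau>: "0 < \<tau>" "\<tau> < T"
  shows "\<exists>c. (\<forall>i. integrable lborel (c i) \<and> c i \<in> borel_measurable borel \<and> (\<forall>t. t \<notin> {0<..<\<tau>} \<longrightarrow> c i t = 0)) \<and>
    summable (\<lambda>i. LINT t|lborel. \<bar>c i t\<bar>) \<and>
    (AE t in lborel. t \<in> {0<..<\<tau>} \<longrightarrow> u t \<in> H10 Om \<and> sine_coeff (u t) = (\<lambda>i. c i t))"
proof -
  obtain c0 where c0: "\<And>i. c0 i \<in> borel_measurable borel"
    and c0eq: "\<And>i. AE t in lborel. t \<in> {0<..<T} \<longrightarrow> sine_coeff (u t) i = c0 i t"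
    using sine_coeff_time_measurable[OF u] by metis
  define c where "c i t = indicator {0<..<\<tau>} t * c0 i t" for i t
  have cm [measurable]: "c i \<in> borel_measurable borel" for i
    unfolding c_def using c0 by measurable
  have supp: "c i t = 0" if "t \<notin> {0<..<\<tau>}" for i t
    using that by (simp add: c_def)
  have "AE t in lebesgue_on {0<..<T}. u t \<in> H10 Om" using u by (simp add: L2_time_def)
  then have uH: "AE t in lborel. t \<in> {0<..<T} \<longrightarrow> u t \<in> H10 Om"
    by (subst (asm) AE_lebesgue_on_iff_lborel) auto
  have "AE t in lborel. \<forall>i. t \<in> {0<..<T} \<longrightarrow> sine_coeff (u t) i = c0 i t"
    by (subst AE_all_countable) (use c0eq in blast)
  then have ae: "AE t in lborel. t \<in> {0<..<\<tau>} \<longrightarrow> u t \<in> H10 Om \<and> sine_coeff (u t) = (\<lambda>i. c i t)"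
    using uH by eventually_elim (use \<tau> in \<open>auto simp: c_def\<close>)
  \<comment> \<open>Normalized so that the sum over \<open>i\<close> is at most the squared
    \<open>H1_norm\<close> of \<open>u t\<close>.\<close>
  define D where "D i t = 2 / (q - p) * (freq i * c i t)\<^sup>2" for i t
  have D0: "0 \<le> D i t" for i t using p_less_q by (simp add: D_def)
  have Dm [measurable]: "D i \<in> borel_measurable borel" for i unfolding D_def by measurable
  have "(\<Sum>i. \<integral>\<^sup>+t. ennreal (D i t) \<partial>lborel) = (\<integral>\<^sup>+t. (\<Sum>i. ennreal (D i t)) \<partial>lborel)"
    by (rule nn_integral_suminf[symmetric]) measurable
  also have "\<dots> \<le> (\<integral>\<^sup>+t. ennreal ((H1_norm Om (u t))\<^sup>2) * indicator {0<..<T} t \<partial>lborel)"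
  proof (rule nn_integral_mono_AE)
    show "AE t in lborel. (\<Sum>i. ennreal (D i t)) \<le> ennreal ((H1_norm Om (u t))\<^sup>2) * indicator {0<..<T} t"
      using ae
    proof eventually_elim
      case (elim t)
      show ?case
      proof (cases "t \<in> {0<..<\<tau>}")
        case True
        then have uH: "u t \<in> H10 Om" and cu: "c i t = sine_coeff (u t) i" for i using elim by auto
        have "sum (\<lambda>i. D i t) I \<le> (H1_norm Om (u t))\<^sup>2" if "finite I" for I
        proof -
          have "sum (\<lambda>i. D i t) I = 2 / (q - p) * (\<Sum>i\<in>I. (freq i * sine_coeff (u t) i)\<^sup>2)"
            by (simp add: D_def cu sum_distrib_left)
          also have "\<dots> \<le> 2 / (q - p) * ((q - p) / 2 * (H1_norm Om (u t))\<^sup>2)"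
            using p_less_q by (intro mult_left_mono sum_sine_coeff_le uH that) auto
          also have "\<dots> = (H1_norm Om (u t))\<^sup>2" using p_less_q by simp
          finally show ?thesis .
        qed
        then have "(\<Sum>i. ennreal (D i t)) \<le> ennreal ((H1_norm Om (u t))\<^sup>2)"
          by (intro suminf_le_const) (auto simp: sum_ennreal D0 intro!: ennreal_leI)
        then show ?thesis using True \<tau> by simp
      next
        case False
        then show ?thesis using supp by (simp add: D_def)
      qed
    qed
  qed
  also have "\<dots> = (\<integral>\<^sup>+t. ennreal ((H1_norm Om (u t))\<^sup>2) \<partial>lebesgue_on {0<..<T})"
    by (simp add: nn_integral_restrict_space nn_integral_completion)
  also have "\<dots> < \<infinity>" using u by (simp add: L2_time_def)
  finally have fin: "(\<Sum>i. \<integral>\<^sup>+t. ennreal (D i t) \<partial>lborel) < \<infinity>" .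
  have fini: "(\<integral>\<^sup>+t. ennreal (D i t) \<partial>lborel) < \<infinity>" for i
  proof -
    have "(\<integral>\<^sup>+t. ennreal (D i t) \<partial>lborel) \<le> (\<Sum>i. \<integral>\<^sup>+t. ennreal (D i t) \<partial>lborel)"
      using sum_le_suminf[of "\<lambda>i. \<integral>\<^sup>+t. ennreal (D i t) \<partial>lborel" "{i}"] by simp
    then show ?thesis using fin by (rule le_less_trans)
  qed
  have Di: "integrable lborel (D i)" for i
    by (rule integrableI_bounded) (use fini[of i] D0 in auto)
  have Dsum: "summable (\<lambda>i. LINT t|lborel. D i t)"
  proof (rule summable_suminf_not_top)
    show "0 \<le> (LINT t|lborel. D i t)" for i using D0 by simp
    have "ennreal (LINT t|lborel. D i t) = (\<integral>\<^sup>+t. ennreal (D i t) \<partial>lborel)" for i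
      by (rule nn_integral_eq_integral[symmetric]) (use Di D0 in auto)
    then show "(\<Sum>i. ennreal (LINT t|lborel. D i t)) \<noteq> top" using fin by simp
  qed
  \<comment> \<open>The majorant of \<open>abs_le_freq_squares\<close>, whose second half
    \<open>(freq i * c i t)^2 / 2\<close> equals \<open>(q - p) / 4 * D i t\<close>. The indicator
    keeps the first half integrable.\<close>
  define W where "W i t = 1 / (2 * (freq i)\<^sup>2) * indicator {0<..<\<tau>} t + (q - p) / 4 * D i t" for i t
  have W: "\<bar>c i t\<bar> \<le> W i t" for i t
  proof (cases "t \<in> {0<..<\<tau>}")
    case True
    have "W i t = (1 / (freq i)\<^sup>2 + (freq i * c i t)\<^sup>2) / 2"
    proof -
      have e: "(q - p) / 4 * (2 / (q - p) * (freq i * c i t)\<^sup>2) = (freq i * c i t)\<^sup>2 / 2"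
      proof -
        have gen: "d / 4 * (2 / d * Z) = Z / 2" if "d \<noteq> 0" for d Z :: real
          using that by simp
        show ?thesis by (rule gen) (use p_less_q in simp)
      qed
      show ?thesis unfolding W_def D_def e using True by (simp add: add_divide_distrib mult.commute)
    qed
    then show ?thesis using abs_le_freq_squares[of "c i t" i] by simp
  next
    case False
    then show ?thesis using supp by (simp add: W_def D_def)
  qed
  have Wint: "has_bochner_integral lborel (W i) (1 / (2 * (freq i)\<^sup>2) * \<tau> + (q - p) / 4 * (LINT t|lborel. D i t))" for i
    unfolding W_def
  proof (intro has_bochner_integral_add has_bochner_integral_mult_right)
    show "has_bochner_integral lborel (indicator {0<..<\<tau>}) \<tau>"
      using \<tau> has_bochner_integral_real_indicator[of "{0<..<\<tau>}" lborel] by simp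
    show "has_bochner_integral lborel (D i) (integral\<^sup>L lborel (D i))"
      using Di by (rule has_bochner_integral_integrable)
  qed
  have ci: "integrable lborel (c i)" for i
  proof (rule Bochner_Integration.integrable_bound)
    show "integrable lborel (W i)" using Wint[of i] by (simp add: has_bochner_integral_iff)
    show "AE t in lborel. norm (c i t) \<le> norm (W i t)"
      using W by (intro AE_I2) (auto intro: order_trans[OF _ abs_ge_self])
  qed measurable
  have "summable (\<lambda>i. LINT t|lborel. \<bar>c i t\<bar>)"
  proof (rule summable_comparison_test'[where N = 0])
    show "summable (\<lambda>i. 1 / (freq i)\<^sup>2 * (\<tau> / 2) + (q - p) / 4 * (LINT t|lborel. D i t))"
      by (intro summable_add summable_mult summable_mult2 summable_freq Dsum)
    fix i :: nat
    have "(LINT t|lborel. \<bar>c i t\<bar>) \<le> (LINT t|lborel. W i t)"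
      using W ci[of i] Wint[of i] by (intro integral_mono) (auto simp: has_bochner_integral_iff)
    also have "\<dots> = 1 / (freq i)\<^sup>2 * (\<tau> / 2) + (q - p) / 4 * (LINT t|lborel. D i t)"
      using Wint[of i] by (simp add: has_bochner_integral_iff)
    finally show "norm (LINT t|lborel. \<bar>c i t\<bar>) \<le> 1 / (freq i)\<^sup>2 * (\<tau> / 2) + (q - p) / 4 * (LINT t|lborel. D i t)"
      by simp
  qed
  then show ?thesis using ci cm supp ae by blast
qed

text \<open>The modewise estimates are added with weights \<open>sine i x\<close> of modulus at most
  1. Their errors are summable, as \<open>u0\<close> lies in \<open>H10\<close> and the time norms
  of the coefficients are summable, so \<open>K\<close> depends on the solution but not on
  \<open>s\<close>.\<close>

lemma weak_solution_laplace:
  assumes sol: "weak_solution Om T \<alpha> A u0 u" and A: "A > 0" and \<tau>: "0 < \<tau>" "\<tau> < T"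
    and \<alpha>: "0 < \<alpha>" "\<alpha> < 1" and x: "x \<in> Om" and u0: "u0 \<in> H10 Om"
  shows "\<exists>K. \<forall>s>0. \<bar>(LINT t|lebesgue_on {0<..<\<tau>}. exp (- s * t) * point_value Om (u t) x)
    - 2 / (q - p) * (s powr (\<alpha> - 1) * (\<Sum>i. sine_coeff u0 i * sine i x / (s powr \<alpha> + A * (freq i)\<^sup>2)))\<bar>
    \<le> K * exp (- s * \<tau>) * (1 / s + 1)"
proof -
  have uL: "u \<in> L2_time T (H10 Om) (H1_norm Om)" using sol by (simp add: weak_solution_def)
  obtain w where cap: "has_caputo_deriv Om T \<alpha> (\<lambda>t. L2_into_Hm1 Om (u t - u0)) w"
    and weq: "AE t in lebesgue_on {0<..<T}. \<forall>\<Phi>\<in>H10 Om.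
      w t \<Phi> + A * (LINT x|M. weak_deriv Om (u t) x * weak_deriv Om \<Phi> x) = 0"
    using sol by (auto simp: weak_solution_def)
  obtain c where ci: "\<And>i. integrable lborel (c i)" and cm [measurable]: "\<And>i. c i \<in> borel_measurable borel"
    and supp: "\<And>i t. t \<notin> {0<..<\<tau>} \<Longrightarrow> c i t = 0" and csum: "summable (\<lambda>i. LINT t|lborel. \<bar>c i t\<bar>)"
    and ae: "AE t in lborel. t \<in> {0<..<\<tau>} \<longrightarrow> u t \<in> H10 Om \<and> sine_coeff (u t) = (\<lambda>i. c i t)"
    using sine_coeff_time_coefficients[OF uL \<tau>] by blast
  have u0L: "u0 \<in> L2 Om" by (intro H1_D(1) H10_H1 u0)
  \<comment> \<open>Testing with \<open>sine i\<close> diagonalizes the equation: integrating by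
    parts against the sine yields \<open>(freq i)^2\<close> times the coefficient.\<close>
  have weq': "AE t in lborel. t \<in> {0<..<\<tau>} \<longrightarrow> (\<forall>i. w t (sine i) = - (A * (freq i)\<^sup>2) * c i t)"
  proof -
    have "AE t in lborel. t \<in> {0<..<T} \<longrightarrow> (\<forall>\<Phi>\<in>H10 Om.
      w t \<Phi> + A * (LINT x|M. weak_deriv Om (u t) x * weak_deriv Om \<Phi> x) = 0)"
      using weq by (subst (asm) AE_lebesgue_on_iff_lborel) auto
    then show ?thesis
      using ae
    proof eventually_elim
      case (elim t)
      show ?case
      proof (intro impI allI)
        fix i assume t: "t \<in> {0<..<\<tau>}"
        then have "w t (sine i) + A * (LINT x|M. weak_deriv Om (u t) x * weak_deriv Om (sine i) x) = 0"
          using elim(1) sine_H10 \<tau> by auto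
        moreover have "u t \<in> H10 Om" "sine_coeff (u t) i = c i t" using elim(2) t by auto
        ultimately show "w t (sine i) = - (A * (freq i)\<^sup>2) * c i t"
          using sine_coeff_weak_deriv_sine[of "u t" i] by simp
      qed
    qed
  qed
  \<comment> \<open>The graph of the Caputo derivative, evaluated at \<open>sine i\<close>, with the
    value of \<open>w\<close> just found inserted under the fractional integral.\<close>
  have volterra: "AE t in lborel. t \<in> {0<..<\<tau>} \<longrightarrow>
      c i t = sine_coeff u0 i - A * (freq i)\<^sup>2 / Gamma \<alpha> * (LINT r|lborel. pker \<alpha> (t - r) * c i r)" for i
  proof -
    have "AE t in lborel. t \<in> {0<..<T} \<longrightarrow> (\<forall>\<Phi>\<in>H10 Om. L2_into_Hm1 Om (u t - u0) \<Phi> = J_frac \<alpha> w t \<Phi>)"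
      using cap unfolding has_caputo_deriv_def by (subst (asm) AE_lebesgue_on_iff_lborel) auto
    then show ?thesis
      using ae
    proof eventually_elim
      case (elim t)
      show ?case
      proof
        assume t: "t \<in> {0<..<\<tau>}"
        have "u t \<in> L2 Om" using elim(2) t by (intro H1_D(1) H10_H1) auto
        then have "sine_coeff (u t - u0) i = c i t - sine_coeff u0 i"
          using sine_coeff_diff[OF _ u0L, of "u t" i] elim(2) t by simp
        then have "L2_into_Hm1 Om (u t - u0) (sine i) = c i t - sine_coeff u0 i"
          by (simp add: L2_into_Hm1_def sine_coeff_def[of "u t - u0"])
        moreover have "L2_into_Hm1 Om (u t - u0) (sine i) = J_frac \<alpha> w t (sine i)"
          using elim(1) t \<tau> sine_H10 by auto
        moreover have "(LINT r|lebesgue_on {0<..<t}. (t - r) powr (\<alpha> - 1) * w r (sine i)) =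
            (LINT r|lborel. - (A * (freq i)\<^sup>2) * (pker \<alpha> (t - r) * c i r))"
        proof (rule integral_lebesgue_on_eq_lborel)
          show "AE r in lborel. indicator {0<..<t} r * ((t - r) powr (\<alpha> - 1) * w r (sine i)) =
              - (A * (freq i)\<^sup>2) * (pker \<alpha> (t - r) * c i r)"
            using weq'
          proof eventually_elim
            case (elim r)
            show ?case
            proof (cases "r \<in> {0<..<t}")
              case True
              then show ?thesis using elim t by (simp add: pker_def)
            next
              case False
              then have "pker \<alpha> (t - r) * c i r = 0"
                using supp[of r i] t by (cases "r < t") (auto simp: pker_def)
              then show ?thesis using False by simp
            qed
          qed
        qed measurable
        ultimately show "c i t = sine_coeff u0 i - A * (freq i)\<^sup>2 / Gamma \<alpha> * (LINT r|lborel. pker \<alpha> (t - r) * c i r)"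
          by (simp add: J_frac_def)
      qed
    qed
  qed
  define N where "N i = (LINT t|lborel. \<bar>c i t\<bar>)" for i
  have Nsum: "summable N" using csum unfolding N_def .
  have u0sum: "summable (\<lambda>i. \<bar>sine_coeff u0 i\<bar>)" by (rule summable_abs_sine_coeff[OF u0])
  define S0 where "S0 = (\<Sum>i. \<bar>sine_coeff u0 i\<bar>)"
  define S1 where "S1 = (\<Sum>i. N i)"
  have S: "0 \<le> S0" "0 \<le> S1"
    unfolding S0_def S1_def using u0sum Nsum by (auto intro!: suminf_nonneg simp: N_def)
  show ?thesis
  proof (intro exI allI impI)
    fix s :: real assume s: "s > 0"
    define L where "L i = (LINT t|lborel. exp (- s * t) * c i t)" for i
    define R where "R i = sine_coeff u0 i * s powr (\<alpha> - 1) / (s powr \<alpha> + A * (freq i)\<^sup>2)" for i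
    have LR: "\<bar>L i - R i\<bar> \<le> exp (- s * \<tau>) * (\<bar>sine_coeff u0 i\<bar> / s + N i)" for i
      unfolding L_def R_def N_def
      by (rule truncated_laplace_volterra[OF \<alpha> s \<tau>(1) _ ci supp volterra]) (use A in auto)
    define f where "f i t = exp (- s * t) * c i t * sine i x" for i t
    have f_le: "norm (f i t) \<le> \<bar>c i t\<bar>" for i t
    proof (cases "t \<in> {0<..<\<tau>}")
      case True
      have "exp (- s * t) \<le> 1" using True s by simp
      then have "exp (- s * t) * \<bar>c i t\<bar> * \<bar>sine i x\<bar> \<le> 1 * \<bar>c i t\<bar> * 1"
        by (intro mult_mono abs_sine_le) auto
      then show ?thesis by (simp add: f_def abs_mult)
    qed (use supp in \<open>simp add: f_def\<close>)
    have fint: "integrable lborel (f i)" for i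
    proof (rule Bochner_Integration.integrable_bound[OF ci[of i]])
      show "f i \<in> borel_measurable lborel" unfolding f_def by measurable
      show "AE t in lborel. norm (f i t) \<le> norm (c i t)" using f_le by simp
    qed
    \<comment> \<open>At almost every time \<open>u t\<close> lies in \<open>H10\<close>, so its
      coefficients are absolutely summable; with the summable time norms this permits exchanging sum
      and integral.\<close>
    have f_abs: "AE t in lborel. summable (\<lambda>i. norm (f i t))"
      using ae
    proof eventually_elim
      case (elim t)
      have "summable (\<lambda>i. \<bar>c i t\<bar>)"
      proof (cases "t \<in> {0<..<\<tau>}")
        case True
        then show ?thesis using elim summable_abs_sine_coeff[of "u t"] by simp
      qed (simp add: supp)
      then show ?case by (rule summable_comparison_test'[where N = 0]) (use f_le in simp)
    qed
    have f_norm: "summable (\<lambda>i. LINT t|lborel. norm (f i t))"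
    proof (rule summable_comparison_test'[OF csum, of 0])
      fix i :: nat
      have "(LINT t|lborel. norm (f i t)) \<le> (LINT t|lborel. \<bar>c i t\<bar>)"
        by (intro integral_mono f_le integrable_norm fint integrable_abs ci)
      then show "norm (LINT t|lborel. norm (f i t)) \<le> (LINT t|lborel. \<bar>c i t\<bar>)" by simp
    qed
    have f_int: "integral\<^sup>L lborel (f i) = L i * sine i x" for i
      unfolding f_def L_def by (rule Bochner_Integration.integral_mult_left_zero)
    have "(LINT t|lebesgue_on {0<..<\<tau>}. exp (- s * t) * point_value Om (u t) x) =
        (LINT t|lborel. 2 / (q - p) * (\<Sum>i. f i t))"
    proof (rule integral_lebesgue_on_eq_lborel)
      show "AE t in lborel. indicator {0<..<\<tau>} t * (exp (- s * t) * point_value Om (u t) x) = 2 / (q - p) * (\<Sum>i. f i t)"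
        using ae
      proof eventually_elim
        case (elim t)
        show ?case
        proof (cases "t \<in> {0<..<\<tau>}")
          case True
          then have uH: "u t \<in> H10 Om" and su: "sine_coeff (u t) = (\<lambda>i. c i t)" using elim by auto
          have "summable (\<lambda>i. c i t * sine i x)"
            using summable_mult_sine[OF summable_abs_sine_coeff[OF uH], of x] by (simp add: su)
          from suminf_mult[OF this, of "exp (- s * t)"]
          have "(\<Sum>i. f i t) = exp (- s * t) * (\<Sum>i. c i t * sine i x)"
            by (simp add: f_def mult.assoc)
          then show ?thesis using True
            by (simp add: point_value_H10[OF uH x] sine_series_def su)
        next
          case False
          then show ?thesis using supp[OF False] by (simp add: f_def)
        qed
      qed
      show "(\<lambda>t. 2 / (q - p) * (\<Sum>i. f i t)) \<in> borel_measurable borel"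
        unfolding f_def by measurable
    qed simp
    also have "\<dots> = 2 / (q - p) * (\<Sum>i. L i * sine i x)"
      by (simp only: Bochner_Integration.integral_mult_right_zero integral_suminf[OF fint f_abs f_norm] f_int)
    finally have G: "(LINT t|lebesgue_on {0<..<\<tau>}. exp (- s * t) * point_value Om (u t) x) = 2 / (q - p) * (\<Sum>i. L i * sine i x)" .
    have Lsum: "summable (\<lambda>i. L i * sine i x)"
      using summable_integral[OF fint f_abs f_norm] unfolding f_int .
    have bsum: "summable (\<lambda>i. exp (- s * \<tau>) * (\<bar>sine_coeff u0 i\<bar> / s + N i))"
      by (intro summable_mult summable_add summable_divide u0sum Nsum)
    have le: "norm (L i * sine i x - R i * sine i x) \<le> exp (- s * \<tau>) * (\<bar>sine_coeff u0 i\<bar> / s + N i)" for i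
    proof -
      have "norm (L i * sine i x - R i * sine i x) = \<bar>L i - R i\<bar> * \<bar>sine i x\<bar>"
        by (simp add: abs_mult[symmetric] left_diff_distrib)
      also have "\<dots> \<le> \<bar>L i - R i\<bar> * 1" by (intro mult_left_mono abs_sine_le) auto
      finally show ?thesis using LR[of i] by simp
    qed
    have dsum: "summable (\<lambda>i. L i * sine i x - R i * sine i x)"
      by (rule summable_comparison_test'[OF bsum, of 0]) (rule le)
    have Rsum: "summable (\<lambda>i. R i * sine i x)"
      using summable_diff[OF Lsum dsum] by simp
    have R_eq: "(\<Sum>i. R i * sine i x) = s powr (\<alpha> - 1) * (\<Sum>i. sine_coeff u0 i * sine i x / (s powr \<alpha> + A * (freq i)\<^sup>2))"
    proof -
      have sp: "s powr (\<alpha> - 1) \<noteq> 0" using s by simp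
      have eq: "R i * sine i x = s powr (\<alpha> - 1) * (sine_coeff u0 i * sine i x / (s powr \<alpha> + A * (freq i)\<^sup>2))" for i
        by (simp add: R_def)
      have "summable (\<lambda>i. sine_coeff u0 i * sine i x / (s powr \<alpha> + A * (freq i)\<^sup>2))"
        using Rsum sp unfolding eq by (auto simp only: summable_cmult_iff)
      then show ?thesis unfolding eq by (rule suminf_mult)
    qed
    have "norm (\<Sum>i. L i * sine i x - R i * sine i x) \<le> (\<Sum>i. exp (- s * \<tau>) * (\<bar>sine_coeff u0 i\<bar> / s + N i))"
      by (rule norm_suminf_le[OF le bsum])
    then have "\<bar>(\<Sum>i. L i * sine i x) - (\<Sum>i. R i * sine i x)\<bar> \<le> (\<Sum>i. exp (- s * \<tau>) * (\<bar>sine_coeff u0 i\<bar> / s + N i))"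
      by (simp only: suminf_diff[OF Lsum Rsum, symmetric] real_norm_def)
    also have "\<dots> = exp (- s * \<tau>) * (S0 / s + S1)"
      using u0sum Nsum
      by (simp add: suminf_mult suminf_add[symmetric] suminf_divide summable_add summable_divide S0_def S1_def)
    also have "\<dots> \<le> exp (- s * \<tau>) * ((S0 + S1) * (1 / s + 1))"
    proof (rule mult_left_mono)
      have "(S0 + S1) * (1 / s + 1) = S0 / s + S1 + (S0 + S1 / s)" using s by (simp add: field_simps)
      moreover have "0 \<le> S0 + S1 / s" using S s by simp
      ultimately show "S0 / s + S1 \<le> (S0 + S1) * (1 / s + 1)" by linarith
    qed simp
    finally have fin: "\<bar>(\<Sum>i. L i * sine i x) - (\<Sum>i. R i * sine i x)\<bar> \<le> exp (- s * \<tau>) * ((S0 + S1) * (1 / s + 1))" .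
    have "\<bar>2 / (q - p) * (\<Sum>i. L i * sine i x) - 2 / (q - p) * (\<Sum>i. R i * sine i x)\<bar> =
        2 / (q - p) * \<bar>(\<Sum>i. L i * sine i x) - (\<Sum>i. R i * sine i x)\<bar>"
      unfolding right_diff_distrib[symmetric] abs_mult using p_less_q by simp
    also have "\<dots> \<le> 2 / (q - p) * (exp (- s * \<tau>) * ((S0 + S1) * (1 / s + 1)))"
      using fin p_less_q by (intro mult_left_mono) auto
    also have "\<dots> = 2 / (q - p) * (S0 + S1) * exp (- s * \<tau>) * (1 / s + 1)" by (simp only: mult_ac)
    finally show "\<bar>(LINT t|lebesgue_on {0<..<\<tau>}. exp (- s * t) * point_value Om (u t) x)
      - 2 / (q - p) * (s powr (\<alpha> - 1) * (\<Sum>i. sine_coeff u0 i * sine i x / (s powr \<alpha> + A * (freq i)\<^sup>2)))\<bar>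
      \<le> 2 / (q - p) * (S0 + S1) * exp (- s * \<tau>) * (1 / s + 1)"
      unfolding G R_eq .
  qed
qed

end

section \<open>Homogenized coefficients\<close>

lemma homogenized_bounds:
  assumes l1: "0 < l1" and a: "a \<in> Linfty {0<..<l1}" and \<nu>: "0 < \<nu>"
    and bounds: "\<forall>y\<in>closure {0<..<l1}. \<nu> \<le> a y \<and> a y \<le> \<mu>"
  shows "integrable (lebesgue_on {0<..<l1}) (\<lambda>y. 1 / a y)" "0 < homogenized {0<..<l1} a"
    "homogenized {0<..<l1} a = l1 / (LINT y|lebesgue_on {0<..<l1}. 1 / a y)"
proof -
  interpret Y: interval 0 l1 by unfold_locales fact
  have b: "\<nu> \<le> a y" "a y \<le> \<mu>" if "y \<in> {0<..<l1}" for y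
    using bounds that l1 by auto
  have am: "a \<in> borel_measurable Y.M" using a by (simp add: Linfty_def)
  have \<mu>: "0 < \<mu>" using b[of "l1 / 2"] l1 \<nu> by simp
  show int: "integrable Y.M (\<lambda>y. 1 / a y)"
  proof (rule Y.integrable_const_bound[where B = "1 / \<nu>"])
    show "AE y in Y.M. norm (1 / a y) \<le> 1 / \<nu>"
    proof (rule AE_I2)
      fix y assume "y \<in> space Y.M"
      then have "\<nu> \<le> a y" using b by simp
      then show "norm (1 / a y) \<le> 1 / \<nu>" using \<nu> by (simp add: frac_le)
    qed
  qed (use am in measurable)
  have "0 < (LINT y|Y.M. 1 / \<mu>)" using l1 \<mu> Y.measure_M by simp
  also have "\<dots> \<le> (LINT y|Y.M. 1 / a y)"
  proof (rule integral_mono[OF _ int])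
    fix y assume "y \<in> space Y.M"
    then show "1 / \<mu> \<le> 1 / a y" using b[of y] \<nu> by (simp add: frac_le)
  qed simp
  finally have pos: "0 < (LINT y|Y.M. 1 / a y)" .
  show "homogenized {0<..<l1} a = l1 / (LINT y|lebesgue_on {0<..<l1}. 1 / a y)"
    using l1 by (simp add: homogenized_def mean_def)
  then show "0 < homogenized {0<..<l1} a" using pos l1 by simp
qed

text \<open>The order is reversed by the inner reciprocal and again by the outer one. In the
  equality case the nonnegative difference of reciprocals has integral 0, hence vanishes almost
  everywhere.\<close>

lemma homogenized_mono:
  assumes l1: "0 < l1" and a1: "a1 \<in> Linfty {0<..<l1}" and a2: "a2 \<in> Linfty {0<..<l1}" and \<nu>: "0 < \<nu>"
    and b1: "\<forall>y\<in>closure {0<..<l1}. \<nu> \<le> a1 y \<and> a1 y \<le> \<mu>"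
    and b2: "\<forall>y\<in>closure {0<..<l1}. \<nu> \<le> a2 y \<and> a2 y \<le> \<mu>"
    and le: "\<forall>y\<in>closure {0<..<l1}. a1 y \<ge> a2 y"
  shows "homogenized {0<..<l1} a2 \<le> homogenized {0<..<l1} a1"
    "homogenized {0<..<l1} a2 = homogenized {0<..<l1} a1 \<Longrightarrow> AE y in lebesgue_on {0<..<l1}. a1 y = a2 y"
proof -
  let ?Y = "lebesgue_on {0<..<l1}"
  note h1 = homogenized_bounds[OF l1 a1 \<nu> b1] and h2 = homogenized_bounds[OF l1 a2 \<nu> b2]
  have pt: "\<nu> \<le> a2 y" "a2 y \<le> a1 y" if "y \<in> {0<..<l1}" for y
    using b2 le that l1 by auto
  have inv: "1 / a1 y \<le> 1 / a2 y" if "y \<in> space ?Y" for y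
    using pt[of y] that \<nu> by (simp add: frac_le)
  have mono: "(LINT y|?Y. 1 / a1 y) \<le> (LINT y|?Y. 1 / a2 y)"
    by (rule integral_mono[OF h1(1) h2(1) inv])
  have pos: "0 < (LINT y|?Y. 1 / a1 y)" using h1(2,3) l1 by (simp add: zero_less_divide_iff)
  show "homogenized {0<..<l1} a2 \<le> homogenized {0<..<l1} a1"
    unfolding h1(3) h2(3) using mono pos l1 by (intro divide_left_mono) auto
  assume "homogenized {0<..<l1} a2 = homogenized {0<..<l1} a1"
  then have "(LINT y|?Y. 1 / a2 y) = (LINT y|?Y. 1 / a1 y)"
    unfolding h1(3) h2(3) using pos mono l1 by (simp add: frac_eq_eq)
  then have zero: "(LINT y|?Y. 1 / a2 y - 1 / a1 y) = 0" using h1(1) h2(1) by simp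
  have "AE y in ?Y. 0 \<le> 1 / a2 y - 1 / a1 y"
    by (rule AE_I2) (simp only: diff_ge_0_iff_ge inv)
  then have "AE y in ?Y. 1 / a2 y - 1 / a1 y = 0"
    using integral_nonneg_eq_0_iff_AE[OF Bochner_Integration.integrable_diff[OF h2(1) h1(1)]] zero by blast
  moreover have "AE y in ?Y. y \<in> {0<..<l1}" by (rule AE_I2) simp
  ultimately show "AE y in ?Y. a1 y = a2 y"
  proof eventually_elim
    case (elim y)
    then show ?case using pt[of y] \<nu> by simp
  qed
qed

theorem proposition3p16:
  fixes \<alpha> T \<nu> \<mu> l1 p q x0 t1 :: real
    and Y \<Omega> :: "real set"
    and a1 a2 u01 u02 :: "real \<Rightarrow> real"
    and u1 u2 :: "real \<Rightarrow> real \<Rightarrow> real"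
  assumes "0 < \<alpha>" "\<alpha> < 1" "0 < T" "0 < \<nu>" "\<nu> < \<mu>"
    and "0 < l1" "Y = {0<..<l1}"
    and "p < q" "\<Omega> = {p<..<q}"
    and "x0 \<in> \<Omega>" "t1 \<in> {0<..<T}"
    and "a1 \<in> Linfty Y" "a2 \<in> Linfty Y"
    and "\<forall>y. a1 (y + l1) = a1 y" "\<forall>y. a2 (y + l1) = a2 y"
    and "\<forall>y\<in>closure Y. \<nu> \<le> a1 y \<and> a1 y \<le> \<mu>"
    and "\<forall>y\<in>closure Y. \<nu> \<le> a2 y \<and> a2 y \<le> \<mu>"
    and "\<forall>y\<in>closure Y. a1 y \<ge> a2 y"
    and "u01 \<in> H2 \<Omega> \<inter> H10 \<Omega>" "u02 \<in> H2 \<Omega> \<inter> H10 \<Omega>"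
    and "weak_solution \<Omega> T \<alpha> (homogenized Y a1) u01 u1"
    and "weak_solution \<Omega> T \<alpha> (homogenized Y a2) u02 u2"
    and "point_value \<Omega> (P1 \<Omega> u01) x0 \<noteq> 0"
    and "point_value \<Omega> (P1 \<Omega> u02) x0 \<noteq> 0"
    and "\<forall>t. 0 < t \<and> t < t1 \<longrightarrow> point_value \<Omega> (u1 t) x0 = point_value \<Omega> (u2 t) x0"
  shows "AE y in lebesgue_on Y. a1 y = a2 y"
proof -
  interpret interval p q by unfold_locales fact
  have O: "\<Omega> = Om" and Y: "Y = {0<..<l1}" by fact+
  have x0: "x0 \<in> Om" using assms(10) O by simp
  have t1: "0 < t1" "t1 < T" using assms(11) by simp_all
  let ?A1 = "homogenized Y a1" and ?A2 = "homogenized Y a2"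
  note a = assms(6) assms(12,13)[unfolded Y] assms(4) assms(16,17,18)[unfolded Y]
  have A: "0 < ?A1" "0 < ?A2"
    unfolding Y using homogenized_bounds(2)[OF a(1,2,4,5)] homogenized_bounds(2)[OF a(1,3,4,6)] .
  have le: "?A2 \<le> ?A1" and eq_imp: "?A2 = ?A1 \<Longrightarrow> AE y in lebesgue_on Y. a1 y = a2 y"
    unfolding Y using homogenized_mono[OF a] .
  have u0: "u01 \<in> H10 Om" "u02 \<in> H10 Om" using assms(19,20) O by simp_all
  have "\<not> ?A2 < ?A1"
  proof
    assume lt: "?A2 < ?A1"
    let ?G1 = "\<lambda>s. LINT t|lebesgue_on {0<..<t1}. exp (- s * t) * point_value Om (u1 t) x0"
    let ?G2 = "\<lambda>s. LINT t|lebesgue_on {0<..<t1}. exp (- s * t) * point_value Om (u2 t) x0"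
    let ?F1 = "\<lambda>s. s powr (\<alpha> - 1) * (\<Sum>i. sine_coeff u01 i * sine i x0 / (s powr \<alpha> + ?A1 * (freq i)\<^sup>2))"
    let ?F2 = "\<lambda>s. s powr (\<alpha> - 1) * (\<Sum>i. sine_coeff u02 i * sine i x0 / (s powr \<alpha> + ?A2 * (freq i)\<^sup>2))"
    let ?d = "2 / (q - p)"
    have w: "weak_solution Om T \<alpha> ?A1 u01 u1" "weak_solution Om T \<alpha> ?A2 u02 u2" using assms(21,22) O by simp_all
    obtain K1 where K1: "\<And>s. s > 0 \<Longrightarrow> \<bar>?G1 s - ?d * ?F1 s\<bar> \<le> K1 * exp (- s * t1) * (1 / s + 1)"
      using weak_solution_laplace[OF w(1) A(1) t1 assms(1,2) x0 u0(1)] by blast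
    obtain K2 where K2: "\<And>s. s > 0 \<Longrightarrow> \<bar>?G2 s - ?d * ?F2 s\<bar> \<le> K2 * exp (- s * t1) * (1 / s + 1)"
      using weak_solution_laplace[OF w(2) A(2) t1 assms(1,2) x0 u0(2)] by blast
    \<comment> \<open>The truncated transforms involve only times in \<open>{0<..<t1}\<close>, so
      the observation makes them equal exactly, with no further error.\<close>
    have G: "?G1 s = ?G2 s" for s
      by (intro Bochner_Integration.integral_cong refl) (use assms(25) t1 in \<open>simp add: O\<close>)
    have "\<bar>?F1 s - ?F2 s\<bar> \<le> (q - p) / 2 * (K1 + K2) * exp (- s * t1) * (1 / s + 1)" if s: "s > 0" for s
    proof -
      have d: "?d > 0" using p_less_q by simp
      have "?d * \<bar>?F1 s - ?F2 s\<bar> = \<bar>?d * (?F1 s - ?F2 s)\<bar>" using d by (simp only: abs_mult abs_of_pos)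
      also have "\<dots> = \<bar>?d * ?F1 s - ?d * ?F2 s\<bar>" by (simp only: right_diff_distrib)
      also have "\<dots> \<le> K1 * exp (- s * t1) * (1 / s + 1) + K2 * exp (- s * t1) * (1 / s + 1)"
        using K1[OF s] K2[OF s] G[of s] by linarith
      also have "\<dots> = (K1 + K2) * exp (- s * t1) * (1 / s + 1)" by (simp only: distrib_right)
      finally have "(q - p) / 2 * (?d * \<bar>?F1 s - ?F2 s\<bar>) \<le> (q - p) / 2 * ((K1 + K2) * exp (- s * t1) * (1 / s + 1))"
        using p_less_q by (intro mult_left_mono) auto
      moreover have "(q - p) / 2 * (?d * \<bar>?F1 s - ?F2 s\<bar>) = \<bar>?F1 s - ?F2 s\<bar>"
      proof -
        have gen: "c / 2 * (2 / c * X) = X" if "c \<noteq> 0" for c X :: real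
          using that by simp
        show ?thesis by (rule gen) (use p_less_q in simp)
      qed
      ultimately show ?thesis by (simp only: mult.assoc)
    qed
    note bound = this
    have sm: "summable (\<lambda>i. \<bar>sine_coeff u i * sine i x0\<bar>)" if "u \<in> H10 Om" for u
      by (rule summable_comparison_test'[OF summable_abs_sine_coeff[OF that], of 0])
        (simp add: abs_mult mult_left_le abs_sine_le)
    \<comment> \<open>The second solution has the smaller coefficient and takes the primed role, so
      the contradiction falls on the first mode of \<open>u02\<close>.\<close>
    from bound have "sine_coeff u02 0 * sine 0 x0 = 0"
    proof (rule leading_coefficient_zero[rotated -1])
      show "summable (\<lambda>i. \<bar>sine_coeff u01 i * sine i x0\<bar>)" "summable (\<lambda>i. \<bar>sine_coeff u02 i * sine i x0\<bar>)"
        by (intro sm u0)+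
      show "0 < (freq 0)\<^sup>2" using freq_pos[of 0] by simp
      show "(freq 0)\<^sup>2 \<le> (freq i)\<^sup>2" for i
        using freq_mono[of i] freq_pos[of 0] by (simp add: power_mono)
      show "(freq 0)\<^sup>2 < (freq 1)\<^sup>2"
        using freq_mono[of 1] freq_inj[of 0 1] freq_pos[of 0] by (intro power_strict_mono) auto
      have "freq 1 \<le> freq (Suc i)" for i
        using p_less_q by (simp add: freq_def divide_right_mono)
      then show "(freq 1)\<^sup>2 \<le> (freq (Suc i))\<^sup>2" for i
        using freq_pos[of 1] by (simp add: power_mono)
    qed (assumption | fact A lt assms(1,2) t1)+
    then have "sine_coeff u02 0 = 0" using sine_0_pos[OF x0] by simp
    moreover have "u02 \<in> L2 Om" by (intro H1_D(1) H10_H1 u0)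
    ultimately have "point_value Om (P1 Om u02) x0 = 0"
      using P1_point_value[OF _ x0, of u02] by simp
    then show False using assms(24) O by simp
  qed
  then show ?thesis using le eq_imp by linarith
qed

end
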